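(* Let $E$ be the elliptic curve $y^2=x^3+1$ over $\mathbb{Q}$, and for a prime $p>3$ and $k\in\mathbb{N}$ let $N_p(k)$ be the number of $\mathbb{F}_{p^k}$-rational points of the reduction of $E$ modulo $p$ (including the point at infinity). Then for every prime $p\equiv 1\pmod 6$, $$r_{1,3}(p)=\tfrac13 N_p(1).$$ Moreover, the three-term relation $$3r_{1,3}(p^k)=\begin{cases}N_p(k)+3p\, r_{1,3}(p^{k-2}), & k\ge 3,\\ N_p(k), & k=1,2,\end{cases}$$ holds for every $k\ge1$ when $p\equiv1\pmod6$, and for every even $k\ge 2$ when $p>3$ is any prime. Consequently, for every integer $k\ge 0$, $$r_{1,3}(p^{2k+1})=\tfrac13\big[N_p(2k+1)+pN_p(2k-1)+\cdots+p^kN_p(1)\big]\quad\text{for primes } p\equiv 1\pmod 6,$$ and $$r_{1,3}(p^{2k+2})=\tfrac13\big[N_p(2k+2)+pN_p(2k)+\cdots+p^kN_p(2)\big]\quad\text{for primes } p>3.$$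
   Context: For a nonnegative integer $n$, $r_{1,3}(n)$ denotes the number of vectors $\vec{x}\in\mathbb{Z}^4$ with $x_1^2+x_2^2+x_3^2+x_4^2=n$ and $x_i\equiv 1\pmod 3$ for all $i$. *)

theory Defs
  imports
    "HOL-Analysis.Finite_Cartesian_Product"
    "HOL-Number_Theory.Residues"
    "HOL-Algebra.Algebraic_Closure"
begin

lemma (in cring) binomial_ring:
  assumes x: "x \<in> carrier R" and y: "y \<in> carrier R"
  shows "(x \<oplus> y) [^] n =
           (\<Oplus>k\<in>{..n}. [(n choose k)] \<cdot> (x [^] k \<otimes> y [^] (n - k)))"
proof (induction n)
  case 0
  show ?case using x y by (simp add: finsum_0)
next
  case (Suc n)
  let ?t = "\<lambda>(m::nat) (k::nat). x [^] k \<otimes> y [^] (m - k)"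
  let ?S = "\<Oplus>k\<in>{..n}. [(n choose k)] \<cdot> ?t n k"
  have tc: "?t m k \<in> carrier R" for m k using x y by simp
  have xS: "?S \<otimes> x = (\<Oplus>k\<in>{..n}. [(n choose k)] \<cdot> ?t (Suc n) (Suc k))"
  proof -
    have "?S \<otimes> x = (\<Oplus>k\<in>{..n}. ([(n choose k)] \<cdot> ?t n k) \<otimes> x)"
      by (rule finsum_ldistr) (use x y in auto)
    also have "\<dots> = (\<Oplus>k\<in>{..n}. [(n choose k)] \<cdot> ?t (Suc n) (Suc k))"
    proof (rule finsum_cong')
      fix k assume "k \<in> {..n}"
      show "([(n choose k)] \<cdot> ?t n k) \<otimes> x = [(n choose k)] \<cdot> ?t (Suc n) (Suc k)"
        using x y by (subst add_pow_ldistr) (auto simp: m_ac)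
    qed (use x y in auto)
    finally show ?thesis .
  qed
  have yS: "?S \<otimes> y = (\<Oplus>k\<in>{..Suc n}. [(n choose k)] \<cdot> ?t (Suc n) k)"
  proof -
    have "?S \<otimes> y = (\<Oplus>k\<in>{..n}. ([(n choose k)] \<cdot> ?t n k) \<otimes> y)"
      by (rule finsum_ldistr) (use x y in auto)
    also have "\<dots> = (\<Oplus>k\<in>{..n}. [(n choose k)] \<cdot> ?t (Suc n) k)"
    proof (rule finsum_cong')
      fix k assume "k \<in> {..n}"
      hence "Suc n - k = Suc (n - k)" by auto
      thus "([(n choose k)] \<cdot> ?t n k) \<otimes> y = [(n choose k)] \<cdot> ?t (Suc n) k"
        using x y by (subst add_pow_ldistr) (auto simp: m_ac)
    qed (use x y in auto)
    also have "\<dots> = (\<Oplus>k\<in>{..Suc n}. [(n choose k)] \<cdot> ?t (Suc n) k)"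
      using x y by (subst finsum_Suc) (auto simp: binomial_eq_0)
    finally show ?thesis .
  qed
  have "(x \<oplus> y) [^] Suc n = ?S \<otimes> x \<oplus> ?S \<otimes> y"
    using x y Suc.IH by (simp add: r_distr finsum_closed)
  also have "\<dots> = (\<Oplus>k\<in>{..n}. [(n choose k)] \<cdot> ?t (Suc n) (Suc k)) \<oplus>
      ((\<Oplus>k\<in>{..n}. [(n choose Suc k)] \<cdot> ?t (Suc n) (Suc k)) \<oplus> [(n choose 0)] \<cdot> ?t (Suc n) 0)"
    unfolding xS yS using x y by (subst finsum_Suc2) (auto simp del: diff_Suc_Suc)
  also have "\<dots> = ((\<Oplus>k\<in>{..n}. [(n choose k)] \<cdot> ?t (Suc n) (Suc k)) \<oplus>
      (\<Oplus>k\<in>{..n}. [(n choose Suc k)] \<cdot> ?t (Suc n) (Suc k))) \<oplus> [(n choose 0)] \<cdot> ?t (Suc n) 0"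
    using x y by (intro a_assoc[symmetric]) (auto intro!: finsum_closed)
  also have "(\<Oplus>k\<in>{..n}. [(n choose k)] \<cdot> ?t (Suc n) (Suc k)) \<oplus>
      (\<Oplus>k\<in>{..n}. [(n choose Suc k)] \<cdot> ?t (Suc n) (Suc k)) =
      (\<Oplus>k\<in>{..n}. [(n choose k)] \<cdot> ?t (Suc n) (Suc k) \<oplus> [(n choose Suc k)] \<cdot> ?t (Suc n) (Suc k))"
    by (rule finsum_addf[symmetric]) (use x y in auto)
  also have "\<dots> = (\<Oplus>k\<in>{..n}. [(Suc n choose Suc k)] \<cdot> ?t (Suc n) (Suc k))"
    by (rule finsum_cong') (use x y in \<open>auto simp: add.nat_pow_mult\<close>)
  also have "\<dots> \<oplus> [(n choose 0)] \<cdot> ?t (Suc n) 0 =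
      (\<Oplus>k\<in>{..Suc n}. [(Suc n choose k)] \<cdot> ?t (Suc n) k)"
    using x y by (subst finsum_Suc2) (auto simp del: diff_Suc_Suc binomial_Suc_Suc)
  finally show ?case .
qed

lemma (in cring) add_pow_char_dvd:
  assumes "[(p::nat)] \<cdot> \<one> = \<zero>" "p dvd m" "x \<in> carrier R"
  shows "[m] \<cdot> x = \<zero>"
proof -
  obtain c where c: "m = p * c" using assms(2) by auto
  have "[p] \<cdot> x = ([p] \<cdot> \<one>) \<otimes> x" using assms(3) add_pow_ldistr[of \<one> x p] by simp
  also have "\<dots> = \<zero>" using assms by simp
  finally have "[p] \<cdot> x = \<zero>" .
  thus ?thesis using assms(3) by (simp add: c add.nat_pow_pow[symmetric])
qed

lemma (in cring) frobenius_add: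
  assumes p: "Factorial_Ring.prime (p::nat)" and ch: "[p] \<cdot> \<one> = \<zero>"
    and x: "x \<in> carrier R" and y: "y \<in> carrier R"
  shows "(x \<oplus> y) [^] p = x [^] p \<oplus> y [^] p"
proof -
  obtain m where m: "p = Suc m" using prime_gt_0_nat[OF p] by (cases p) auto
  let ?f = "\<lambda>k. [(p choose k)] \<cdot> (x [^] k \<otimes> y [^] (p - k))"
  have fc: "?f k \<in> carrier R" for k using x y by simp
  have "(x \<oplus> y) [^] p = (\<Oplus>k\<in>{..p}. ?f k)" by (rule binomial_ring[OF x y])
  also have "\<dots> = (\<Oplus>k\<in>{..p}. if k \<in> {0, p} then ?f k else \<zero>)"
  proof (rule finsum_cong')
    fix k assume "k \<in> {..p}"
    show "?f k = (if k \<in> {0, p} then ?f k else \<zero>)"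
    proof (cases "k \<in> {0, p}")
      case False
      hence "p dvd (p choose k)" using \<open>k \<in> {..p}\<close> prime_gt_0_nat[OF p] p
        by (intro dvd_choose_prime) auto
      thus ?thesis using False add_pow_char_dvd[OF ch] x y by simp
    qed simp
  qed (use fc in auto)
  also have "\<dots> = (\<Oplus>k\<in>{0, p}. ?f k)"
    using x y by (intro add.finprod_mono_neutral_cong_right) auto
  also have "\<dots> = ?f 0 \<oplus> ?f p" 
  proof -
    have "(\<Oplus>k\<in>{0, p}. ?f k) = ?f 0 \<oplus> (\<Oplus>k\<in>{p}. ?f k)"
      by (rule finsum_insert) (use fc m in blast)+
    also have "(\<Oplus>k\<in>{p}. ?f k) = ?f p \<oplus> (\<Oplus>k\<in>{}. ?f k)"
      by (rule finsum_insert) (use fc in blast)+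
    finally show ?thesis using fc[of p] by (simp only: finsum_empty r_zero)
  qed
  also have "\<dots> = x [^] p \<oplus> y [^] p" using x y by (simp add: a_comm)
  finally show ?thesis .
qed

lemma (in cring) frobenius_pow_add:
  assumes p: "Factorial_Ring.prime (p::nat)" and ch: "[p] \<cdot> \<one> = \<zero>"
    and x: "x \<in> carrier R" and y: "y \<in> carrier R"
  shows "(x \<oplus> y) [^] (p ^ k) = x [^] (p ^ k) \<oplus> y [^] (p ^ k)"
proof (induction k)
  case 0 show ?case using x y by simp
next
  case (Suc k)
  have *: "z [^] (p ^ Suc k) = (z [^] (p ^ k)) [^] p" if "z \<in> carrier R" for z
    using that by (simp add: nat_pow_pow mult.commute[of p])
  show ?case using x y Suc.IH by (simp add: * frobenius_add[OF p ch] del: power_Suc)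
qed

lemma (in cring) frobenius_pow_minus:
  assumes p: "Factorial_Ring.prime (p::nat)" and ch: "[p] \<cdot> \<one> = \<zero>"
    and x: "x \<in> carrier R"
  shows "(\<ominus> x) [^] (p ^ k) = \<ominus> (x [^] (p ^ k))"
proof -
  have "x [^] (p ^ k) \<oplus> (\<ominus> x) [^] (p ^ k) = (x \<oplus> \<ominus> x) [^] (p ^ k)"
    using frobenius_pow_add[OF p ch x, of "\<ominus> x"] x by simp
  also have "\<dots> = \<zero>" using x prime_gt_0_nat[OF p] by (simp add: r_neg nat_pow_zero)
  finally show ?thesis using x by (metis a_comm a_inv_closed minus_equality nat_pow_closed)
qed


lemma (in ring_hom_ring) hom_add_pow_nat:
  "x \<in> carrier R \<Longrightarrow> h ([(n::nat)] \<cdot>\<^bsub>R\<^esub> x) = [n] \<cdot>\<^bsub>S\<^esub> h x"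
  by (induction n) simp_all

lemma (in algebraically_closed) card_roots_frobenius:
  assumes p: "Factorial_Ring.prime (p::nat)" and ch: "[p] \<cdot> \<one> = \<zero>" and k: "k > 0"
  shows "card {x \<in> carrier L. x [^] (p ^ k) = x} = p ^ k"
proof -
  let ?P = "poly_ring L"
  define q where "q = p ^ k"
  have q: "q > 1" unfolding q_def using prime_gt_1_nat[OF p] k by (intro one_less_power) auto
  interpret UP: domain ?P by (rule univ_poly_is_domain[OF carrier_is_subring])
  interpret C: ring_hom_ring L ?P poly_of_const
    using canonical_embedding_ring_hom[OF carrier_is_subring] by simp
  have chP: "[p] \<cdot>\<^bsub>?P\<^esub> \<one>\<^bsub>?P\<^esub> = \<zero>\<^bsub>?P\<^esub>"
    using C.hom_add_pow_nat[of \<one> p] ch by simp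
  have X: "X \<in> carrier ?P" and polX: "polynomial (carrier L) X"
    using var_closed[OF carrier_is_subring] by auto
  define f where "f = X [^]\<^bsub>?P\<^esub> q \<ominus>\<^bsub>?P\<^esub> X"
  have f: "f \<in> carrier ?P" unfolding f_def using X by simp
  have deg: "degree f = q"
  proof -
    have d1: "degree (X [^]\<^bsub>?P\<^esub> q) = q"
      unfolding unitary_monom_eq_var_pow[OF carrier_is_subring, symmetric] by (simp add: monom_def)
    have d2: "degree (\<ominus>\<^bsub>?P\<^esub> X) = 1"
      using univ_poly_a_inv_degree[OF carrier_is_subring X] by (simp add: var_def)
    have "polynomial (carrier L) (X [^]\<^bsub>?P\<^esub> q)" "polynomial (carrier L) (\<ominus>\<^bsub>?P\<^esub> X)"
      using X UP.nat_pow_closed UP.a_inv_closed by (simp_all add: univ_poly_carrier)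
    from poly_add_degree_eq[OF carrier_is_subring this] d1 d2 q
    show ?thesis unfolding f_def a_minus_def by (simp add: univ_poly_add)
  qed
  hence f0: "f \<noteq> []" using q by auto
  have evf: "eval f a = a [^] q \<ominus> a" if a: "a \<in> carrier L" for a
  proof -
    interpret E: ring_hom_cring ?P L "\<lambda>g. eval g a"
      by (rule eval_cring_hom[OF carrier_is_subring a])
    have "eval f a = (eval X a) [^] q \<oplus> \<ominus> (eval X a)"
      unfolding f_def a_minus_def using X by (simp add: E.hom_a_inv)
    thus ?thesis using a by (simp only: eval_var a_minus_def)
  qed
  have root: "is_root f a \<longleftrightarrow> a \<in> carrier L \<and> a [^] q = a" for a
    using f0 evf unfolding is_root_def by (metis nat_pow_closed r_right_minus_eq)
  have mult1: "count (roots f) a = 1" if ar: "is_root f a" for a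
  proof -
    have a: "a \<in> carrier L" and aq: "a [^] q = a" using ar root by auto
    define A where "A = poly_of_const a"
    define d where "d = [\<one>, \<ominus> a]"
    have A: "A \<in> carrier ?P" unfolding A_def using a by simp
    have d: "d \<in> carrier ?P" unfolding d_def using a
      by (simp add: univ_poly_carrier[symmetric] polynomial_def)
    have "d = X \<ominus>\<^bsub>?P\<^esub> A"
    proof -
      have "\<ominus>\<^bsub>?P\<^esub> A = poly_of_const (\<ominus> a)" unfolding A_def using a by simp
      thus ?thesis using a
        by (auto simp: d_def a_minus_def var_def univ_poly_add poly_of_const_def)
    qed
    hence Xd: "X = d \<oplus>\<^bsub>?P\<^esub> A" using X A d by (metis UP.add.inv_solve_right' UP.minus_eq)
    have Aq: "A [^]\<^bsub>?P\<^esub> q = A" unfolding A_def using C.hom_nat_pow[OF a, of q] aq by simp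
    have "X [^]\<^bsub>?P\<^esub> q = d [^]\<^bsub>?P\<^esub> q \<oplus>\<^bsub>?P\<^esub> A"
      using UP.frobenius_pow_add[OF p chP d A, of k] Aq unfolding Xd q_def by simp
    hence f1: "f = d [^]\<^bsub>?P\<^esub> q \<ominus>\<^bsub>?P\<^esub> d"
      unfolding f_def using A d Xd
      by (simp add: UP.minus_eq UP.minus_add UP.a_ac UP.r_neg1 UP.r_neg2 UP.r_neg)
    define Q where "Q = d [^]\<^bsub>?P\<^esub> (q - 1) \<ominus>\<^bsub>?P\<^esub> \<one>\<^bsub>?P\<^esub>"
    have Q: "Q \<in> carrier ?P" unfolding Q_def using d by simp
    have "d [^]\<^bsub>?P\<^esub> q = d \<otimes>\<^bsub>?P\<^esub> d [^]\<^bsub>?P\<^esub> (q - 1)"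
      using d q UP.nat_pow_Suc2[OF d, of "q - 1"] by simp
    hence fQ: "f = d \<otimes>\<^bsub>?P\<^esub> Q"
      unfolding f1 Q_def using d by (simp add: UP.minus_eq UP.r_distr UP.r_minus)
    have Q0: "Q \<noteq> []"
      using fQ f0 d UP.r_null[OF d] by (auto simp: univ_poly_zero)
    interpret E: ring_hom_cring ?P L "\<lambda>g. eval g a"
      by (rule eval_cring_hom[OF carrier_is_subring a])
    have "eval d a = \<zero>" using a by (simp add: d_def r_neg)
    moreover have "eval Q a = (eval d a) [^] (q - 1) \<oplus> \<ominus> \<one>"
      unfolding Q_def a_minus_def using d E.hom_a_inv[of "\<one>\<^bsub>?P\<^esub>"] by simp
    ultimately have "eval Q a = \<ominus> \<one>" using q by (simp add: nat_pow_zero)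
    hence "\<not> is_root Q a" unfolding is_root_def
      by (metis a_inv_closed minus_minus minus_zero one_closed one_not_zero)
    hence "count (roots Q) a = 0"
      using roots_mem_iff_is_root[OF Q] by (simp add: count_eq_zero_iff)
    thus ?thesis
      using poly_mult_degree_one_monic_imp_same_roots[OF a Q Q0] fQ by (simp add: d_def)
  qed
  have setr: "set_mset (roots f) = {x \<in> carrier L. x [^] q = x}"
    using roots_mem_iff_is_root[OF f] root by auto
  have "size (roots f) = (\<Sum>a\<in>set_mset (roots f). count (roots f) a)"
    by (rule size_multiset_overloaded_eq)
  also have "\<dots> = (\<Sum>a\<in>set_mset (roots f). 1)"
    by (rule sum.cong) (use mult1 roots_mem_iff_is_root[OF f] in auto)
  also have "\<dots> = card {x \<in> carrier L. x [^] q = x}" by (simp add: setr)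
  finally show ?thesis
    using roots_over_carrier[OF f] deg unfolding splitted_def q_def by simp
qed

lemma (in field) frobenius_fixed_subfield:
  assumes p: "Factorial_Ring.prime (p::nat)" and ch: "[p] \<cdot> \<one> = \<zero>"
  shows "subfield {x \<in> carrier R. x [^] (p ^ k) = x} R"
proof (rule subfieldI')
  show "subring {x \<in> carrier R. x [^] (p ^ k) = x} R"
    by (rule subringI)
      (auto simp: nat_pow_distrib frobenius_pow_add[OF p ch] frobenius_pow_minus[OF p ch])
next
  fix x assume "x \<in> {x \<in> carrier R. x [^] (p ^ k) = x} - {\<zero>}"
  hence x: "x \<in> Units R" "x \<in> carrier R" "x [^] (p ^ k) = x" by (auto simp: field_Units)
  have "x \<otimes> (inv x) [^] (p ^ k) = x [^] (p ^ k) \<otimes> (inv x) [^] (p ^ k)"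
    by (simp only: x(3))
  also have "\<dots> = (x \<otimes> inv x) [^] (p ^ k)"
    using x by (intro nat_pow_distrib[symmetric]) auto
  also have "\<dots> = \<one>" using x by simp
  finally have "inv x = (inv x) [^] (p ^ k)" using x by (intro comm_inv_char) auto
  thus "inv x \<in> {x \<in> carrier R. x [^] (p ^ k) = x}" using x by auto
qed

text \<open>Choosing the field of order \<open>q\<close> is harmless: all of them are isomorphic, and for every
  prime power \<open>q\<close> one exists, by the lemma that follows.\<close>

definition finite_field :: "nat \<Rightarrow> nat ring"
  where "finite_field q = (SOME F. field F \<and> order F = q)"

lemma finite_field_exists:
  assumes p: "Factorial_Ring.prime (p::nat)" and k: "k > 0"
  shows "\<exists>F :: nat ring. field F \<and> order F = p ^ k"
proof -
  define Z where "Z = residue_ring (int p)"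
  interpret Z: residues_prime p Z by unfold_locales (use p Z_def in auto)
  have chZ: "[p] \<cdot>\<^bsub>Z\<^esub> \<one>\<^bsub>Z\<^esub> = \<zero>\<^bsub>Z\<^esub>"
  proof -
    have "[n] \<cdot>\<^bsub>Z\<^esub> \<one>\<^bsub>Z\<^esub> = int n mod int p" for n
      by (induction n)
        (simp_all add: Z.res_zero_eq Z.res_add_eq Z.res_one_eq mod_add_right_eq mod_add_left_eq add.commute)
    thus ?thesis by (simp add: Z.res_zero_eq)
  qed
  define L where "L = Z.alg_closure"
  interpret L: algebraic_closure L "Z.indexed_const ` carrier Z"
    unfolding L_def by (rule Z.alg_closureE(1))
  interpret h: ring_hom_ring Z L Z.indexed_const
    using Z.alg_closureE(2) unfolding L_def[symmetric]
    by (intro ring_hom_ringI2 Z.ring_axioms L.ring_axioms)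
  have ch: "[p] \<cdot>\<^bsub>L\<^esub> \<one>\<^bsub>L\<^esub> = \<zero>\<^bsub>L\<^esub>"
    using h.hom_add_pow_nat[of "\<one>\<^bsub>Z\<^esub>" p] chZ by simp
  define K where "K = {x \<in> carrier L. x [^]\<^bsub>L\<^esub> (p ^ k) = x}"
  let ?K = "L \<lparr> carrier := K \<rparr>"
  have "subfield K L" unfolding K_def by (rule L.frobenius_fixed_subfield[OF p ch])
  then interpret K: field ?K by (rule L.subfield_iff(2))
  have cK: "card K = p ^ k" unfolding K_def by (rule L.card_roots_frobenius[OF p ch k])
  hence "finite K" using prime_gt_0_nat[OF p] by (metis card.infinite power_not_zero less_not_refl)
  then obtain g where g: "bij_betw g K {0..<card K}" using ex_bij_betw_finite_nat by blast
  define g' where "g' = inv_into K g"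
  define S :: "nat ring" where
    "S = \<lparr> carrier = {0..<card K},
           monoid.mult = (\<lambda>x y. g (g' x \<otimes>\<^bsub>L\<^esub> g' y)), one = g \<one>\<^bsub>L\<^esub>,
           zero = g \<zero>\<^bsub>L\<^esub>, add = (\<lambda>x y. g (g' x \<oplus>\<^bsub>L\<^esub> g' y)) \<rparr>"
  have g'g: "g' (g x) = x" if "x \<in> K" for x
    using g that unfolding g'_def by (simp add: bij_betw_def inv_into_f_f)
  have "g \<in> ring_iso ?K S"
    using g by (auto simp: ring_iso_def ring_hom_def S_def g'g bij_betw_def)
  from K.ring_iso_imp_img_field[OF this] have "field S" by (simp add: S_def)
  moreover have "order S = p ^ k" by (simp add: order_def S_def cK)
  ultimately show ?thesis by blast
qed

lemma finite_field:
  assumes "Factorial_Ring.prime (p::nat)" and "k > 0"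
  shows "field (finite_field (p ^ k))" and "order (finite_field (p ^ k)) = p ^ k"
  using someI_ex[OF finite_field_exists[OF assms]] unfolding finite_field_def by auto

text \<open>The points over \<open>F\<close> of the curve \<open>y\<^sup>2 = x\<^sup>3 + 1\<close>; \<open>None\<close> is the point at infinity.
  Its discriminant \<open>-432\<close> is a unit modulo every prime \<open>p > 3\<close>, so over a field of such a
  characteristic the same equation describes the reduction of the rational curve.\<close>

definition E_points :: "('a, 'b) ring_scheme \<Rightarrow> ('a \<times> 'a) option set"
  where "E_points F = insert None (Some ` {(x, y). x \<in> carrier F \<and> y \<in> carrier F \<and>
           y [^]\<^bsub>F\<^esub> (2::nat) = x [^]\<^bsub>F\<^esub> (3::nat) \<oplus>\<^bsub>F\<^esub> \<one>\<^bsub>F\<^esub>})"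

definition N :: "nat \<Rightarrow> nat \<Rightarrow> nat"
  where "N p k = card (E_points (finite_field (p ^ k)))"

definition r13 :: "nat \<Rightarrow> nat"
  where "r13 n = card {x :: int ^ 4. (\<Sum>i\<in>UNIV. (x $ i)\<^sup>2) = int n \<and> (\<forall>i. [x $ i = 1] (mod 3))}"

end

(* Let a be the sum of q^(m^2) over the multiples m of 3, and w the sum over the m that are 1 mod 3, so
   that r13 is the sequence of coefficients of w^4 and a + 2w is the full theta series. In (a + 2w)^4,
   whose odd coefficients are 8 sigma(n) by Jacobi, the exponents n = 1 mod 3 come from 8 w a^3 + 16 w^4
   only. A second relation is w (a^3 - w^3) = q prod (1 - q^(6n))^4: the three factors of a^3 - w^3 are
   theta series twisted by a cube root of unity, and each is an infinite product by the triple product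
   identity. Writing the fourth power as (Euler's series) * (Jacobi's series for the cube) shows that
   its coefficient at an odd n is c(n), the sum of u over u^2 + 3v^2 = n with u = 1 mod 3. Hence
   3 r13(n) = sigma(n) - c(n) for n = 1 mod 6.

   On the other side let q = 1 mod 6 be a prime power. The three cubic twists of the character sum of
   x^3 + 1 satisfy one linear and one quadratic relation, which give N = q + 1 - 2u with u^2 + 3v^2 = q
   and u = 1 mod 3; moreover u is prime to p if p = 1 mod 6. Such a primitive representation is unique up
   to the sign of v, whence c(p^k) - p c(p^(k-2)) = 2u. *)

theory Submission
  imports
    Defs
    "HOL-Computational_Algebra.Formal_Power_Series"
    "HOL-Analysis.Cartesian_Space"
    "HOL-Algebra.Multiplicative_Group"
begin

unbundle no vec_syntax
unbundle fps_syntax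

section \<open>Formal power series and theta series\<close>

text \<open>All series are formal, and convergence means that each coefficient is eventually
  constant. The product side rests on one finite identity, the finite triple product with a weight
  on its terms: weight 1 gives the triple product, weight j its derivative and hence Jacobi's series
  for the cube of Euler's product. Squaring that series and turning the lattice gives the sixth
  power as a Wronskian of \<open>phi\<close> and \<open>psi\<close>, which is how the four-square
  theorem is reached.

  On the curve side \<open>N p k\<close> is computed inside the field of order p^k itself, so no
  relation between the fields for different k enters. The obstacle is that for p = 1 mod 6 the
  equation u^2 + 3v^2 = p^k also has solutions divisible by p, and the relations between the
  character sums do not tell which solution belongs to the curve. This is settled by a congruence:
  with p^k = 6e + 1, Euler's criterion turns the sum -2u into minus the binomial coefficient of 3e
  over 2e in the field, and p does not divide that coefficient. For p = 5 mod 6 and even k the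
  opposite extreme occurs: the only solution with u = 1 mod 3 is a power of -p.\<close>

lemma fps_mult_nth_cong:
  assumes "\<And>i. i \<le> n \<Longrightarrow> f $ i = f' $ i" "\<And>i. i \<le> n \<Longrightarrow> g $ i = g' $ i"
  shows "(f * g) $ n = (f' * g' :: 'a :: comm_ring_1 fps) $ n"
  unfolding fps_mult_nth by (rule sum.cong) (use assms in auto)

lemma tendsto_fps_upto:
  assumes "(f \<longlonglongrightarrow> (l :: 'a :: group_add fps))"
  shows "\<forall>\<^sub>F x in sequentially. \<forall>i\<le>n. f x $ i = l $ i"
proof -
  have "\<forall>\<^sub>F x in sequentially. \<forall>i\<in>{..n}. f x $ i = l $ i"
    by (subst eventually_ball_finite_distrib) (use assms in \<open>auto simp: tendsto_fps_iff\<close>)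
  thus ?thesis by (simp only: Ball_def atMost_iff)
qed

text \<open>Coefficient \<open>n\<close> of a product involves only the coefficients up to
  \<open>n\<close> of the factors, and these finitely many are eventually constant together.\<close>

lemma tendsto_mult_fps:
  fixes l m :: "'a :: comm_ring_1 fps"
  assumes "f \<longlonglongrightarrow> l" "g \<longlonglongrightarrow> m"
  shows "(\<lambda>x. f x * g x) \<longlonglongrightarrow> l * m"
proof (rule tendsto_fpsI)
  fix n
  show "\<forall>\<^sub>F x in sequentially. (f x * g x) $ n = (l * m) $ n"
    using tendsto_fps_upto[OF assms(1), of n] tendsto_fps_upto[OF assms(2), of n]
    by eventually_elim (rule fps_mult_nth_cong; simp)
qed

lemma tendsto_power_fps:
  fixes l :: "'a :: comm_ring_1 fps"
  assumes "f \<longlonglongrightarrow> l"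
  shows "(\<lambda>x. f x ^ k) \<longlonglongrightarrow> l ^ k"
  by (induction k) (simp, simp only: power_Suc tendsto_mult_fps[OF assms])

lemma tendsto_add_fps:
  fixes l m :: "'a :: comm_ring_1 fps"
  assumes "f \<longlonglongrightarrow> l" "g \<longlonglongrightarrow> m"
  shows "(\<lambda>x. f x + g x) \<longlonglongrightarrow> l + m"
proof (rule tendsto_fpsI)
  fix n
  show "\<forall>\<^sub>F x in sequentially. (f x + g x) $ n = (l + m) $ n"
    using tendsto_fps_upto[OF assms(1), of n] tendsto_fps_upto[OF assms(2), of n]
    by eventually_elim simp
qed

lemma tendsto_diff_fps:
  fixes l m :: "'a :: comm_ring_1 fps"
  assumes "f \<longlonglongrightarrow> l" "g \<longlonglongrightarrow> m"
  shows "(\<lambda>x. f x - g x) \<longlonglongrightarrow> l - m"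
proof (rule tendsto_fpsI)
  fix n
  show "\<forall>\<^sub>F x in sequentially. (f x - g x) $ n = (l - m) $ n"
    using tendsto_fps_upto[OF assms(1), of n] tendsto_fps_upto[OF assms(2), of n]
    by eventually_elim simp
qed

lemma tendsto_deriv_fps:
  fixes l :: "'a :: comm_ring_1 fps"
  assumes "f \<longlonglongrightarrow> l"
  shows "(\<lambda>x. fps_deriv (f x)) \<longlonglongrightarrow> fps_deriv l"
proof (rule tendsto_fpsI)
  fix n
  show "\<forall>\<^sub>F x in sequentially. fps_deriv (f x) $ n = fps_deriv l $ n"
    using tendsto_fps_upto[OF assms, of "Suc n"] by eventually_elim simp
qed

lemma fps_mult_nth_zero_below:
  fixes f g :: "'a :: comm_ring_1 fps"
  assumes "\<And>i. i < n \<Longrightarrow> g $ i = 0" "m < n"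
  shows "(f * g) $ m = 0"
  unfolding fps_mult_nth by (rule sum.neutral) (use assms in auto)

text \<open>Factor \<open>k\<close> differs from 1 only beyond degree \<open>k\<close>, so it leaves
  the coefficients up to \<open>k\<close> of a partial product alone. Hence the diagonal
  coefficients describe the limit.\<close>

lemma prod_fps_stable:
  fixes h :: "nat \<Rightarrow> 'a :: comm_ring_1 fps"
  assumes h: "\<And>k i. i \<le> k \<Longrightarrow> (h k - 1) $ i = 0" and "i \<le> M" "M \<le> n"
  shows "(\<Prod>k<n. h k) $ i = (\<Prod>k<M. h k) $ i"
  using assms(3)
proof (induction n rule: dec_induct)
  case (step n)
  have "(\<Prod>k<Suc n. h k) = (\<Prod>k<n. h k) + (\<Prod>k<n. h k) * (h n - 1)"
    unfolding prod.lessThan_Suc right_diff_distrib by simp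
  moreover have "((\<Prod>k<n. h k) * (h n - 1)) $ i = 0"
    by (rule fps_mult_nth_zero_below[of "Suc n"]) (use h step(1) assms(2) in auto)
  ultimately show ?case using step.IH by (simp only: fps_add_nth add_0_right)
qed simp

lemma prod_fps_converges:
  fixes h :: "nat \<Rightarrow> 'a :: comm_ring_1 fps"
  assumes h: "\<And>k i. i \<le> k \<Longrightarrow> (h k - 1) $ i = 0"
  shows "(\<lambda>n. \<Prod>k<n. h k) \<longlonglongrightarrow> Abs_fps (\<lambda>n. (\<Prod>k<n. h k) $ n)"
proof (rule tendsto_fpsI)
  fix i
  show "\<forall>\<^sub>F n in sequentially. (\<Prod>k<n. h k) $ i = Abs_fps (\<lambda>n. (\<Prod>k<n. h k) $ n) $ i"
    using eventually_ge_at_top[of i]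
    by eventually_elim (unfold fps_nth_Abs_fps, rule prod_fps_stable[of h i i, OF h order_refl])
qed

section \<open>Formal sums of weighted powers of X over an index type\<close>

definition theta_series :: "('i \<Rightarrow> 'a :: comm_ring_1) \<Rightarrow> ('i \<Rightarrow> nat) \<Rightarrow> 'a fps"
  where "theta_series w e = Abs_fps (\<lambda>n. \<Sum>i | e i = n. w i)"

lemma theta_series_nth: "theta_series w e $ n = (\<Sum>i | e i = n. w i)"
  by (simp add: theta_series_def)

text \<open>A sum over an infinite set takes the default value 0, so \<open>theta_series\<close> is
  the intended sum of the terms w i X^(e i) only under this condition.\<close>

definition finite_fibres :: "('i \<Rightarrow> nat) \<Rightarrow> bool"
  where "finite_fibres e \<longleftrightarrow> (\<forall>n. finite {i. e i = n})"

lemma finite_fibres_le: "finite_fibres e \<Longrightarrow> finite {i. e i \<le> n}"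
proof -
  assume "finite_fibres e"
  hence "finite (\<Union>m\<in>{..n}. {i. e i = m})" unfolding finite_fibres_def by auto
  moreover have "{i. e i \<le> n} = (\<Union>m\<in>{..n}. {i. e i = m})" by auto
  ultimately show ?thesis by simp
qed

lemma finite_fibres_add:
  assumes "finite_fibres e" "finite_fibres f"
  shows "finite_fibres (\<lambda>(i, j). e i + f j)"
  unfolding finite_fibres_def
proof
  fix n
  have "{x. (case x of (i, j) \<Rightarrow> e i + f j) = n} \<subseteq> {i. e i \<le> n} \<times> {j. f j \<le> n}" by auto
  thus "finite {x. (case x of (i, j) \<Rightarrow> e i + f j) = n}"
    by (rule finite_subset) (intro finite_SigmaI finite_fibres_le assms)
qed

lemma theta_series_mult:
  assumes e: "finite_fibres e" and f: "finite_fibres f"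
  shows "theta_series w e * theta_series v f =
           theta_series (\<lambda>(i, j). w i * v j) (\<lambda>(i, j). e i + f j)"
proof (rule fps_ext)
  fix n
  have fin: "finite {i. e i = m}" "finite {i. f i = m}" for m
    using e f unfolding finite_fibres_def by auto
  have "(theta_series w e * theta_series v f) $ n =
      (\<Sum>m=0..n. \<Sum>(i, j)\<in>{i. e i = m} \<times> {j. f j = n - m}. w i * v j)"
    by (simp add: fps_mult_nth theta_series_nth sum_product sum.cartesian_product)
  also have "\<dots> = (\<Sum>(i, j)\<in>(\<Union>m\<in>{0..n}. {i. e i = m} \<times> {j. f j = n - m}). w i * v j)"
    by (subst sum.UNION_disjoint) (use fin in auto)
  also have "(\<Union>m\<in>{0..n}. {i. e i = m} \<times> {j. f j = n - m}) = {(i, j). e i + f j = n}" by auto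
  finally show "(theta_series w e * theta_series v f) $ n =
      theta_series (\<lambda>(i, j). w i * v j) (\<lambda>(i, j). e i + f j) $ n"
    by (simp add: theta_series_nth case_prod_unfold)
qed

section \<open>Triangular numbers and q-Pochhammer symbols\<close>

definition tri :: "int \<Rightarrow> nat"
  where "tri j = nat (j * (j + 1) div 2)"

lemma tri_double: "2 * int (tri j) = j * (j + 1)"
proof -
  have "even (j * (j + 1))" by auto
  moreover have "j * (j + 1) \<ge> 0" by (cases "j \<ge> 0") (auto simp: mult_nonpos_nonpos)
  ultimately show ?thesis unfolding tri_def by auto
qed

lemma tri_Suc: "int (tri j) = int (tri (j - 1)) + j"
  using tri_double[of j] tri_double[of "j - 1"] by (simp add: algebra_simps)

text \<open>Linear growth of the exponents gives finite fibres and tells where a sum may be cut at a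
  given degree.\<close>

lemma tri_ge: "int (tri j) \<ge> \<bar>j\<bar> - 1" "int (tri (j - 1)) \<ge> \<bar>j\<bar> - 1"
proof -
  have *: "2 * (\<bar>j\<bar> - 1) \<le> \<bar>j\<bar> * (\<bar>j\<bar> - 1)"
  proof (cases "\<bar>j\<bar> \<ge> 2")
    case True
    thus ?thesis by (intro mult_right_mono) auto
  next
    case False
    hence "j = 0 \<or> j = 1 \<or> j = -1" by auto
    thus ?thesis by auto
  qed
  have "\<bar>j\<bar> * (\<bar>j\<bar> - 1) \<le> j * (j + 1)" "\<bar>j\<bar> * (\<bar>j\<bar> - 1) \<le> (j - 1) * j"
    by (cases "j \<ge> 0"; simp add: algebra_simps)+
  with * tri_double[of j] tri_double[of "j - 1"]
  show "int (tri j) \<ge> \<bar>j\<bar> - 1" "int (tri (j - 1)) \<ge> \<bar>j\<bar> - 1" by (auto simp: algebra_simps)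
qed

definition qpoch :: "'a :: comm_ring_1 fps \<Rightarrow> nat \<Rightarrow> 'a fps"
  where "qpoch Q n = (\<Prod>k<n. 1 - Q ^ Suc k)"

text \<open>The value 0 at negative \<open>m\<close> imitates the reciprocal factorial: sums over j
  in \<open>jsum\<close> then end by themselves at |j| = n.\<close>

definition qpoch_inv :: "'a :: field fps \<Rightarrow> int \<Rightarrow> 'a fps"
  where "qpoch_inv Q m = (if m < 0 then 0 else inverse (qpoch Q (nat m)))"

lemma qpoch_Suc: "qpoch Q (Suc n) = qpoch Q n * (1 - Q ^ Suc n)"
  by (simp add: qpoch_def mult.commute)

lemma qpoch_nth_0: "Q $ 0 = 0 \<Longrightarrow> qpoch Q n $ 0 = 1"
  by (induction n) (simp_all add: qpoch_def fps_power_zeroth)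

text \<open>The recursion crosses 0 without exception: at m = -1 the factor is 1 - Q^0 = 0, and
  below that both sides are the default 0.\<close>

lemma qpoch_inv_step:
  fixes Q :: "'a :: field fps"
  assumes Q: "Q $ 0 = 0"
  shows "qpoch_inv Q m = (1 - Q ^ nat (m + 1)) * qpoch_inv Q (m + 1)"
proof -
  consider "m < -1" | "m = -1" | "m \<ge> 0" by linarith
  thus ?thesis
  proof cases
    case 3
    hence n: "nat (m + 1) = Suc (nat m)" by simp
    have "(1 - Q ^ Suc (nat m)) $ 0 \<noteq> 0" using Q by (simp add: fps_power_zeroth)
    moreover have "qpoch Q (nat m) $ 0 \<noteq> 0" using qpoch_nth_0[OF Q] by simp
    ultimately show ?thesis using 3 n
      by (simp add: qpoch_inv_def qpoch_Suc fps_inverse_mult inverse_mult_eq_1' mult_ac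
               del: power_Suc)
  qed (auto simp: qpoch_inv_def)
qed

lemma fps_power_nth_below:
  assumes "(Q :: 'a :: comm_ring_1 fps) $ 0 = 0" "i < k"
  shows "(Q ^ k) $ i = 0"
  using assms startsby_zero_power_prefix by blast

lemma qpoch_stable:
  assumes "(Q :: 'a :: comm_ring_1 fps) $ 0 = 0" "i \<le> M" "M \<le> n"
  shows "qpoch Q n $ i = qpoch Q M $ i"
  unfolding qpoch_def
  by (rule prod_fps_stable) (use assms fps_power_nth_below[of Q] in \<open>auto simp del: power_Suc\<close>)

lemma qpoch_converges:
  assumes "(Q :: 'a :: comm_ring_1 fps) $ 0 = 0"
  shows "\<exists>l. qpoch Q \<longlonglongrightarrow> l \<and> l $ 0 = 1"
proof -
  have "qpoch Q \<longlonglongrightarrow> Abs_fps (\<lambda>n. qpoch Q n $ n)"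
    unfolding qpoch_def
    by (rule prod_fps_converges) (use assms fps_power_nth_below[of Q] in \<open>auto simp del: power_Suc\<close>)
  thus ?thesis using qpoch_nth_0[OF assms] by (intro exI[of _ "Abs_fps (\<lambda>n. qpoch Q n $ n)"]) simp
qed

lemma qpoch_mult_inv_nth:
  fixes Q :: "'a :: field fps"
  assumes Q: "Q $ 0 = 0" and "i \<le> M" "M \<le> n" "int M \<le> m"
  shows "(qpoch Q n * qpoch_inv Q m) $ i = (1 :: 'a fps) $ i"
proof -
  have "(qpoch Q n * qpoch_inv Q m) $ i = (qpoch Q (nat m) * qpoch_inv Q m) $ i"
  proof (rule fps_mult_nth_cong)
    fix k assume "k \<le> i"
    hence "k \<le> M" "M \<le> nat m" using assms by auto
    thus "qpoch Q n $ k = qpoch Q (nat m) $ k"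
      using qpoch_stable[OF Q, of k M n] qpoch_stable[OF Q, of k M "nat m"] assms(3) by simp
  qed simp
  also have "qpoch Q (nat m) * qpoch_inv Q m = 1"
    using assms qpoch_nth_0[OF Q] by (simp add: qpoch_inv_def inverse_mult_eq_1')
  finally show ?thesis .
qed

section \<open>The Jacobi triple product\<close>

text \<open>The finite form of the triple product, up to the factor \<open>qpoch Q (2 * n)\<close>; weights
  other than \<open>1\<close> give its derivatives in the ratio of \<open>A\<close> and \<open>B\<close>.\<close>

definition jsum :: "'a :: field fps \<Rightarrow> 'a fps \<Rightarrow> (int \<Rightarrow> 'a fps) \<Rightarrow> nat \<Rightarrow> 'a fps"
  where "jsum A B h n = qpoch (A * B) (2 * n) * (\<Sum>j\<in>{- int n..int n}.
     h j * A ^ tri j * B ^ tri (j - 1) * qpoch_inv (A * B) (int n + j) * qpoch_inv (A * B) (int n - j))"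

lemma jsum_wide:
  assumes "n \<le> m"
  shows "jsum A B h n = qpoch (A * B) (2 * n) * (\<Sum>j\<in>{- int m..int m}.
     h j * A ^ tri j * B ^ tri (j - 1) * qpoch_inv (A * B) (int n + j) * qpoch_inv (A * B) (int n - j))"
  unfolding jsum_def
  by (intro arg_cong2[where f = "(*)"] refl sum.mono_neutral_left) 
     (use assms in \<open>auto simp: qpoch_inv_def\<close>)

lemma jsum_0: "jsum A B h 0 = h 0"
  by (simp add: jsum_def qpoch_inv_def tri_def qpoch_def)

text \<open>The q-Pascal rule applied twice. It compares the terms of index j when the finite
  product is multiplied by (1 + A Q^n)(1 + B Q^n) = 1 + Q^(2n+1) + A Q^n + B Q^n with Q = A B.
  Expressed through \<open>R\<close>, \<open>S\<close>, \<open>x\<close>, \<open>y\<close> and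
  \<open>z\<close> it is a polynomial identity.\<close>

lemma jsum_coeff_identity:
  fixes Q :: "'a :: field fps" and j :: int
  assumes Q: "Q $ 0 = 0" and j: "\<bar>j\<bar> \<le> int n + 1"
  shows "qpoch_inv Q (int n + j + 1) * qpoch_inv Q (int n - j + 1) *
           ((1 - Q ^ (2 * n + 1)) * (1 - Q ^ (2 * n + 2))) =
         (1 + Q ^ (2 * n + 1)) * (qpoch_inv Q (int n + j) * qpoch_inv Q (int n - j))
         + Q ^ nat (int n + 1 - j) * (qpoch_inv Q (int n + j - 1) * qpoch_inv Q (int n - j + 1))
         + Q ^ nat (int n + 1 + j) * (qpoch_inv Q (int n + j + 1) * qpoch_inv Q (int n - j - 1))"
proof -
  define r where "r = qpoch_inv Q"
  define x where "x = Q ^ nat (int n + 1 + j)"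
  define y where "y = Q ^ nat (int n + 1 - j)"
  define R where "R = r (int n + j + 1)"
  define S where "S = r (int n - j + 1)"
  have r1: "r (int n + j) = (1 - x) * R" 
    using qpoch_inv_step[OF Q, of "int n + j"] by (simp add: r_def x_def R_def add_ac)
  have s1: "r (int n - j) = (1 - y) * S" 
    using qpoch_inv_step[OF Q, of "int n - j"] by (simp add: r_def y_def S_def diff_add_eq)
  have xy: "x * y = Q ^ (2 * n + 2)"
    unfolding x_def y_def power_add[symmetric] by (rule arg_cong[where f = "power Q"]) (use j in auto)
  have a: "y * r (int n + j - 1) = (y - Q ^ (2 * n + 1)) * ((1 - x) * R)"
  proof (cases "int n + j \<ge> 0")
    case True
    have "y * Q ^ nat (int n + j) = Q ^ (2 * n + 1)"
      unfolding y_def power_add[symmetric] by (rule arg_cong[where f = "power Q"]) (use j True in auto)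
    moreover have "r (int n + j - 1) = (1 - Q ^ nat (int n + j)) * r (int n + j)"
      using qpoch_inv_step[OF Q, of "int n + j - 1"] by (simp add: r_def)
    ultimately have "y * r (int n + j - 1) = (y - Q ^ (2 * n + 1)) * r (int n + j)"
      by (simp only: left_diff_distrib right_diff_distrib mult_1_left mult.assoc[symmetric])
    thus ?thesis by (simp only: r1)
  next
    case False
    \<comment> \<open>Only j = -n - 1 is left here. Then x = Q^0, and both sides vanish: the left by
      the default value of \<open>qpoch_inv\<close>, the right by its factor 1 - x.\<close>
    hence "x = 1" using j by (simp add: x_def)
    thus ?thesis using False by (simp add: r_def qpoch_inv_def)
  qed
  have b: "x * r (int n - j - 1) = (x - Q ^ (2 * n + 1)) * ((1 - y) * S)"
  proof (cases "int n - j \<ge> 0")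
    case True
    have "x * Q ^ nat (int n - j) = Q ^ (2 * n + 1)"
      unfolding x_def power_add[symmetric] by (rule arg_cong[where f = "power Q"]) (use j True in auto)
    moreover have "r (int n - j - 1) = (1 - Q ^ nat (int n - j)) * r (int n - j)"
      using qpoch_inv_step[OF Q, of "int n - j - 1"] by (simp add: r_def)
    ultimately have "x * r (int n - j - 1) = (x - Q ^ (2 * n + 1)) * r (int n - j)"
      by (simp only: left_diff_distrib right_diff_distrib mult_1_left mult.assoc[symmetric])
    thus ?thesis by (simp only: s1)
  next
    case False
    hence "y = 1" using j by (simp add: y_def)
    thus ?thesis using False by (simp add: r_def qpoch_inv_def)
  qed
  define z where "z = Q ^ (2 * n + 1)"
  have "R * S * ((1 - z) * (1 - x * y)) = (1 + z) * (((1 - x) * R) * ((1 - y) * S))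
     + ((y - z) * ((1 - x) * R)) * S + R * ((x - z) * ((1 - y) * S))"
    by (simp add: algebra_simps)
  also have "\<dots> = (1 + z) * (r (int n + j) * r (int n - j)) + (y * r (int n + j - 1)) * r (int n - j + 1)
      + r (int n + j + 1) * (x * r (int n - j - 1))"
    unfolding a b r1 s1 z_def R_def S_def by simp
  finally have "R * S * ((1 - z) * (1 - Q ^ (2 * n + 2))) =
      (1 + z) * (r (int n + j) * r (int n - j)) + y * (r (int n + j - 1) * r (int n - j + 1))
      + x * (r (int n + j + 1) * r (int n - j - 1))"
    unfolding xy by (simp only: mult_ac)
  thus ?thesis unfolding z_def R_def S_def x_def y_def r_def .
qed

text \<open>Multiplication by A Q^n or B Q^n moves a term to a neighbouring index, because
  \<open>tri j\<close> and \<open>tri (j - 1)\<close> differ by j. The weight does not move with the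
  term, so it appears with a shifted argument. For a constant weight the right side is a
  multiplication by the next two factors of the product.\<close>

lemma jsum_Suc:
  fixes A B :: "'a :: field fps"
  assumes Q: "(A * B) $ 0 = 0"
  shows "jsum A B h (Suc n) = (1 + (A * B) ^ (2 * n + 1)) * jsum A B h n
     + A * (A * B) ^ n * jsum A B (\<lambda>j. h (j + 1)) n + B * (A * B) ^ n * jsum A B (\<lambda>j. h (j - 1)) n"
proof -
  define Q where "Q = A * B"
  define r where "r = qpoch_inv Q"
  define t where "t h j = h j * A ^ tri j * B ^ tri (j - 1)" for h :: "int \<Rightarrow> 'a fps" and j
  define I where "I = {- int (Suc n)..int (Suc n)}"
  define P where "P = qpoch Q (2 * n)"
  have P2: "qpoch Q (2 * Suc n) = P * ((1 - Q ^ (2 * n + 1)) * (1 - Q ^ (2 * n + 2)))"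
    by (simp add: P_def qpoch_Suc mult_ac del: power_Suc)
  have shift1: "A * Q ^ n * (h j * A ^ tri (j - 1) * B ^ tri (j - 1 - 1)) =
      Q ^ nat (int n + 1 - j) * t h j"
    if "j \<in> I" for j and h :: "int \<Rightarrow> 'a fps"
  proof -
    have "int (nat (int n + 1 - j)) = int n + 1 - j" using that by (simp add: I_def)
    hence "Suc (n + tri (j - 1)) = nat (int n + 1 - j) + tri j"
      "n + tri (j - 1 - 1) = nat (int n + 1 - j) + tri (j - 1)"
      using tri_Suc[of j] tri_Suc[of "j - 1"] by linarith+
    hence "A ^ Suc (n + tri (j - 1)) = A ^ (nat (int n + 1 - j) + tri j)"
        "B ^ (n + tri (j - 1 - 1)) = B ^ (nat (int n + 1 - j) + tri (j - 1))" by (simp_all only:)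
    hence "A * A ^ n * A ^ tri (j - 1) = A ^ nat (int n + 1 - j) * A ^ tri j"
        "B ^ n * B ^ tri (j - 1 - 1) = B ^ nat (int n + 1 - j) * B ^ tri (j - 1)"
      by (simp_all only: power_add power_Suc mult.assoc)
    note e = this
    have "A * Q ^ n * (h j * A ^ tri (j - 1) * B ^ tri (j - 1 - 1)) =
        h j * (A * A ^ n * A ^ tri (j - 1)) * (B ^ n * B ^ tri (j - 1 - 1))"
      by (simp add: Q_def power_mult_distrib mult_ac)
    also have "\<dots> = Q ^ nat (int n + 1 - j) * t h j"
      unfolding e by (simp only: t_def Q_def power_mult_distrib mult_ac)
    finally show ?thesis .
  qed
  have shift2: "B * Q ^ n * (h j * A ^ tri (j + 1) * B ^ tri j) =
      Q ^ nat (int n + 1 + j) * t h j"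
    if "j \<in> I" for j and h :: "int \<Rightarrow> 'a fps"
  proof -
    have "int (nat (int n + 1 + j)) = int n + 1 + j" using that by (simp add: I_def)
    hence "Suc (n + tri j) = nat (int n + 1 + j) + tri (j - 1)"
      "n + tri (j + 1) = nat (int n + 1 + j) + tri j"
      using tri_Suc[of j] tri_Suc[of "j + 1", unfolded add_diff_cancel_right'] by linarith+
    hence "B ^ Suc (n + tri j) = B ^ (nat (int n + 1 + j) + tri (j - 1))"
        "A ^ (n + tri (j + 1)) = A ^ (nat (int n + 1 + j) + tri j)" by (simp_all only:)
    hence "B * B ^ n * B ^ tri j = B ^ nat (int n + 1 + j) * B ^ tri (j - 1)"
        "A ^ n * A ^ tri (j + 1) = A ^ nat (int n + 1 + j) * A ^ tri j"
      by (simp_all only: power_add power_Suc mult.assoc)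
    note e = this
    have "B * Q ^ n * (h j * A ^ tri (j + 1) * B ^ tri j) =
        h j * (B * B ^ n * B ^ tri j) * (A ^ n * A ^ tri (j + 1))"
      by (simp add: Q_def power_mult_distrib mult_ac)
    also have "\<dots> = Q ^ nat (int n + 1 + j) * t h j"
      unfolding e by (simp only: t_def Q_def power_mult_distrib mult_ac)
    finally show ?thesis .
  qed
  have arith: "int (Suc n) + j = int n + j + 1" "int (Suc n) - j = int n - j + 1"
    "int n + (j - 1) = int n + j - 1" "int n - (j - 1) = int n - j + 1"
    "int n + (j + 1) = int n + j + 1" "int n - (j + 1) = int n - j - 1" for j by simp_all
  have J0: "jsum A B h n = P * (\<Sum>j\<in>I. t h j * (r (int n + j) * r (int n - j)))"
    by (subst jsum_wide[of n "Suc n"]) (simp_all add: P_def Q_def r_def t_def I_def mult_ac)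
  have JS: "jsum A B h (Suc n) = P * (\<Sum>j\<in>I. t h j * (r (int n + j + 1) * r (int n - j + 1) *
              ((1 - Q ^ (2 * n + 1)) * (1 - Q ^ (2 * n + 2)))))"
    unfolding jsum_def Q_def[symmetric] r_def[symmetric] P2 sum_distrib_left
    unfolding sum_distrib_left[symmetric] arith
    by (simp only: t_def I_def mult_ac sum_distrib_left)
  have J1: "A * Q ^ n * jsum A B (\<lambda>j. h (j + 1)) n =
      P * (\<Sum>j\<in>I. t h j * (Q ^ nat (int n + 1 - j) * (r (int n + j - 1) * r (int n - j + 1))))"
  proof -
    have "jsum A B (\<lambda>j. h (j + 1)) n = P * (\<Sum>j\<in>{- int n..int n}.
        (h (j + 1) * A ^ tri j * B ^ tri (j - 1)) * (r (int n + j) * r (int n - j)))"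
      by (simp add: jsum_def P_def Q_def r_def mult_ac)
    also have "(\<Sum>j\<in>{- int n..int n}.
        (h (j + 1) * A ^ tri j * B ^ tri (j - 1)) * (r (int n + j) * r (int n - j)))
      = (\<Sum>j\<in>{- int n + 1..int n + 1}.
        (h j * A ^ tri (j - 1) * B ^ tri (j - 1 - 1)) * (r (int n + (j - 1)) * r (int n - (j - 1))))"
      by (rule sum.reindex_bij_witness[of _ "\<lambda>j. j - 1" "\<lambda>j. j + 1"]) auto
    also have "\<dots> = (\<Sum>j\<in>I.
        (h j * A ^ tri (j - 1) * B ^ tri (j - 1 - 1)) * (r (int n + (j - 1)) * r (int n - (j - 1))))"
      by (intro sum.mono_neutral_left) (auto simp: I_def r_def qpoch_inv_def)
    finally have "A * Q ^ n * jsum A B (\<lambda>j. h (j + 1)) n = P * (\<Sum>j\<in>I. A * Q ^ n *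
        (h j * A ^ tri (j - 1) * B ^ tri (j - 1 - 1)) * (r (int n + j - 1) * r (int n - j + 1)))"
      by (simp only: sum_distrib_left mult_ac arith)
    also have "\<dots> = P * (\<Sum>j\<in>I. Q ^ nat (int n + 1 - j) * t h j *
         (r (int n + j - 1) * r (int n - j + 1)))"
      by (rule arg_cong[where f = "(*) P"], rule sum.cong[OF refl]) (simp only: shift1)
    finally show ?thesis by (simp only: mult_ac)
  qed
  have J2: "B * Q ^ n * jsum A B (\<lambda>j. h (j - 1)) n =
      P * (\<Sum>j\<in>I. t h j * (Q ^ nat (int n + 1 + j) * (r (int n + j + 1) * r (int n - j - 1))))"
  proof -
    have "jsum A B (\<lambda>j. h (j - 1)) n = P * (\<Sum>j\<in>{- int n..int n}.
        (h (j - 1) * A ^ tri j * B ^ tri (j - 1)) * (r (int n + j) * r (int n - j)))"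
      by (simp add: jsum_def P_def Q_def r_def mult_ac)
    also have "(\<Sum>j\<in>{- int n..int n}.
        (h (j - 1) * A ^ tri j * B ^ tri (j - 1)) * (r (int n + j) * r (int n - j)))
      = (\<Sum>j\<in>{- int n - 1..int n - 1}.
        (h j * A ^ tri (j + 1) * B ^ tri j) * (r (int n + (j + 1)) * r (int n - (j + 1))))"
      by (rule sum.reindex_bij_witness[of _ "\<lambda>j. j + 1" "\<lambda>j. j - 1"]) auto
    also have "\<dots> = (\<Sum>j\<in>I.
        (h j * A ^ tri (j + 1) * B ^ tri j) * (r (int n + (j + 1)) * r (int n - (j + 1))))"
      by (intro sum.mono_neutral_left) (auto simp: I_def r_def qpoch_inv_def)
    finally have "B * Q ^ n * jsum A B (\<lambda>j. h (j - 1)) n = P * (\<Sum>j\<in>I. B * Q ^ n *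
        (h j * A ^ tri (j + 1) * B ^ tri j) * (r (int n + j + 1) * r (int n - j - 1)))"
      by (simp only: sum_distrib_left mult_ac arith)
    also have "\<dots> = P * (\<Sum>j\<in>I. Q ^ nat (int n + 1 + j) * t h j *
         (r (int n + j + 1) * r (int n - j - 1)))"
      by (rule arg_cong[where f = "(*) P"], rule sum.cong[OF refl]) (simp only: shift2)
    finally show ?thesis by (simp only: mult_ac)
  qed
  have "jsum A B h (Suc n) = P * (\<Sum>j\<in>I. t h j * ((1 + Q ^ (2 * n + 1)) * (r (int n + j) * r (int n - j))
         + Q ^ nat (int n + 1 - j) * (r (int n + j - 1) * r (int n - j + 1))
         + Q ^ nat (int n + 1 + j) * (r (int n + j + 1) * r (int n - j - 1))))"
    unfolding JS r_def
    by (rule arg_cong[where f = "(*) P"], rule sum.cong[OF refl], rule arg_cong[where f = "(*) (t h _)"],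
        rule jsum_coeff_identity)
       (use Q in \<open>auto simp: Q_def I_def\<close>)
  also have "\<dots> = (1 + Q ^ (2 * n + 1)) * jsum A B h n
     + A * Q ^ n * jsum A B (\<lambda>j. h (j + 1)) n + B * Q ^ n * jsum A B (\<lambda>j. h (j - 1)) n"
    unfolding J0 J1 J2 by (simp only: distrib_left distrib_right sum.distrib sum_distrib_left mult_ac mult_1)
  finally show ?thesis by (simp add: Q_def)
qed

lemma jsum_const:
  assumes "(A * B :: 'a :: field fps) $ 0 = 0"
  shows "jsum A B (\<lambda>_. 1) n = (\<Prod>k<n. (1 + A * (A * B) ^ k) * (1 + B * (A * B) ^ k))"
proof (induction n)
  case (Suc n)
  show ?case unfolding jsum_Suc[OF assms] Suc prod.lessThan_Suc
    by (simp add: algebra_simps power_mult power2_eq_square power_mult_distrib)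
qed (simp add: jsum_0)

lemma jsum_linear:
  "jsum A B (\<lambda>j. h j + c * g j) n = jsum A B h n + c * jsum A B g n"
  unfolding jsum_def by (simp only: distrib_right distrib_left sum.distrib sum_distrib_left mult_ac)

text \<open>With the extra factor \<open>qpoch (A * B) n\<close> every Pochhammer symbol meets a
  partner: the term of index j carries the quotients of \<open>qpoch\<close> at n by those at n + j
  and n - j, and in front stands the quotient at 2n by that at n. All of them tend to 1, and the
  monomials remain.\<close>

lemma jsum_tendsto_theta_series:
  fixes c d :: "'a :: field"
  assumes ab: "a + b > 0"
  defines "A \<equiv> fps_const c * fps_X ^ a" and "B \<equiv> fps_const d * fps_X ^ b"
  shows "(\<lambda>n. qpoch (A * B) n * jsum A B (\<lambda>j. fps_const (h j)) n) \<longlonglongrightarrow>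
           theta_series (\<lambda>j. h j * c ^ tri j * d ^ tri (j - 1)) (\<lambda>j. a * tri j + b * tri (j - 1))"
proof -
  define Q where "Q = A * B"
  have Q0: "Q $ 0 = 0" using ab by (auto simp: Q_def A_def B_def fps_power_zeroth)
  define w where "w j = h j * c ^ tri j * d ^ tri (j - 1)" for j
  define e where "e j = a * tri j + b * tri (j - 1)" for j
  define r where "r = qpoch_inv Q"
  have mono: "fps_const (h j) * A ^ tri j * B ^ tri (j - 1) = fps_const (w j) * fps_X ^ e j" for j
    by (simp add: A_def B_def w_def e_def power_mult_distrib power_add power_mult mult_ac
          fps_const_power flip: fps_const_mult)
  have ege: "int (e j) \<ge> \<bar>j\<bar> - 1" for j
  proof -
    have "a > 0 \<or> b > 0" using ab by auto
    moreover have "int (e j) = int a * int (tri j) + int b * int (tri (j - 1))" by (simp add: e_def)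
    moreover have "a > 0 \<Longrightarrow> int (tri j) \<le> int a * int (tri j)"
      "b > 0 \<Longrightarrow> int (tri (j - 1)) \<le> int b * int (tri (j - 1))"
      by (simp_all add: mult_le_cancel_right1 flip: of_nat_mult)
    ultimately show ?thesis using tri_ge[of j]
      by (smt (verit) mult_nonneg_nonneg of_nat_0_le_iff)
  qed
  define S where "S n = (\<Sum>j\<in>{- int n..int n}. fps_const (w j) * fps_X ^ e j * (qpoch Q n * r (int n + j)) *
       (qpoch Q n * r (int n - j)))" for n
  have lim: "S \<longlonglongrightarrow> theta_series w e"
  proof (rule tendsto_fpsI)
    fix M
    show "\<forall>\<^sub>F n in sequentially. S n $ M = theta_series w e $ M"
      \<comment> \<open>For |j| up to M + 1 this bound keeps n + j and n - j at least M, so the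
        quotients are 1 up to degree M; for the other j the exponent \<open>e j\<close> exceeds
        M.\<close>
      using eventually_ge_at_top[of "2 * M + 2"]
    proof eventually_elim
      case (elim n)
      have "(fps_const (w j) * fps_X ^ e j * (qpoch Q n * r (int n + j)) *
              (qpoch Q n * r (int n - j))) $ M = (if e j = M then w j else 0)"
        (is "(?m * ?x * ?y) $ M = _") if j: "j \<in> {- int n..int n}" for j
      proof (cases "\<bar>j\<bar> \<le> int M + 1")
        case True
        have "(?m * ?x * ?y) $ M = (?m * 1 * 1) $ M"
          by (intro fps_mult_nth_cong refl; unfold r_def; rule qpoch_mult_inv_nth[OF Q0, of _ M])
             (use True elim in auto)
        thus ?thesis by (simp add: fps_X_power_iff)
      next
        case False
        hence "e j > M" using ege[of j] by linarith
        hence "(fps_X ^ e j :: 'a fps) $ i = 0" if "i \<le> M" for i using that by (simp add: fps_X_power_iff)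
        hence "((fps_const (w j) * ?x * ?y) * fps_X ^ e j) $ M = 0"
          by (intro fps_mult_nth_zero_below[of "Suc M"]) auto
        thus ?thesis using \<open>e j > M\<close> by (simp add: mult_ac)
      qed
      hence "S n $ M = (\<Sum>j\<in>{- int n..int n}. if e j = M then w j else 0)"
        unfolding S_def fps_sum_nth by (intro sum.cong refl)
      also have "\<dots> = (\<Sum>j\<in>{j \<in> {- int n..int n}. e j = M}. w j)"
        by (rule sum.inter_filter[symmetric]) simp
      also have "{j \<in> {- int n..int n}. e j = M} = {j. e j = M}"
      proof -
        have "\<bar>j\<bar> \<le> int n" if "e j = M" for j using that ege[of j] elim by linarith
        thus ?thesis by force
      qed
      finally show ?case by (simp add: theta_series_nth)
    qed
  qed
  obtain l where l: "qpoch Q \<longlonglongrightarrow> l" "l $ 0 = 1" using qpoch_converges[OF Q0] by blast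
  have l2: "(\<lambda>n. qpoch Q (2 * n)) \<longlonglongrightarrow> l"
    using LIMSEQ_subseq_LIMSEQ[OF l(1), of "\<lambda>n. 2 * n"] by (simp add: strict_mono_def o_def)
  have q: "(\<lambda>n. qpoch Q (2 * n) * inverse (qpoch Q n)) \<longlonglongrightarrow> l * inverse l"
    by (intro tendsto_mult_fps l2 tendsto_inverse_fps l(1)) (use l(2) in simp)
  have "l * inverse l = 1" using l(2) by (simp add: inverse_mult_eq_1')
  with tendsto_mult_fps[OF q lim]
  have "(\<lambda>n. qpoch Q (2 * n) * inverse (qpoch Q n) * S n) \<longlonglongrightarrow> theta_series w e" by simp
  also have "(\<lambda>n. qpoch Q (2 * n) * inverse (qpoch Q n) * S n) =
     (\<lambda>n. qpoch Q n * jsum A B (\<lambda>j. fps_const (h j)) n)"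
  proof
    fix n
    have "S n = qpoch Q n * (qpoch Q n * (\<Sum>j\<in>{- int n..int n}. fps_const (h j) * A ^ tri j * B ^ tri (j - 1) *
       r (int n + j) * r (int n - j)))"
      unfolding S_def mono by (simp add: sum_distrib_left mult_ac)
    moreover have "inverse (qpoch Q n) * qpoch Q n = 1"
      using qpoch_nth_0[OF Q0] by (simp add: inverse_mult_eq_1)
    ultimately have "inverse (qpoch Q n) * S n = qpoch Q n * (\<Sum>j\<in>{- int n..int n}. fps_const (h j) * A ^ tri j * B ^ tri (j - 1) *
       r (int n + j) * r (int n - j))"
      by (simp flip: mult.assoc)
    thus "qpoch Q (2 * n) * inverse (qpoch Q n) * S n = qpoch Q n * jsum A B (\<lambda>j. fps_const (h j)) n"
      by (simp add: jsum_def Q_def r_def mult_ac)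
  qed
  finally show ?thesis by (simp add: Q_def w_def e_def)
qed

text \<open>Weight 1 in the limit above. One of the exponents may be 0: the pair 2, 0 produces the
  series with exponents j^2 + j.\<close>

theorem jacobi_triple_product:
  fixes c d :: "'a :: field"
  assumes ab: "a + b > 0"
  defines "A \<equiv> fps_const c * fps_X ^ a" and "B \<equiv> fps_const d * fps_X ^ b"
  shows "(\<lambda>n. \<Prod>k<n. (1 - (A * B) ^ Suc k) * ((1 + A * (A * B) ^ k) * (1 + B * (A * B) ^ k))) \<longlonglongrightarrow>
           theta_series (\<lambda>j. c ^ tri j * d ^ tri (j - 1)) (\<lambda>j. a * tri j + b * tri (j - 1))"
proof -
  have Q0: "(A * B) $ 0 = 0" using ab by (auto simp: A_def B_def fps_power_zeroth)
  show ?thesis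
    using jsum_tendsto_theta_series[OF ab, of c d "\<lambda>_. 1"] 
    by (simp add: jsum_const[OF Q0, unfolded A_def B_def] qpoch_def prod.distrib A_def B_def)
qed

text \<open>At A = -1 the product of weight 1 contains the factor 1 + A = 0. Weight j then acts as
  the derivative at this zero, and the three-term recursion collapses to multiplication by (1 -
  Q^(n+1)) (1 - Q^(n+2)).\<close>

lemma jsum_id:
  fixes m :: nat
  defines "B \<equiv> - (fps_X ^ m :: 'a :: field fps)"
  assumes m: "m > 0"
  shows "jsum (-1) B of_int (Suc n) = - (qpoch (fps_X ^ m) n * qpoch (fps_X ^ m) (Suc n))"
proof -
  define Q where "Q = (fps_X ^ m :: 'a fps)"
  have AB: "- 1 * B = Q" by (simp add: B_def Q_def)
  have Q0: "(- 1 * B) $ 0 = 0" using m unfolding AB by (simp add: Q_def fps_power_zeroth)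
  have sh: "jsum (-1) B (\<lambda>j. of_int (j + 1)) k = jsum (-1) B of_int k + jsum (-1) B (\<lambda>_. 1) k"
    "jsum (-1) B (\<lambda>j. of_int (j - 1)) k = jsum (-1) B of_int k - jsum (-1) B (\<lambda>_. 1) k" for k
    using jsum_linear[of "-1" B of_int 1 "\<lambda>_. 1" k] jsum_linear[of "-1" B of_int "-1" "\<lambda>_. 1" k]
    by simp_all
  have one: "jsum (-1) B (\<lambda>_. 1) (Suc k) = 0" for k
    unfolding jsum_const[OF Q0] by (rule prod_zero) (auto intro!: bexI[of _ 0])
  show ?thesis
  proof (induction n)
    case 0
    show ?case unfolding jsum_Suc[OF Q0] sh AB
      by (simp add: jsum_0 B_def qpoch_def Q_def)
  next
    case (Suc n)
    have "jsum (-1) B of_int (Suc (Suc n)) =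
        (1 - Q ^ Suc n) * (1 - Q ^ Suc (Suc n)) * jsum (-1) B of_int (Suc n)"
      unfolding jsum_Suc[OF Q0, of _ "Suc n"] sh AB one
      by (simp add: B_def Q_def algebra_simps power_mult power2_eq_square mult_2_right flip: power_add power_Suc)
    thus ?case unfolding Suc by (simp add: qpoch_Suc Q_def mult_ac del: power_Suc)
  qed
qed

text \<open>The limit of \<open>jsum_id\<close>. The sum runs over all integers; j and 1 - j share
  their exponent and together give the classical odd coefficient 2j - 1 up to sign.\<close>

theorem jacobi_cube_identity:
  assumes m: "m > 0" and E: "qpoch (fps_X ^ m) \<longlonglongrightarrow> E"
  shows "theta_series (\<lambda>j. - (of_int j * (-1) ^ tri j * (-1) ^ tri (j - 1))) (\<lambda>j. m * tri (j - 1)) =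
           (E ^ 3 :: 'a :: field fps)"
proof -
  define Q where "Q = (fps_X ^ m :: 'a fps)"
  have E1: "(\<lambda>n. qpoch Q (Suc n)) \<longlonglongrightarrow> E" using LIMSEQ_Suc[OF E] by (simp add: Q_def)
  have "(\<lambda>n. qpoch Q (Suc n) * jsum (-1) (- Q) (\<lambda>j. fps_const (of_int j)) (Suc n)) \<longlonglongrightarrow>
       theta_series (\<lambda>j. of_int j * (-1) ^ tri j * (-1) ^ tri (j - 1)) (\<lambda>j. m * tri (j - 1))"
    using LIMSEQ_Suc[OF jsum_tendsto_theta_series[of 0 m "-1" "-1" of_int]] m
    by (simp add: Q_def flip: fps_const_neg)
  hence "(\<lambda>n. - (qpoch Q (Suc n) * (qpoch Q n * qpoch Q (Suc n)))) \<longlonglongrightarrow>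
       theta_series (\<lambda>j. of_int j * (-1) ^ tri j * (-1) ^ tri (j - 1)) (\<lambda>j. m * tri (j - 1))"
    using jsum_id[OF m, where 'a = 'a] by (simp add: Q_def fps_of_int)
  moreover have "(\<lambda>n. 0 - (qpoch Q (Suc n) * (qpoch Q n * qpoch Q (Suc n)))) \<longlonglongrightarrow> 0 - E * (E * E)"
    by (intro tendsto_diff_fps tendsto_mult_fps E1 E[folded Q_def] tendsto_const)
  ultimately have "theta_series (\<lambda>j. of_int j * (-1) ^ tri j * (-1) ^ tri (j - 1)) (\<lambda>j. m * tri (j - 1)) = - (E ^ 3)"
    by (simp add: LIMSEQ_unique power3_eq_cube mult.assoc)
  thus ?thesis by (auto simp: fps_eq_iff theta_series_nth sum_negf)
qed

section \<open>Four squares\<close>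

lemma theta_series_reindex:
  assumes "bij f"
  shows "theta_series w e = theta_series (w \<circ> f) (e \<circ> f)"
proof (rule fps_ext)
  fix n
  show "theta_series w e $ n = theta_series (w \<circ> f) (e \<circ> f) $ n"
    unfolding theta_series_nth
    by (rule sum.reindex_bij_witness[of _ f "inv_into UNIV f"])
       (use assms in \<open>auto simp: bij_is_surj surj_f_inv_f bij_is_inj\<close>)
qed

text \<open>Used to split a sum over pairs of integers by parity, each half with its own
  coordinates.\<close>

lemma theta_series_split:
  assumes e: "finite_fibres e" and "inj f" "inj g" "range f \<inter> range g = {}" "range f \<union> range g = UNIV"
  shows "theta_series w e = theta_series (w \<circ> f) (e \<circ> f) + theta_series (w \<circ> g) (e \<circ> g)"
proof (rule fps_ext)
  fix n
  have fin: "finite {i. e i = n}" using e by (simp add: finite_fibres_def)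
  have eq: "{i. e i = n} = f ` {i. e (f i) = n} \<union> g ` {i. e (g i) = n}"
  proof (rule equalityI; rule subsetI)
    fix i assume i: "i \<in> {i. e i = n}"
    have "i \<in> range f \<union> range g" using assms(5) by simp
    thus "i \<in> f ` {i. e (f i) = n} \<union> g ` {i. e (g i) = n}" using i by auto
  qed auto
  have "sum w {i. e i = n} = sum w (f ` {i. e (f i) = n}) + sum w (g ` {i. e (g i) = n})"
    unfolding eq by (rule sum.union_disjoint) (use fin assms(4) in \<open>auto simp: eq\<close>)
  also have "sum w (f ` {i. e (f i) = n}) = (\<Sum>i | e (f i) = n. w (f i))"
    by (rule sum.reindex_cong[OF inj_on_subset[OF assms(2)]]) auto
  also have "sum w (g ` {i. e (g i) = n}) = (\<Sum>i | e (g i) = n. w (g i))"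
    by (rule sum.reindex_cong[OF inj_on_subset[OF assms(3)]]) auto
  finally show "theta_series w e $ n = (theta_series (w \<circ> f) (e \<circ> f) + theta_series (w \<circ> g) (e \<circ> g)) $ n"
    by (simp add: theta_series_nth)
qed

lemma theta_series_diff: "theta_series u e - theta_series v e = theta_series (\<lambda>i. u i - v i) e"
  by (simp add: fps_eq_iff theta_series_nth sum_subtractf)

lemma theta_series_add: "theta_series u e + theta_series v e = theta_series (\<lambda>i. u i + v i) e"
  by (simp add: fps_eq_iff theta_series_nth sum.distrib)

lemma theta_series_cmult: "fps_const c * theta_series v e = theta_series (\<lambda>i. c * v i) e"
  by (simp add: fps_eq_iff theta_series_nth sum_distrib_left)

lemma theta_series_deriv:
  "fps_X * fps_deriv (theta_series w e) = theta_series (\<lambda>i. of_nat (e i) * w i) e"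
proof (rule fps_ext)
  fix n
  show "(fps_X * fps_deriv (theta_series w e)) $ n = theta_series (\<lambda>i. of_nat (e i) * w i) e $ n"
    by (cases n) (auto simp: theta_series_nth sum_distrib_left intro!: sum.cong)
qed

lemma finite_fibres_int:
  assumes "\<And>j :: int. \<bar>j\<bar> \<le> int (e j) + c"
  shows "finite_fibres e"
  unfolding finite_fibres_def
proof
  fix n
  have "{i. e i = n} \<subseteq> {- (int n + c)..int n + c}" using assms by (auto dest!: spec) (smt (verit))+
  thus "finite {i. e i = n}" by (rule finite_subset) simp
qed

lemma int_abs_le_square: "\<bar>j\<bar> \<le> j\<^sup>2" for j :: int
proof (cases "j = 0")
  case False
  hence "\<bar>j\<bar> * 1 \<le> \<bar>j\<bar> * \<bar>j\<bar>" by (intro mult_left_mono) auto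
  thus ?thesis by (simp add: power2_eq_square abs_mult_self_eq)
qed simp

lemma finite_fibres_square: "finite_fibres (\<lambda>j :: int. nat (j\<^sup>2))"
  by (rule finite_fibres_int[of _ 0]) (simp add: int_abs_le_square)

lemma finite_fibres_tri: "finite_fibres (\<lambda>j. tri (j - 1))"
  by (rule finite_fibres_int[of _ 1]) (use tri_ge in \<open>smt (verit)\<close>)

lemma tri_add: "tri j + tri (j - 1) = nat (j\<^sup>2)"
  using tri_double[of j] tri_double[of "j - 1"] by (simp add: algebra_simps power2_eq_square)

lemma minus_one_power_tri:
  "(-1) ^ tri j * (-1) ^ tri (j - 1) = (if even j then 1 else -1 :: 'a :: comm_ring_1)"
  unfolding power_add[symmetric] tri_add by (simp add: minus_one_power_iff even_nat_iff)

section \<open>Euler products and the classical theta functions\<close>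

definition phi :: "complex fps" where "phi = theta_series (\<lambda>_ :: int. 1) (\<lambda>j. nat (j\<^sup>2))"

definition phi_alt :: "complex fps"
  where "phi_alt = theta_series (\<lambda>j :: int. if even j then 1 else -1) (\<lambda>j. nat (j\<^sup>2))"

text \<open>The diagonal coefficients are those of the infinite product whenever factor k is 1 up to
  degree k, as in \<open>infprod_lim\<close>.\<close>

definition infprod :: "(nat \<Rightarrow> complex fps) \<Rightarrow> complex fps"
  where "infprod h = Abs_fps (\<lambda>n. (\<Prod>k<n. h k) $ n)"

lemma infprod_lim:
  "(\<And>k i. i \<le> k \<Longrightarrow> (h k - 1) $ i = 0) \<Longrightarrow> (\<lambda>n. \<Prod>k<n. h k) \<longlonglongrightarrow> infprod h"
  unfolding infprod_def by (rule prod_fps_converges)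

definition euler :: "complex fps" where "euler = infprod (\<lambda>k. 1 - fps_X ^ Suc k)"
definition euler_plus :: "complex fps" where "euler_plus = infprod (\<lambda>k. 1 + fps_X ^ Suc k)"
definition euler_odd :: "complex fps" where "euler_odd = infprod (\<lambda>k. 1 - fps_X ^ (2 * k + 1))"

lemma euler_lim: "(\<lambda>n. \<Prod>k<n. 1 - fps_X ^ Suc k) \<longlonglongrightarrow> euler"
  unfolding euler_def by (rule infprod_lim) (auto simp: fps_X_power_iff simp del: power_Suc)

lemma euler_plus_lim: "(\<lambda>n. \<Prod>k<n. 1 + fps_X ^ Suc k) \<longlonglongrightarrow> euler_plus"
  unfolding euler_plus_def by (rule infprod_lim) (auto simp: fps_X_power_iff simp del: power_Suc)

lemma euler_odd_lim: "(\<lambda>n. \<Prod>k<n. 1 - fps_X ^ (2 * k + 1)) \<longlonglongrightarrow> euler_odd"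
  unfolding euler_odd_def by (rule infprod_lim) (auto simp: fps_X_power_iff simp del: power_Suc)

lemma tendsto_double: "f \<longlonglongrightarrow> l \<Longrightarrow> (\<lambda>n. f (2 * n)) \<longlonglongrightarrow> (l :: 'a :: topological_space)"
  using LIMSEQ_subseq_LIMSEQ[of f l "\<lambda>n. 2 * n"] by (simp add: strict_mono_def o_def)

lemma prod_double: "(\<Prod>k<2 * n. f k) = (\<Prod>k<n. f (2 * k) * f (2 * k + 1))"
  for f :: "nat \<Rightarrow> 'a :: comm_monoid_mult"
  by (induction n) (simp_all add: mult_ac)

lemma euler_nth_0: "euler $ 0 = 1"
  by (simp add: euler_def infprod_def)

lemma euler_nonzero: "euler \<noteq> 0"
  using euler_nth_0 by auto

text \<open>Euler's theorem on partitions into odd and into distinct parts. In Euler's product each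
  even factor 1 - X^(2k) is (1 - X^k) (1 + X^k), so a whole Euler product cancels.\<close>

lemma euler_odd_euler_plus: "euler_odd * euler_plus = 1"
proof -
  have "(\<lambda>n. \<Prod>k<2 * n. 1 - fps_X ^ Suc k :: complex fps) \<longlonglongrightarrow> euler"
    using euler_lim by (rule tendsto_double)
  moreover have "(\<Prod>k<2 * n. 1 - fps_X ^ Suc k :: complex fps) =
     (\<Prod>k<n. 1 - fps_X ^ (2 * k + 1)) * ((\<Prod>k<n. 1 - fps_X ^ Suc k) * (\<Prod>k<n. 1 + fps_X ^ Suc k))" for n
    unfolding prod_double prod.distrib[symmetric]
  proof (rule prod.cong[OF refl])
    fix k
    have "fps_X ^ Suc (2 * k + 1) = (fps_X ^ Suc k :: complex fps) * fps_X ^ Suc k"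
      unfolding power_add[symmetric] by (rule arg_cong[where f = "power fps_X"]) simp
    thus "(1 - fps_X ^ Suc (2 * k)) * (1 - fps_X ^ Suc (2 * k + 1)) =
         (1 - fps_X ^ (2 * k + 1)) * ((1 - fps_X ^ Suc k) * (1 + fps_X ^ Suc k) :: complex fps)"
      by (simp only: Suc_eq_plus1[symmetric] distrib_left distrib_right right_diff_distrib left_diff_distrib) simp
  qed
  ultimately have "(\<lambda>n. (\<Prod>k<n. 1 - fps_X ^ (2 * k + 1)) * ((\<Prod>k<n. 1 - fps_X ^ Suc k) * (\<Prod>k<n. 1 + fps_X ^ Suc k)))
       \<longlonglongrightarrow> euler" by simp
  moreover have "(\<lambda>n. (\<Prod>k<n. 1 - fps_X ^ (2 * k + 1)) * ((\<Prod>k<n. 1 - fps_X ^ Suc k) * (\<Prod>k<n. 1 + fps_X ^ Suc k)))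
       \<longlonglongrightarrow> euler_odd * (euler * euler_plus)"
    by (intro tendsto_mult_fps euler_lim euler_plus_lim euler_odd_lim)
  ultimately have "euler = euler_odd * (euler * euler_plus)" by (rule LIMSEQ_unique)
  hence "euler * (euler_odd * euler_plus - 1) = 0" by (simp add: algebra_simps)
  thus ?thesis using euler_nonzero by simp
qed

lemma phi_alt_product: "phi_alt = euler * euler_odd"
proof -
  have "(\<lambda>n. \<Prod>k<n. (1 - (fps_X * fps_X) ^ Suc k) *
         ((1 - fps_X * (fps_X * fps_X) ^ k) * (1 - fps_X * (fps_X * fps_X) ^ k))) \<longlonglongrightarrow> phi_alt"
    using jacobi_triple_product[of 1 1 "-1 :: complex" "-1"]
    by (simp add: phi_alt_def minus_one_power_tri tri_add flip: fps_const_neg)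
  also have "(\<lambda>n. \<Prod>k<n. (1 - (fps_X * fps_X) ^ Suc k) *
         ((1 - fps_X * (fps_X * fps_X) ^ k) * (1 - fps_X * (fps_X * fps_X) ^ k))) =
     (\<lambda>n. (\<Prod>k<2 * n. 1 - fps_X ^ Suc k) * (\<Prod>k<n. 1 - fps_X ^ (2 * k + 1)) :: complex fps)"
    unfolding prod_double prod.distrib[symmetric]
    by (intro ext prod.cong refl) (simp add: power_mult power2_eq_square power_mult_distrib mult_ac)
  finally show ?thesis
    using tendsto_mult_fps[OF tendsto_double[OF euler_lim] euler_odd_lim] LIMSEQ_unique by blast
qed

definition phi_factor :: "nat \<Rightarrow> complex fps"
  where "phi_factor k = (1 - fps_X ^ (2 * k + 2)) * (1 + fps_X ^ (2 * k + 1))\<^sup>2"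

definition psi_factor :: "nat \<Rightarrow> complex fps"
  where "psi_factor k = (1 - fps_X ^ (2 * k + 2)) * (1 + fps_X ^ (2 * k + 2))\<^sup>2"

lemma phi_lim: "(\<lambda>n. \<Prod>k<n. phi_factor k) \<longlonglongrightarrow> phi"
proof -
  have "(\<lambda>n. \<Prod>k<n. (1 - (fps_X * fps_X) ^ Suc k) *
         ((1 + fps_X * (fps_X * fps_X) ^ k) * (1 + fps_X * (fps_X * fps_X) ^ k))) \<longlonglongrightarrow> phi"
    using jacobi_triple_product[of 1 1 "1 :: complex" "1"]
    by (simp add: phi_def tri_add)
  also have "(\<lambda>n. \<Prod>k<n. (1 - (fps_X * fps_X) ^ Suc k) *
         ((1 + fps_X * (fps_X * fps_X) ^ k) * (1 + fps_X * (fps_X * fps_X) ^ k))) =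
     (\<lambda>n. (\<Prod>k<n. phi_factor k) :: complex fps)"
    by (intro ext prod.cong refl) (simp add: phi_factor_def power_mult power2_eq_square power_mult_distrib mult_ac)
  finally show ?thesis .
qed

definition psi :: "complex fps" where "psi = infprod psi_factor"

lemma psi_lim: "(\<lambda>n. \<Prod>k<n. psi_factor k) \<longlonglongrightarrow> psi"
  unfolding psi_def
proof (rule infprod_lim)
  fix k i :: nat assume "i \<le> k"
  define y where "y = (fps_X ^ (2 * k + 2) :: complex fps)"
  have "psi_factor k - 1 = (1 - y - y\<^sup>2) * y"
    unfolding psi_factor_def y_def[symmetric] by (simp add: algebra_simps power2_eq_square)
  also have "\<dots> $ i = 0"
    by (rule fps_mult_nth_zero_below[of "2 * k + 2"]) (use \<open>i \<le> k\<close> in \<open>auto simp: y_def fps_X_power_iff\<close>)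
  finally show "(psi_factor k - 1) $ i = 0" .
qed

text \<open>The indices j and -1 - j share their exponent, whence the factor 2. On the product side
  it is the factor 1 + B Q^0 with B = 1.\<close>

lemma psi_theta: "theta_series (\<lambda>_ :: int. 1) (\<lambda>j. nat (j\<^sup>2 + j)) = 2 * psi"
proof -
  have tri2: "2 * tri j = nat (j\<^sup>2 + j)" for j
    using tri_double[of j] by (simp add: power2_eq_square algebra_simps)
  have "(\<lambda>n. \<Prod>k<n. (1 - (fps_X ^ 2) ^ Suc k) * ((1 + fps_X ^ 2 * (fps_X ^ 2) ^ k) * (1 + (fps_X ^ 2) ^ k)))
         \<longlonglongrightarrow> theta_series (\<lambda>_ :: int. 1 :: complex) (\<lambda>j. nat (j\<^sup>2 + j))"
    using jacobi_triple_product[of 2 0 "1 :: complex" "1"] by (simp add: tri2)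
  hence "(\<lambda>n. \<Prod>k<Suc n. (1 - (fps_X ^ 2) ^ Suc k) * ((1 + fps_X ^ 2 * (fps_X ^ 2) ^ k) * (1 + (fps_X ^ 2) ^ k)))
         \<longlonglongrightarrow> theta_series (\<lambda>_ :: int. 1 :: complex) (\<lambda>j. nat (j\<^sup>2 + j))"
    by (rule LIMSEQ_Suc)
  \<comment> \<open>The third factor lags one index behind the other two. Regrouping leaves the 2 of
    index 0 in front and an incomplete last factor, which tends to 1.\<close>
  also have "(\<lambda>n. \<Prod>k<Suc n. (1 - (fps_X ^ 2) ^ Suc k) * ((1 + fps_X ^ 2 * (fps_X ^ 2) ^ k) * (1 + (fps_X ^ 2) ^ k)))
       = (\<lambda>n. 2 * (\<Prod>k<n. psi_factor k) * ((1 - fps_X ^ (2 * n + 2)) * (1 + fps_X ^ (2 * n + 2)) :: complex fps))"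
  proof
    fix n
    show "(\<Prod>k<Suc n. (1 - (fps_X ^ 2) ^ Suc k) * ((1 + fps_X ^ 2 * (fps_X ^ 2) ^ k) * (1 + (fps_X ^ 2) ^ k)))
       = 2 * (\<Prod>k<n. psi_factor k) * ((1 - fps_X ^ (2 * n + 2)) * (1 + fps_X ^ (2 * n + 2)) :: complex fps)"
    proof (induction n)
      case 0
      show ?case by (simp add: numeral_2_eq_2 flip: numeral_eq_Suc)
    next
      case (Suc n)
      define y where "y = (fps_X ^ (2 * n + 2) :: complex fps)"
      define z where "z = (fps_X ^ (2 * Suc n + 2) :: complex fps)"
      have e: "(fps_X ^ 2) ^ Suc n = y" "(fps_X ^ 2) ^ Suc (Suc n) = z" "fps_X ^ 2 * y = z"
        unfolding y_def z_def power_mult[symmetric] power_add[symmetric]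
        by (rule arg_cong[where f = "power fps_X"]; simp)+
      show ?case
        unfolding prod.lessThan_Suc[of _ "Suc n"] Suc y_def[symmetric] z_def[symmetric] e
        unfolding prod.lessThan_Suc psi_factor_def[of n] y_def[symmetric] by (simp only: power2_eq_square mult_ac)
    qed
  qed
  finally have lim: "(\<lambda>n. 2 * (\<Prod>k<n. psi_factor k) * ((1 - fps_X ^ (2 * n + 2)) * (1 + fps_X ^ (2 * n + 2)) :: complex fps))
        \<longlonglongrightarrow> theta_series (\<lambda>_ :: int. 1 :: complex) (\<lambda>j. nat (j\<^sup>2 + j))" .
  have "(\<lambda>n. fps_X ^ (2 * n + 2)) \<longlonglongrightarrow> (0 :: complex fps)"
  proof (rule tendsto_fpsI)
    fix i show "\<forall>\<^sub>F n in sequentially. (fps_X ^ (2 * n + 2)) $ i = (0 :: complex fps) $ i"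
      using eventually_ge_at_top[of i] by eventually_elim (simp add: fps_X_power_iff del: power_Suc)
  qed
  hence "(\<lambda>n. 2 * (\<Prod>k<n. psi_factor k) * ((1 - fps_X ^ (2 * n + 2)) * (1 + fps_X ^ (2 * n + 2)) :: complex fps))
        \<longlonglongrightarrow> 2 * psi * ((1 - 0) * (1 + 0))"
    by (intro tendsto_mult_fps tendsto_diff_fps tendsto_add_fps tendsto_const psi_lim)
  with lim show ?thesis using LIMSEQ_unique by fastforce
qed

lemma phi_psi_product: "phi * psi = euler\<^sup>2 * euler_plus ^ 4"
proof -
  have "(\<Prod>k<n. phi_factor k) * (\<Prod>k<n. psi_factor k) =
     ((\<Prod>k<2 * n. 1 + fps_X ^ Suc k) * ((\<Prod>k<n. 1 - fps_X ^ Suc k) * (\<Prod>k<n. 1 + fps_X ^ Suc k)))\<^sup>2" for n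
    unfolding prod_double prod.distrib[symmetric] prod_power_distrib
  proof (rule prod.cong[OF refl])
    fix k
    have "fps_X ^ (2 * k + 2) = (fps_X ^ Suc k :: complex fps) * fps_X ^ Suc k"
      unfolding power_add[symmetric] by (rule arg_cong[where f = "power fps_X"]) simp
    hence e: "1 - fps_X ^ (2 * k + 2) = (1 - fps_X ^ Suc k) * (1 + fps_X ^ Suc k :: complex fps)"
      by (simp only: distrib_left distrib_right right_diff_distrib left_diff_distrib) simp
    have i: "Suc (2 * k) = 2 * k + 1" "Suc (2 * k + 1) = 2 * k + 2" by simp_all
    show "phi_factor k * psi_factor k = ((1 + fps_X ^ Suc (2 * k)) * (1 + fps_X ^ Suc (2 * k + 1)) *
         ((1 - fps_X ^ Suc k) * (1 + fps_X ^ Suc k)))\<^sup>2"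
      unfolding e[symmetric] i phi_factor_def psi_factor_def by (simp only: power2_eq_square mult_ac)
  qed
  moreover have "(\<lambda>n. (\<Prod>k<n. phi_factor k) * (\<Prod>k<n. psi_factor k)) \<longlonglongrightarrow> phi * psi"
    by (intro tendsto_mult_fps phi_lim psi_lim)
  moreover have "(\<lambda>n. ((\<Prod>k<2 * n. 1 + fps_X ^ Suc k) * ((\<Prod>k<n. 1 - fps_X ^ Suc k) * (\<Prod>k<n. 1 + fps_X ^ Suc k)))\<^sup>2)
      \<longlonglongrightarrow> (euler_plus * (euler * euler_plus))\<^sup>2"
    by (intro tendsto_mult_fps tendsto_power_fps tendsto_double[OF euler_plus_lim] euler_plus_lim euler_lim)
  ultimately have "phi * psi = (euler_plus * (euler * euler_plus))\<^sup>2" using LIMSEQ_unique by fastforce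
  thus ?thesis by (simp add: power2_eq_square power4_eq_xxxx mult_ac)
qed

section \<open>Logarithmic derivatives and Lambert series\<close>

definition lambert :: "nat \<Rightarrow> complex fps"
  where "lambert m = Abs_fps (\<lambda>n. if n > 0 \<and> m dvd n then (-1) ^ (n div m - 1) * of_nat m else 0)"

text \<open>Thus \<open>lambert m\<close> is the expansion of m X^m / (1 + X^m), the logarithmic
  derivative of 1 + X^m for the operator X d/dX.\<close>

lemma lambert_mult: "m > 0 \<Longrightarrow> (1 + fps_X ^ m) * lambert m = of_nat m * fps_X ^ m"
proof (rule fps_ext)
  fix n assume m: "m > 0"
  have "((1 + fps_X ^ m) * lambert m) $ n = lambert m $ n + (if n < m then 0 else lambert m $ (n - m))"
    by (simp add: distrib_right fps_X_power_mult_nth)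
  also have "\<dots> = (if n = m then of_nat m else 0)"
  proof (cases "m dvd n")
    case True
    then obtain k where k: "n = m * k" by auto
    consider "k = 0" | "k = 1" | k' where "k = Suc (Suc k')" by (metis One_nat_def not0_implies_Suc)
    thus ?thesis by cases (use m in \<open>auto simp: lambert_def k\<close>)
  next
    case False
    moreover have "\<not> m dvd n - m" if "\<not> n < m" using False that by (meson dvd_diffD1 dvd_refl not_less dvd_diff_nat dvd_minus_self)
    ultimately show ?thesis by (auto simp: lambert_def)
  qed
  also have "\<dots> = (of_nat m * fps_X ^ m) $ n"
    by (simp add: fps_X_power_iff flip: fps_of_nat)
  finally show "((1 + fps_X ^ m) * lambert m) $ n = (of_nat m * fps_X ^ m) $ n" .
qed

lemma fps_X_deriv_power: "fps_X * fps_deriv (fps_X ^ m) = (of_nat m * fps_X ^ m :: 'a :: comm_ring_1 fps)"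
proof (rule fps_ext)
  fix n
  have "(fps_X * fps_deriv (fps_X ^ m)) $ n = of_nat n * (fps_X ^ m :: 'a fps) $ n" by (cases n) simp_all
  also have "\<dots> = (of_nat m * fps_X ^ m :: 'a fps) $ n" by (simp add: fps_X_power_iff flip: fps_of_nat)
  finally show "(fps_X * fps_deriv (fps_X ^ m)) $ n = (of_nat m * fps_X ^ m :: 'a fps) $ n" .
qed

text \<open>The logarithmic derivative of b/a is additive over products; the Wronskian a D b - b D a
  expresses this without division.\<close>

lemma wronskian_prod:
  fixes a b l :: "nat \<Rightarrow> 'a :: comm_ring_1 fps"
  assumes "\<And>k. a k * (fps_X * fps_deriv (b k)) - b k * (fps_X * fps_deriv (a k)) = a k * b k * l k"
  shows "(\<Prod>k<n. a k) * (fps_X * fps_deriv (\<Prod>k<n. b k)) - (\<Prod>k<n. b k) * (fps_X * fps_deriv (\<Prod>k<n. a k))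
       = (\<Prod>k<n. a k) * (\<Prod>k<n. b k) * (\<Sum>k<n. l k)"
proof (induction n)
  case (Suc n)
  define P Q where "P = (\<Prod>k<n. a k)" and "Q = (\<Prod>k<n. b k)"
  have "(P * a n) * (fps_X * fps_deriv (Q * b n)) - (Q * b n) * (fps_X * fps_deriv (P * a n)) =
     a n * b n * (P * (fps_X * fps_deriv Q) - Q * (fps_X * fps_deriv P)) +
     P * Q * (a n * (fps_X * fps_deriv (b n)) - b n * (fps_X * fps_deriv (a n)))"
    by (simp add: algebra_simps)
  also have "\<dots> = (P * a n) * (Q * b n) * ((\<Sum>k<n. l k) + l n)"
    unfolding assms Suc[folded P_def Q_def] by (simp add: algebra_simps)
  finally show ?case by (simp add: P_def Q_def)
qed simp

lemma phi_psi_factor_wronskian: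
  "phi_factor k * (fps_X * fps_deriv (psi_factor k)) - psi_factor k * (fps_X * fps_deriv (phi_factor k))
     = phi_factor k * psi_factor k * (2 * (lambert (2 * k + 2) - lambert (2 * k + 1)))"
proof -
  define e x y :: "complex fps" where "e = 1 - fps_X ^ (2 * k + 2)"
    and "x = 1 + fps_X ^ (2 * k + 1)" and "y = 1 + fps_X ^ (2 * k + 2)"
  define D where "D f = fps_X * fps_deriv f" for f :: "complex fps"
  have Dx: "D x = x * lambert (2 * k + 1)" and Dy: "D y = y * lambert (2 * k + 2)"
    unfolding D_def x_def y_def by (simp_all add: lambert_mult fps_X_deriv_power del: power_Suc of_nat_Suc of_nat_add add_2_eq_Suc')
  have "(e * x\<^sup>2) * D (e * y\<^sup>2) - (e * y\<^sup>2) * D (e * x\<^sup>2) = 2 * e\<^sup>2 * x * y * (x * D y - y * D x)"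
    by (simp add: D_def power2_eq_square algebra_simps)
  also have "\<dots> = (e * x\<^sup>2) * (e * y\<^sup>2) * (2 * (lambert (2 * k + 2) - lambert (2 * k + 1)))"
    unfolding Dx Dy by (simp add: power2_eq_square algebra_simps)
  finally show ?thesis by (simp add: phi_factor_def psi_factor_def D_def e_def x_def y_def)
qed

text \<open>The expansion of the sum over m >= 1 of (-1)^m m X^m / (1 + X^m). At odd exponents its
  coefficient is minus the divisor sum.\<close>

definition lambert_series :: "complex fps"
  where "lambert_series = Abs_fps (\<lambda>n. \<Sum>m | m dvd n \<and> n > 0. (-1) ^ m * (-1) ^ (n div m - 1) * of_nat m)"

lemma lambert_lim:
  "(\<lambda>n. \<Sum>k<n. 2 * (lambert (2 * k + 2) - lambert (2 * k + 1))) \<longlonglongrightarrow> 2 * lambert_series"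
proof (rule tendsto_fpsI)
  fix i
  show "\<forall>\<^sub>F n in sequentially. (\<Sum>k<n. 2 * (lambert (2 * k + 2) - lambert (2 * k + 1))) $ i = (2 * lambert_series) $ i"
    using eventually_ge_at_top[of i]
  proof eventually_elim
    case (elim n)
    have "(\<Sum>k<n. 2 * (lambert (2 * k + 2) - lambert (2 * k + 1))) =
       2 * (\<Sum>m\<in>{1..2 * n}. (-1) ^ m * lambert m)"
    proof (induction n)
      case (Suc n)
      have "{1..2 * Suc n} = insert (2 * n + 2) (insert (2 * n + 1) {1..2 * n})" by auto
      thus ?case using Suc by (simp add: algebra_simps)
    qed simp
    also have "\<dots> $ i = 2 * (\<Sum>m\<in>{1..2 * n}. (-1) ^ m * lambert m $ i)"
    proof -
      have "((-1) ^ m * lambert m) $ i = (-1) ^ m * lambert m $ i" for m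
        by (cases "even m") simp_all
      thus ?thesis by (simp add: fps_sum_nth numeral_fps_const)
    qed
    also have "(\<Sum>m\<in>{1..2 * n}. (-1) ^ m * lambert m $ i) =
       (\<Sum>m | m dvd i \<and> i > 0. (-1) ^ m * (-1) ^ (i div m - 1) * of_nat m)"
    proof (rule sum.mono_neutral_cong_right)
      show "{m. m dvd i \<and> i > 0} \<subseteq> {1..2 * n}"
      proof safe
        fix m assume "m dvd i" "i > 0"
        hence "m > 0" "m \<le> i" by (auto intro!: Nat.gr0I dvd_imp_le)
        thus "m \<in> {1..2 * n}" using elim by auto
      qed
    qed (auto simp: lambert_def)
    finally show ?case by (simp add: lambert_series_def numeral_fps_const)
  qed
qed

lemma phi_psi_wronskian:
  "phi * (fps_X * fps_deriv psi) - psi * (fps_X * fps_deriv phi) = phi * psi * (2 * lambert_series)"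
proof (rule LIMSEQ_unique)
  show "(\<lambda>n. (\<Prod>k<n. phi_factor k) * (fps_X * fps_deriv (\<Prod>k<n. psi_factor k))
      - (\<Prod>k<n. psi_factor k) * (fps_X * fps_deriv (\<Prod>k<n. phi_factor k)))
    \<longlonglongrightarrow> phi * (fps_X * fps_deriv psi) - psi * (fps_X * fps_deriv phi)"
    by (intro tendsto_diff_fps tendsto_mult_fps tendsto_deriv_fps phi_lim psi_lim tendsto_const)
  show "(\<lambda>n. (\<Prod>k<n. phi_factor k) * (fps_X * fps_deriv (\<Prod>k<n. psi_factor k))
      - (\<Prod>k<n. psi_factor k) * (fps_X * fps_deriv (\<Prod>k<n. phi_factor k)))
    \<longlonglongrightarrow> phi * psi * (2 * lambert_series)"
    unfolding wronskian_prod[OF phi_psi_factor_wronskian]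
    by (intro tendsto_mult_fps phi_lim psi_lim lambert_lim)
qed

text \<open>Squaring the cube identity gives a sum over pairs of integers with a product of two
  linear weights. In the coordinates r, s of the two parity classes the exponent is (r^2 + r) + s^2
  and the weight (2r + 1)^2 - (2s)^2 = 4 (r^2 + r) + 1 - 4 s^2. The weight is therefore linear in
  the two exponents, and X d/dX on \<open>psi\<close> and \<open>phi\<close> produces it.\<close>

lemma euler_power_6:
  "euler ^ 6 = phi * psi + 4 * (phi * (fps_X * fps_deriv psi) - psi * (fps_X * fps_deriv phi))"
proof -
  define eps where "eps j = (if even j then 1 else -1 :: complex)" for j :: int
  define e where "e j = tri (j - 1)" for j
  define w where "w j = of_int (2 * j - 1) * eps j" for j
  have cube: "theta_series (\<lambda>j. - (of_int j * eps j)) e = euler ^ 3"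
    using jacobi_cube_identity[of 1 euler] euler_lim
    by (simp add: qpoch_def[abs_def] minus_one_power_tri eps_def e_def[abs_def] mult.assoc del: power_Suc)
  \<comment> \<open>Adding the series to its image under j -> 1 - j replaces the weight j by 2j - 1,
    so that products of two weights become differences of squares.\<close>
  have "bij (\<lambda>j :: int. 1 - j)" by (rule bijI') (auto intro: exI[of _ "1 - _"])
  hence "euler ^ 3 = theta_series ((\<lambda>j. - (of_int j * eps j)) \<circ> (\<lambda>j. 1 - j)) (e \<circ> (\<lambda>j. 1 - j))"
    unfolding cube[symmetric] by (rule theta_series_reindex)
  also have "e \<circ> (\<lambda>j. 1 - j) = e" by (auto simp: e_def tri_def algebra_simps)
  finally have "2 * euler ^ 3 = theta_series (\<lambda>j. - (of_int j * eps j)) e +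
      theta_series ((\<lambda>j. - (of_int j * eps j)) \<circ> (\<lambda>j. 1 - j)) e"
    by (simp only: cube mult_2)
  also have "\<dots> = theta_series (\<lambda>j. - w j) e"
    unfolding theta_series_add by (rule arg_cong2[where f = theta_series]) (auto simp: w_def eps_def algebra_simps)
  finally have c2: "2 * euler ^ 3 = theta_series (\<lambda>j. - w j) e" .
  have fe: "finite_fibres e" unfolding e_def by (rule finite_fibres_tri)
  define W where "W = (\<lambda>(j, k). w j * w k)"
  define F where "F = (\<lambda>(j, k). e j + e k)"
  \<comment> \<open>\<open>f\<close> covers the pairs of even sum and \<open>g\<close> those of odd
    sum. The second entries r - s + 1 and s - r are exchanged by k -> 1 - k, which preserves
    exponent and weight, so both halves are the same series.\<close>
  define f where "f = (\<lambda>(r :: int, s). (r + s + 1, r - s + 1))"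
  define g where "g = (\<lambda>(r :: int, s). (r + s + 1, s - r))"
  define V where "V = (\<lambda>(r :: int, s :: int). of_int ((2 * r + 1)\<^sup>2 - (2 * s)\<^sup>2) :: complex)"
  define H where "H = (\<lambda>(r :: int, s :: int). nat (r\<^sup>2 + r) + nat (s\<^sup>2))"
  have "4 * euler ^ 6 = (2 * euler ^ 3) * (2 * euler ^ 3)"
    by (simp add: power_mult_distrib flip: power_add)
  also have "\<dots> = theta_series W F"
    unfolding c2 theta_series_mult[OF fe fe] W_def F_def by (simp add: case_prod_unfold)
  also have "\<dots> = theta_series (W \<circ> f) (F \<circ> f) + theta_series (W \<circ> g) (F \<circ> g)"
  proof (rule theta_series_split)
    show "finite_fibres F" unfolding F_def by (rule finite_fibres_add[OF fe fe])
    show "inj f" "inj g" by (auto simp: inj_def f_def g_def)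
    have "False" if "f p = g q" for p q
    proof -
      have "fst (f p) + snd (f p) = 2 * (fst p + 1)" "fst (g q) + snd (g q) = 2 * snd q + 1"
        by (simp_all add: f_def g_def case_prod_unfold)
      with that have "2 * (fst p + 1) = 2 * snd q + 1" by simp
      thus False by presburger
    qed
    thus "range f \<inter> range g = {}" by (metis disjoint_iff imageE)
    show "range f \<union> range g = UNIV"
    proof (rule equalityI[OF subset_UNIV], rule subsetI)
      fix p :: "int \<times> int" 
      obtain j k where p: "p = (j, k)" by (cases p)
      show "p \<in> range f \<union> range g"
      proof (cases "even (j + k)")
        case True
        then obtain m where "j + k = 2 * m" by (rule evenE)
        hence "p = f (m - 1, j - m)" unfolding p f_def prod.case prod.inject by linarith
        thus ?thesis by blast
      next
        case False
        then obtain m where "j + k = 2 * m + 1" by (rule oddE)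
        hence "p = g (j - m - 1, m)" unfolding p g_def prod.case prod.inject by linarith
        thus ?thesis by blast
      qed
    qed
  qed
  also have "W \<circ> f = V"
  proof
    fix p :: "int \<times> int"
    obtain r s where p: "p = (r, s)" by (cases p)
    have "(W \<circ> f) p = of_int ((2 * (r + s + 1) - 1) * (2 * (r - s + 1) - 1)) * (eps (r + s + 1) * eps (r - s + 1))"
      by (simp only: p W_def f_def w_def o_apply prod.case of_int_mult mult_ac)
    also have "(2 * (r + s + 1) - 1) * (2 * (r - s + 1) - 1) = (2 * r + 1)\<^sup>2 - (2 * s)\<^sup>2"
      by (simp add: power2_eq_square algebra_simps)
    also have "eps (r + s + 1) * eps (r - s + 1) = 1" by (simp add: eps_def)
    finally show "(W \<circ> f) p = V p" by (simp add: p V_def)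
  qed
  also have "W \<circ> g = V"
  proof
    fix p :: "int \<times> int"
    obtain r s where p: "p = (r, s)" by (cases p)
    have "(W \<circ> g) p = of_int ((2 * (r + s + 1) - 1) * (2 * (s - r) - 1)) * (eps (r + s + 1) * eps (s - r))"
      by (simp only: p W_def g_def w_def o_apply prod.case of_int_mult mult_ac)
    also have "(2 * (r + s + 1) - 1) * (2 * (s - r) - 1) = - ((2 * r + 1)\<^sup>2 - (2 * s)\<^sup>2)"
      by (simp add: power2_eq_square algebra_simps)
    also have "eps (r + s + 1) * eps (s - r) = -1" by (simp add: eps_def)
    finally show "(W \<circ> g) p = V p" by (simp add: p V_def)
  qed
  also have "F \<circ> f = H"
  proof
    fix p :: "int \<times> int"
    obtain r s where p: "p = (r, s)" by (cases p)
    have "r\<^sup>2 + r \<ge> 0" using tri_double[of r] by (simp add: power2_eq_square algebra_simps)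
    hence "2 * int ((F \<circ> f) p) = 2 * int (H p)"
      using tri_double[of "r + s"] tri_double[of "r - s"]
      by (simp add: p F_def f_def H_def e_def power2_eq_square algebra_simps)
    thus "(F \<circ> f) p = H p" by linarith
  qed
  also have "F \<circ> g = H"
  proof
    fix p :: "int \<times> int"
    obtain r s where p: "p = (r, s)" by (cases p)
    have "r\<^sup>2 + r \<ge> 0" using tri_double[of r] by (simp add: power2_eq_square algebra_simps)
    hence "2 * int ((F \<circ> g) p) = 2 * int (H p)"
      using tri_double[of "r + s"] tri_double[of "s - r - 1"]
      by (simp add: p F_def g_def H_def e_def power2_eq_square algebra_simps)
    thus "(F \<circ> g) p = H p" by linarith
  qed
  finally have E1: "4 * euler ^ 6 = 2 * theta_series V H" by simp
  define p2 where "p2 = (\<lambda>j :: int. nat (j\<^sup>2 + j))"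
  define sq where "sq = (\<lambda>j :: int. nat (j\<^sup>2))"
  have nonneg: "r\<^sup>2 + r \<ge> 0" for r :: int using tri_double[of r] by (simp add: power2_eq_square algebra_simps)
  have p2: "of_nat (p2 r) = (of_int (r\<^sup>2 + r) :: complex)" for r using nonneg[of r] by (simp add: p2_def)
  have sq: "of_nat (sq r) = (of_int (r\<^sup>2) :: complex)" for r by (simp add: sq_def)
  have "p2 j = 2 * tri j" for j
    using tri_double[of j] by (simp add: p2_def power2_eq_square algebra_simps)
  hence "\<bar>j\<bar> \<le> int (p2 j) + 1" for j using tri_ge(1)[of j] by simp
  hence fp2: "finite_fibres p2" by (rule finite_fibres_int)
  have fsq: "finite_fibres sq" unfolding sq_def by (rule finite_fibres_square)
  have th: "theta_series (\<lambda>_ :: int. 1) p2 = 2 * psi" "theta_series (\<lambda>_ :: int. 1) sq = phi"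
    by (simp_all add: p2_def sq_def psi_theta phi_def)
  have th': "theta_series (\<lambda>j. of_nat (p2 j) * 1) p2 = fps_X * fps_deriv (2 * psi)"
     "theta_series (\<lambda>j. of_nat (sq j) * 1) sq = fps_X * fps_deriv phi"
    unfolding th[symmetric] theta_series_deriv by simp_all
  have "theta_series V H = (4 * theta_series (\<lambda>j. of_nat (p2 j) * 1) p2 + theta_series (\<lambda>_. 1) p2) * theta_series (\<lambda>_. 1) sq
        - 4 * theta_series (\<lambda>_. 1) p2 * theta_series (\<lambda>j. of_nat (sq j) * 1) sq"
  proof -
    have "(4 * theta_series (\<lambda>j. of_nat (p2 j) * 1) p2 + theta_series (\<lambda>_. 1) p2) * theta_series (\<lambda>_. 1) sq
        - 4 * theta_series (\<lambda>_. 1) p2 * theta_series (\<lambda>j. of_nat (sq j) * 1) sq =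
      (fps_const 4 * theta_series (\<lambda>j. of_nat (p2 j) * 1) p2 + theta_series (\<lambda>_. 1) p2) * theta_series (\<lambda>_. 1) sq
        - theta_series (\<lambda>_. 1) p2 * (fps_const 4 * theta_series (\<lambda>j. of_nat (sq j) * 1) sq)"
      by (simp add: numeral_fps_const mult_ac)
    also have "\<dots> = theta_series V H"
      unfolding theta_series_cmult theta_series_add theta_series_mult[OF fp2 fsq] theta_series_diff
      unfolding V_def H_def p2 sq p2_def[symmetric] sq_def[symmetric] case_prod_unfold
      by (rule arg_cong2[where f = theta_series]; rule ext)
         (simp add: power2_eq_square distrib_left distrib_right, simp add: p2_def sq_def)
    finally show ?thesis by (rule sym)
  qed
  with E1 have "4 * euler ^ 6 =
     4 * (phi * psi + 4 * (phi * (fps_X * fps_deriv psi) - psi * (fps_X * fps_deriv phi)))"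
  proof -
    assume E1: "4 * euler ^ 6 = 2 * theta_series V H"
    have D: "fps_deriv (2 * psi) = 2 * fps_deriv psi" by simp
    assume "theta_series V H = (4 * theta_series (\<lambda>j. of_nat (p2 j) * 1) p2 + theta_series (\<lambda>_. 1) p2) * theta_series (\<lambda>_. 1) sq
        - 4 * theta_series (\<lambda>_. 1) p2 * theta_series (\<lambda>j. of_nat (sq j) * 1) sq"
    hence V: "theta_series V H = (4 * (fps_X * (2 * fps_deriv psi)) + 2 * psi) * phi - 4 * (2 * psi) * (fps_X * fps_deriv phi)"
      unfolding th th' D .
    show ?thesis unfolding E1 V by (simp add: algebra_simps)
  qed
  thus ?thesis by (rule mult_left_cancel[THEN iffD1, rotated]) simp
qed

text \<open>By the Wronskian, \<open>euler ^ 6\<close> is \<open>phi * psi\<close> times 1 + 8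
  \<open>lambert_series\<close>. Since \<open>phi * psi\<close> is itself a product of Euler
  products, the quotient is the fourth power of \<open>euler\<close> over \<open>euler_plus\<close>,
  that is of \<open>euler * euler_odd\<close>.\<close>

lemma phi_alt_power_4: "phi_alt ^ 4 = 1 + 8 * lambert_series"
proof -
  have "euler ^ 6 = phi * psi * (1 + 8 * lambert_series)"
    unfolding euler_power_6 phi_psi_wronskian by (simp add: algebra_simps)
  hence "euler\<^sup>2 * (euler_plus ^ 4 * (1 + 8 * lambert_series)) = euler\<^sup>2 * euler ^ 4"
    unfolding phi_psi_product by (simp add: mult_ac flip: power_add)
  hence "euler_plus ^ 4 * (1 + 8 * lambert_series) = euler ^ 4"
    by (rule mult_left_cancel[THEN iffD1, rotated]) (simp add: euler_nonzero)
  hence "euler_odd ^ 4 * euler ^ 4 = (euler_odd * euler_plus) ^ 4 * (1 + 8 * lambert_series)"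
    by (simp add: power_mult_distrib mult_ac)
  thus ?thesis unfolding euler_odd_euler_plus phi_alt_product by (simp add: power_mult_distrib mult_ac)
qed

lemma alternating_mult_nth:
  fixes f g :: "'a :: comm_ring_1 fps"
  assumes "\<And>n. f' $ n = (-1) ^ n * f $ n" "\<And>n. g' $ n = (-1) ^ n * g $ n"
  shows "(f' * g') $ n = (-1) ^ n * (f * g) $ n"
  unfolding fps_mult_nth sum_distrib_left
proof (rule sum.cong[OF refl])
  fix i assume "i \<in> {0..n}"
  hence "(-1 :: 'a) ^ n = (-1) ^ i * (-1) ^ (n - i)" by (simp flip: power_add)
  thus "f' $ i * g' $ (n - i) = (-1) ^ n * (f $ i * g $ (n - i))" by (simp add: assms mult_ac)
qed

text \<open>Passing from X to -X turns \<open>phi\<close> into \<open>phi_alt\<close> and only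
  changes the sign of odd coefficients. For odd n all divisors and codivisors are odd, so the signs
  inside the Lambert coefficient are constant.\<close>

theorem jacobi_four_squares:
  assumes "odd n"
  shows "(phi ^ 4) $ n = 8 * of_nat (\<Sum>m | m dvd n. m)"
proof -
  have a: "phi_alt $ n = (-1) ^ n * phi $ n" for n
    unfolding phi_alt_def phi_def theta_series_nth sum_distrib_left
    by (rule sum.cong[OF refl]) (auto simp: even_nat_iff)
  have b: "(phi_alt * phi_alt) $ n = (-1) ^ n * (phi * phi) $ n" for n by (rule alternating_mult_nth) (rule a)+
  have "((phi_alt * phi_alt) * (phi_alt * phi_alt)) $ n = (-1) ^ n * ((phi * phi) * (phi * phi)) $ n"
    by (rule alternating_mult_nth) (rule b)+
  hence "(phi_alt ^ 4) $ n = (-1) ^ n * (phi ^ 4) $ n" by (simp add: power4_eq_xxxx mult_ac)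
  moreover have "(phi_alt ^ 4) $ n = 8 * lambert_series $ n"
    using assms unfolding phi_alt_power_4 by (auto simp: numeral_fps_const elim: oddE)
  moreover have "lambert_series $ n = - of_nat (\<Sum>m | m dvd n. m)"
  proof -
    have "lambert_series $ n = (\<Sum>m | m dvd n. - of_nat m)"
      unfolding lambert_series_def fps_nth_Abs_fps
    proof (rule sum.cong)
      show "{m. m dvd n \<and> 0 < n} = {m. m dvd n}" using assms by (auto elim: oddE)
      fix m assume "m \<in> {m. m dvd n}"
      then obtain k where k: "n = m * k" by auto
      hence "odd m" "odd k" using assms by auto
      moreover have "n div m = k" using k \<open>odd m\<close> by (cases "m = 0") auto
      ultimately show "(-1) ^ m * (-1) ^ (n div m - 1) * of_nat m = (- of_nat m :: complex)" by simp
    qed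
    thus ?thesis by (simp add: sum_negf)
  qed
  ultimately show ?thesis using assms by simp
qed

section \<open>The theta series of the residue classes modulo 3\<close>

definition phi0 :: "complex fps" where "phi0 = theta_series (\<lambda>_ :: int. 1) (\<lambda>j. nat ((3 * j)\<^sup>2))"
definition phi1 :: "complex fps" where "phi1 = theta_series (\<lambda>_ :: int. 1) (\<lambda>j. nat ((3 * j + 1)\<^sup>2))"

text \<open>The residue class 2 modulo 3 is the negative of the class 1, and squares do not see the
  sign.\<close>

lemma theta_square_mod3:
  fixes h :: "int \<Rightarrow> complex"
  shows "theta_series h (\<lambda>j. nat (j\<^sup>2)) = theta_series (\<lambda>j. h (3 * j)) (\<lambda>j. nat ((3 * j)\<^sup>2)) +
           theta_series (\<lambda>j. h (3 * j + 1) + h (- (3 * j + 1))) (\<lambda>j. nat ((3 * j + 1)\<^sup>2))"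
proof (rule fps_ext)
  fix n
  define A where "A f = {j :: int. nat ((f j :: int)\<^sup>2) = n}" for f
  have fin: "finite (A (\<lambda>j. j))" using finite_fibres_square by (simp add: A_def finite_fibres_def)
  let ?f = "\<lambda>j :: int. 3 * j" and ?g = "\<lambda>j :: int. 3 * j + 1" and ?h = "\<lambda>j :: int. - (3 * j + 1)"
  have eq: "A (\<lambda>j. j) = ?f ` A ?f \<union> (?g ` A ?g \<union> ?h ` A ?g)"
  proof (rule equalityI; rule subsetI)
    fix j assume j: "j \<in> A (\<lambda>j. j)"
    consider m where "j = ?f m" | m where "j = ?g m" | m where "j = ?h m"
    proof -
      have "j = ?f (j div 3) \<or> j = ?g (j div 3) \<or> j = ?h (- (j div 3) - 1)" by presburger
      thus ?thesis using that by blast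
    qed
    thus "j \<in> ?f ` A ?f \<union> (?g ` A ?g \<union> ?h ` A ?g)"
    proof cases
      case (1 m)
      hence "m \<in> A ?f" using j by (simp add: A_def)
      thus ?thesis using 1 by blast
    next
      case (2 m)
      hence "m \<in> A ?g" using j by (simp add: A_def)
      thus ?thesis using 2 by blast
    next
      case (3 m)
      hence "j\<^sup>2 = (3 * m + 1)\<^sup>2" by (simp only: power2_minus)
      hence "m \<in> A ?g" using j by (simp add: A_def)
      thus ?thesis using 3 by blast
    qed
  next
    fix j assume "j \<in> ?f ` A ?f \<union> (?g ` A ?g \<union> ?h ` A ?g)"
    then obtain m where "m \<in> A ?f \<and> j = ?f m \<or> m \<in> A ?g \<and> (j = ?g m \<or> j = ?h m)" by blast
    moreover have "(?h m)\<^sup>2 = (?g m)\<^sup>2" by (rule power2_minus)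
    ultimately show "j \<in> A (\<lambda>j. j)" unfolding A_def by (elim disjE conjE) simp_all
  qed
  have d1: "?f ` A ?f \<inter> (?g ` A ?g \<union> ?h ` A ?g) = {}"
  proof (rule equals0I)
    fix x assume "x \<in> ?f ` A ?f \<inter> (?g ` A ?g \<union> ?h ` A ?g)"
    then obtain a b where "x = 3 * a" "x = 3 * b + 1 \<or> x = - (3 * b + 1)" by blast
    thus False by presburger
  qed
  have d2: "?g ` A ?g \<inter> ?h ` A ?g = {}"
  proof (rule equals0I)
    fix x assume "x \<in> ?g ` A ?g \<inter> ?h ` A ?g"
    then obtain a b where "x = 3 * a + 1" "x = - (3 * b + 1)" by blast
    thus False by presburger
  qed
  have fin': "finite (?f ` A ?f)" "finite (?g ` A ?g)" "finite (?h ` A ?g)"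
    using fin unfolding eq by simp_all
  have "sum h (A (\<lambda>j. j)) = sum h (?f ` A ?f) + (sum h (?g ` A ?g) + sum h (?h ` A ?g))"
    unfolding eq using fin' d1 d2 by (simp only: sum.union_disjoint finite_Un simp_thms)
  also have "\<dots> = (\<Sum>j\<in>A ?f. h (3 * j)) + (\<Sum>j\<in>A ?g. h (3 * j + 1) + h (- (3 * j + 1)))"
    by (simp add: sum.distrib sum.reindex inj_on_def)
  finally show "theta_series h (\<lambda>j. nat (j\<^sup>2)) $ n = (theta_series (\<lambda>j. h (3 * j)) (\<lambda>j. nat ((3 * j)\<^sup>2)) +
           theta_series (\<lambda>j. h (3 * j + 1) + h (- (3 * j + 1))) (\<lambda>j. nat ((3 * j + 1)\<^sup>2))) $ n"
    by (simp add: theta_series_nth A_def)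
qed

lemma phi_split: "phi = phi0 + 2 * phi1"
proof -
  have "2 * phi1 = theta_series (\<lambda>j :: int. 2 * 1) (\<lambda>j. nat ((3 * j + 1)\<^sup>2))"
    unfolding phi1_def numeral_fps_const theta_series_cmult ..
  thus ?thesis unfolding phi_def phi0_def theta_square_mod3 by simp
qed

section \<open>Twists by cube roots of unity\<close>

definition omega :: complex where "omega = Complex (-1/2) (sqrt 3 / 2)"

lemma omega_eq: "omega\<^sup>2 + omega + 1 = 0"
  by (simp add: omega_def complex_eq_iff power2_eq_square)

lemma omega_cube: "omega ^ 3 = 1"
proof -
  have "omega ^ 3 - 1 = (omega - 1) * (omega\<^sup>2 + omega + 1)"
    by (simp add: power2_eq_square power3_eq_cube algebra_simps)
  thus ?thesis by (simp add: omega_eq)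
qed

lemma omega_power_mod: "omega ^ n = omega ^ (n mod 3)"
proof -
  have "omega ^ n = omega ^ (3 * (n div 3) + n mod 3)" by simp
  also have "\<dots> = omega ^ (n mod 3)" unfolding power_add power_mult omega_cube by simp
  finally show ?thesis .
qed

lemma omega_power_cong: "n mod 3 = m mod 3 \<Longrightarrow> omega ^ n = omega ^ m"
  using omega_power_mod by metis

text \<open>Factor k of the triple product for A = omega^(i+1) X and B = omega^(i+2) X. The
  exponents of \<open>omega\<close> are reduced modulo 3 so that they become explicit numbers once i
  and the class of k modulo 3 are fixed.\<close>

definition twist_factor :: "nat \<Rightarrow> nat \<Rightarrow> complex fps"
  where "twist_factor i k = (1 - fps_const (omega ^ ((2 * i * (k + 1)) mod 3)) * fps_X ^ (2 * k + 2)) *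
     ((1 + fps_const (omega ^ ((i + 1 + 2 * i * k) mod 3)) * fps_X ^ (2 * k + 1)) *
      (1 + fps_const (omega ^ ((i + 2 + 2 * i * k) mod 3)) * fps_X ^ (2 * k + 1)))"

text \<open>The term of index j has weight omega^(j + i j^2), because
  \<open>tri j + 2 * tri (j - 1)\<close> is j modulo 3. Multiples of 3 get weight 1, while m and -m
  with m = 1 mod 3 together get omega^i (omega + omega^2) = -omega^i.\<close>

lemma twist_lim: "(\<lambda>n. \<Prod>k<n. twist_factor i k) \<longlonglongrightarrow> phi0 - fps_const (omega ^ i) * phi1"
proof -
  define A B where "A = fps_const (omega ^ (i + 1)) * fps_X ^ 1" and "B = fps_const (omega ^ (i + 2)) * fps_X ^ 1"
  have AB: "(A * B) ^ k = fps_const (omega ^ ((2 * i + 3) * k)) * fps_X ^ (2 * k)" for k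
  proof -
    have "A * B = fps_const (omega ^ (2 * i + 3)) * fps_X ^ 2"
      by (simp add: A_def B_def power_add power_mult power2_eq_square mult_ac numeral_3_eq_3 flip: fps_const_mult)
    thus ?thesis by (simp add: power_mult_distrib fps_const_power power_mult)
  qed
  have lim: "(\<lambda>n. \<Prod>k<n. (1 - (A * B) ^ Suc k) * ((1 + A * (A * B) ^ k) * (1 + B * (A * B) ^ k))) \<longlonglongrightarrow>
     theta_series (\<lambda>j. (omega ^ (i + 1)) ^ tri j * (omega ^ (i + 2)) ^ tri (j - 1)) (\<lambda>j. 1 * tri j + 1 * tri (j - 1))"
    unfolding A_def B_def by (rule jacobi_triple_product) simp
  have "(1 - (A * B) ^ Suc k) * ((1 + A * (A * B) ^ k) * (1 + B * (A * B) ^ k)) = twist_factor i k" for k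
  proof -
    have "(A * B) ^ Suc k = fps_const (omega ^ ((2 * i * (k + 1)) mod 3)) * fps_X ^ (2 * k + 2)"
    proof -
      have "omega ^ ((2 * i + 3) * Suc k) = omega ^ ((2 * i * (k + 1)) mod 3)"
      proof (rule omega_power_cong)
        have "(2 * i + 3) * Suc k = 2 * i * (k + 1) + 3 * Suc k" by (simp add: algebra_simps)
        thus "((2 * i + 3) * Suc k) mod 3 = ((2 * i * (k + 1)) mod 3) mod 3"
          by (simp only: mod_mult_self2 mod_mod_trivial)
      qed
      thus ?thesis unfolding AB by simp
    qed
    moreover have "A * (A * B) ^ k = fps_const (omega ^ ((i + 1 + 2 * i * k) mod 3)) * fps_X ^ (2 * k + 1)"
    proof -
      have "A * (A * B) ^ k = fps_const (omega ^ (i + 1 + (2 * i + 3) * k)) * fps_X ^ (2 * k + 1)"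
        unfolding AB unfolding A_def by (simp add: power_add mult_ac flip: fps_const_mult)
      also have "omega ^ (i + 1 + (2 * i + 3) * k) = omega ^ ((i + 1 + 2 * i * k) mod 3)"
      proof (rule omega_power_cong)
        have "i + 1 + (2 * i + 3) * k = (i + 1 + 2 * i * k) + 3 * k" by (simp add: algebra_simps)
        thus "(i + 1 + (2 * i + 3) * k) mod 3 = ((i + 1 + 2 * i * k) mod 3) mod 3"
          by (simp only: mod_mult_self2 mod_mod_trivial)
      qed
      finally show ?thesis .
    qed
    moreover have "B * (A * B) ^ k = fps_const (omega ^ ((i + 2 + 2 * i * k) mod 3)) * fps_X ^ (2 * k + 1)"
    proof -
      have "B * (A * B) ^ k = fps_const (omega ^ (i + 2 + (2 * i + 3) * k)) * fps_X ^ (2 * k + 1)"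
        unfolding AB unfolding B_def by (simp add: power_add mult_ac flip: fps_const_mult)
      also have "omega ^ (i + 2 + (2 * i + 3) * k) = omega ^ ((i + 2 + 2 * i * k) mod 3)"
      proof (rule omega_power_cong)
        have "i + 2 + (2 * i + 3) * k = (i + 2 + 2 * i * k) + 3 * k" by (simp add: algebra_simps)
        thus "(i + 2 + (2 * i + 3) * k) mod 3 = ((i + 2 + 2 * i * k) mod 3) mod 3"
          by (simp only: mod_mult_self2 mod_mod_trivial)
      qed
      finally show ?thesis .
    qed
    ultimately show ?thesis unfolding twist_factor_def by simp
  qed
  note lim[unfolded this]
  also have "theta_series (\<lambda>j. (omega ^ (i + 1)) ^ tri j * (omega ^ (i + 2)) ^ tri (j - 1)) (\<lambda>j. 1 * tri j + 1 * tri (j - 1))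
      = theta_series (\<lambda>j. omega ^ nat (j mod 3) * (omega ^ i) ^ nat (j\<^sup>2 mod 3)) (\<lambda>j. nat (j\<^sup>2))"
  proof (rule arg_cong2[where f = theta_series]; rule ext)
    fix j :: int
    have "(omega ^ (i + 1)) ^ tri j * (omega ^ (i + 2)) ^ tri (j - 1) =
        omega ^ (tri j + 2 * tri (j - 1)) * omega ^ (i * nat (j\<^sup>2))"
      unfolding tri_add[symmetric] power_mult[symmetric] power_add[symmetric]
      by (rule arg_cong[where f = "power omega"]) (simp add: algebra_simps)
    also have "omega ^ (tri j + 2 * tri (j - 1)) = omega ^ nat (j mod 3)"
    proof (rule omega_power_cong)
      have "int (tri j + 2 * tri (j - 1)) = 3 * int (tri (j - 1)) + j" using tri_Suc[of j] by simp
      moreover have "a mod 3 = nat (j mod 3) mod 3" if "int a = 3 * int b + j" for a b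
      proof -
        have "j mod 3 = int a mod 3" using that by presburger
        thus ?thesis by (simp add: nat_mod_distrib)
      qed
      ultimately show "(tri j + 2 * tri (j - 1)) mod 3 = nat (j mod 3) mod 3" by blast
    qed
    also have "omega ^ (i * nat (j\<^sup>2)) = (omega ^ i) ^ nat (j\<^sup>2 mod 3)"
      unfolding power_mult[symmetric]
    proof (rule omega_power_cong)
      have "nat (j\<^sup>2 mod 3) = nat (j\<^sup>2) mod 3" by (simp add: nat_mod_distrib)
      thus "(i * nat (j\<^sup>2)) mod 3 = (i * nat (j\<^sup>2 mod 3)) mod 3" by (simp add: mod_mult_right_eq)
    qed
    finally show "(omega ^ (i + 1)) ^ tri j * (omega ^ (i + 2)) ^ tri (j - 1) =
       omega ^ nat (j mod 3) * (omega ^ i) ^ nat (j\<^sup>2 mod 3)" .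
  qed (simp add: tri_add)
  also have "\<dots> = phi0 - fps_const (omega ^ i) * phi1"
  proof -
    have m: "(3 * j)\<^sup>2 mod 3 = 0" "(3 * j + 1)\<^sup>2 mod 3 = 1" "(3 * j) mod 3 = 0" "(3 * j + 1) mod 3 = 1"
       "(- (3 * j + 1)) mod 3 = 2" for j :: int
    proof -
      have "(3 * j)\<^sup>2 = 3 * (3 * j\<^sup>2)" "(3 * j + 1)\<^sup>2 = 3 * (3 * j\<^sup>2 + 2 * j) + 1"
        by (simp_all add: power2_eq_square algebra_simps)
      thus "(3 * j)\<^sup>2 mod 3 = 0" "(3 * j + 1)\<^sup>2 mod 3 = 1" by presburger+
    qed presburger+
    have o: "omega * c + omega\<^sup>2 * c = - c" for c
    proof -
      have "omega * c + omega\<^sup>2 * c = (omega\<^sup>2 + omega + 1) * c - c" by (simp add: algebra_simps)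
      thus ?thesis by (simp add: omega_eq)
    qed
    have n: "theta_series (\<lambda>j :: int. - (omega ^ i) * 1) (\<lambda>j. nat ((3 * j + 1)\<^sup>2)) = - (fps_const (omega ^ i) * phi1)"
      unfolding theta_series_cmult[symmetric] phi1_def by (simp flip: fps_const_neg)
    show ?thesis
      unfolding theta_square_mod3 power2_minus m phi0_def using n by (simp add: o)
  qed
  finally show ?thesis .
qed

lemma cube_root_product:
  fixes W y :: "'a :: comm_ring_1"
  assumes "W\<^sup>2 + W + 1 = 0"
  shows "(1 + y) * (1 + W * y) * (1 + W\<^sup>2 * y) = 1 + y ^ 3"
    "(1 - y) * (1 - W * y) * (1 - W\<^sup>2 * y) = 1 - y ^ 3"
    "(1 + W * y) * (1 + W\<^sup>2 * y) = 1 - y + y\<^sup>2"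
proof -
  have s: "W + W\<^sup>2 = -1" using assms by (simp add: eq_neg_iff_add_eq_0 add_ac)
  have "W * W\<^sup>2 - 1 = (W - 1) * (W\<^sup>2 + W + 1)" by (simp add: algebra_simps power2_eq_square)
  hence c: "W * W\<^sup>2 = 1" by (simp add: assms)
  have "(1 + W * y) * (1 + W\<^sup>2 * y) = 1 + (W + W\<^sup>2) * y + (W * W\<^sup>2) * y\<^sup>2" for y
    by (simp add: algebra_simps power2_eq_square)
  hence a: "(1 + W * y) * (1 + W\<^sup>2 * y) = 1 - y + y\<^sup>2" for y unfolding s c by simp
  show "(1 + W * y) * (1 + W\<^sup>2 * y) = 1 - y + y\<^sup>2" by (rule a)
  show "(1 + y) * (1 + W * y) * (1 + W\<^sup>2 * y) = 1 + y ^ 3"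
    unfolding mult.assoc a by (simp add: algebra_simps power2_eq_square power3_eq_cube)
  have "(1 - W * y) * (1 - W\<^sup>2 * y) = 1 + y + y\<^sup>2" using a[of "- y"] by simp
  thus "(1 - y) * (1 - W * y) * (1 - W\<^sup>2 * y) = 1 - y ^ 3"
    unfolding mult.assoc by (simp add: algebra_simps power2_eq_square power3_eq_cube)
qed

lemma phi_cubes_factor:
  "phi0 ^ 3 - phi1 ^ 3 = (phi0 - fps_const (omega ^ 0) * phi1) * (phi0 - fps_const (omega ^ 1) * phi1) *
      (phi0 - fps_const (omega ^ 2) * phi1)"
proof -
  define W where "W = fps_const omega"
  have "W\<^sup>2 + W + 1 = fps_const (omega\<^sup>2 + omega + 1)"
    by (simp add: W_def fps_const_power flip: fps_const_add)
  hence W: "W\<^sup>2 + W + 1 = 0" by (simp add: omega_eq)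
  have s: "W + W\<^sup>2 = -1" using W by (simp add: eq_neg_iff_add_eq_0 add_ac)
  have "W * W\<^sup>2 - 1 = (W - 1) * (W\<^sup>2 + W + 1)" by (simp add: algebra_simps power2_eq_square)
  hence c: "W * W\<^sup>2 = 1" by (simp add: W)
  have "(phi0 - W * phi1) * (phi0 - W\<^sup>2 * phi1) = phi0\<^sup>2 - (W + W\<^sup>2) * (phi0 * phi1) + (W * W\<^sup>2) * phi1\<^sup>2"
    by (simp add: algebra_simps power2_eq_square)
  also have "\<dots> = phi0\<^sup>2 + phi0 * phi1 + phi1\<^sup>2" unfolding s c by simp
  finally have "(phi0 - phi1) * ((phi0 - W * phi1) * (phi0 - W\<^sup>2 * phi1)) = phi0 ^ 3 - phi1 ^ 3"
    by (simp add: algebra_simps power2_eq_square power3_eq_cube)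
  thus ?thesis by (simp add: W_def fps_const_power mult.assoc)
qed

text \<open>For k = 3t + s the exponents of \<open>omega\<close> in the numerator factors depend on
  i through i (2s + 1), those in the first factor through 2i (s + 1). If the coefficient of i is
  prime to 3, the three values of i run through all cube roots of unity and the product is a cube in
  y. Otherwise all three factors agree: this happens for y 3 at s = 1 and for y 6 at s = 2.\<close>

lemma twist_factor_product:
  fixes t :: nat
  defines "y j \<equiv> fps_X ^ (6 * t + j) :: complex fps"
  shows "(\<Prod>s<3. twist_factor 0 (3 * t + s) * twist_factor 1 (3 * t + s) * twist_factor 2 (3 * t + s)) =
     (1 + y 1 ^ 3)\<^sup>2 * (1 + y 5 ^ 3)\<^sup>2 * (1 - y 3 + (y 3)\<^sup>2) ^ 3 * (1 - y 2 ^ 3) * (1 - y 4 ^ 3) * (1 - y 6) ^ 3"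
proof -
  define W where "W = fps_const omega"
  have "W\<^sup>2 + W + 1 = fps_const (omega\<^sup>2 + omega + 1)"
    by (simp add: W_def fps_const_power flip: fps_const_add)
  hence W: "W\<^sup>2 + W + 1 = 0" by (simp add: omega_eq)
  note r = cube_root_product[OF W]
  have Wp: "fps_const (omega ^ k) = W ^ k" for k by (simp add: W_def fps_const_power)
  have tf: "twist_factor i (3 * t + s) = (1 - W ^ ((2 * i * (s + 1)) mod 3) * y (2 * s + 2)) *
     ((1 + W ^ ((i + 1 + 2 * i * s) mod 3) * y (2 * s + 1)) *
      (1 + W ^ ((i + 2 + 2 * i * s) mod 3) * y (2 * s + 1)))" for i s
  proof -
    have "2 * i * (3 * t + s + 1) = 2 * i * (s + 1) + 3 * (2 * i * t)"
      "i + 1 + 2 * i * (3 * t + s) = i + 1 + 2 * i * s + 3 * (2 * i * t)"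
      "i + 2 + 2 * i * (3 * t + s) = i + 2 + 2 * i * s + 3 * (2 * i * t)"
      "2 * (3 * t + s) + 2 = 6 * t + (2 * s + 2)" "2 * (3 * t + s) + 1 = 6 * t + (2 * s + 1)"
      by (simp_all add: algebra_simps)
    thus ?thesis unfolding twist_factor_def Wp y_def by (simp only: mod_mult_self2)
  qed
  have 0: "twist_factor 0 (3 * t + 0) * twist_factor 1 (3 * t + 0) * twist_factor 2 (3 * t + 0) =
     ((1 + y 1) * (1 + W * y 1) * (1 + W\<^sup>2 * y 1))\<^sup>2 * ((1 - y 2) * (1 - W * y 2) * (1 - W\<^sup>2 * y 2))"
    unfolding tf by (simp add: power2_eq_square mult_ac del: add_2_eq_Suc add_2_eq_Suc')
  have 1: "twist_factor 0 (3 * t + 1) * twist_factor 1 (3 * t + 1) * twist_factor 2 (3 * t + 1) =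
     ((1 + W * y 3) * (1 + W\<^sup>2 * y 3)) ^ 3 * ((1 - y 4) * (1 - W * y 4) * (1 - W\<^sup>2 * y 4))"
    unfolding tf by (simp add: power2_eq_square power3_eq_cube mult_ac del: add_2_eq_Suc add_2_eq_Suc')
  have 2: "twist_factor 0 (3 * t + 2) * twist_factor 1 (3 * t + 2) * twist_factor 2 (3 * t + 2) =
     ((1 + y 5) * (1 + W * y 5) * (1 + W\<^sup>2 * y 5))\<^sup>2 * (1 - y 6) ^ 3"
    unfolding tf by (simp add: power2_eq_square power3_eq_cube mult_ac del: add_2_eq_Suc add_2_eq_Suc')
  have p: "(\<Prod>s<3. f s) = f 0 * f 1 * f 2" for f :: "nat \<Rightarrow> complex fps"
    by (simp add: lessThan_Suc numeral_3_eq_3 numeral_2_eq_2 mult_ac)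
  show ?thesis unfolding p 0 1 2 r by (simp only: mult_ac)
qed

lemma prod_triple: "(\<Prod>k<3 * n. f k) = (\<Prod>t<n. f (3 * t) * f (3 * t + 1) * f (3 * t + 2))"
  for f :: "nat \<Rightarrow> 'a :: comm_monoid_mult"
proof (induction n)
  case (Suc n)
  have "3 * Suc n = Suc (Suc (Suc (3 * n)))" by simp
  thus ?case unfolding \<open>3 * Suc n = _\<close> prod.lessThan_Suc Suc by (simp add: mult_ac)
qed simp

lemma tendsto_triple: "f \<longlonglongrightarrow> l \<Longrightarrow> (\<lambda>n. f (3 * n)) \<longlonglongrightarrow> (l :: 'a :: topological_space)"
  using LIMSEQ_subseq_LIMSEQ[of f l "\<lambda>n. 3 * n"] by (simp add: strict_mono_def o_def)

section \<open>The product formula for phi1 and the difference of cubes\<close>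

definition euler6 :: "complex fps" where "euler6 = infprod (\<lambda>k. 1 - (fps_X ^ 6) ^ Suc k)"
definition odd3 :: "complex fps" where "odd3 = infprod (\<lambda>k. 1 + fps_X ^ (6 * k + 3))"

lemma euler6_lim: "qpoch (fps_X ^ 6) \<longlonglongrightarrow> euler6"
proof -
  have "(\<lambda>n. \<Prod>k<n. 1 - (fps_X ^ 6) ^ Suc k) \<longlonglongrightarrow> euler6"
    unfolding euler6_def power_mult[symmetric]
    by (rule infprod_lim) (auto simp: fps_X_power_iff simp del: power_Suc)
  thus ?thesis by (simp add: qpoch_def[abs_def])
qed

lemma odd3_lim: "(\<lambda>n. \<Prod>k<n. 1 + fps_X ^ (6 * k + 3)) \<longlonglongrightarrow> odd3"
  unfolding odd3_def by (rule infprod_lim) (auto simp: fps_X_power_iff simp del: power_Suc)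

lemma phi1_lim: "(\<lambda>n. \<Prod>t<n. (1 - fps_X ^ (18 * t + 18)) * ((1 + fps_X ^ (18 * t + 15)) * (1 + fps_X ^ (18 * t + 3))))
    \<longlonglongrightarrow> theta_series (\<lambda>_. 1 :: complex) (\<lambda>j. 15 * tri j + 3 * tri (j - 1))"
proof -
  have lim: "(\<lambda>n. \<Prod>k<n. (1 - (fps_X ^ 15 * fps_X ^ 3) ^ Suc k) * ((1 + fps_X ^ 15 * (fps_X ^ 15 * fps_X ^ 3) ^ k) *
          (1 + fps_X ^ 3 * (fps_X ^ 15 * fps_X ^ 3) ^ k))) \<longlonglongrightarrow>
      theta_series (\<lambda>_. 1 :: complex) (\<lambda>j. 15 * tri j + 3 * tri (j - 1))"
    using jacobi_triple_product[of 15 3 "1 :: complex" 1] by simp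
  have "(1 - (fps_X ^ 15 * fps_X ^ 3) ^ Suc k) * ((1 + fps_X ^ 15 * (fps_X ^ 15 * fps_X ^ 3) ^ k) *
          (1 + fps_X ^ 3 * (fps_X ^ 15 * fps_X ^ 3) ^ k)) =
      ((1 - fps_X ^ (18 * k + 18)) * ((1 + fps_X ^ (18 * k + 15)) * (1 + fps_X ^ (18 * k + 3))) :: complex fps)" for k
  proof -
    have e: "(fps_X ^ 15 * fps_X ^ 3) ^ m = (fps_X ^ (18 * m) :: complex fps)" for m
      unfolding power_add[symmetric] power_mult by simp
    have "18 * Suc k = 18 * k + 18" "15 + 18 * k = 18 * k + 15" "3 + 18 * k = 18 * k + 3" by simp_all
    thus ?thesis unfolding e unfolding power_add[symmetric] by (simp only:)
  qed
  with lim show ?thesis by (simp only:)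
qed

text \<open>The triple product with exponents a, b has the series exponents ((a + b) j^2 + (a - b)
  j) / 2. The pair 15, 3 is the one that gives 9 j^2 + 6 j = (3j + 1)^2 - 1.\<close>

lemma phi1_shift: "phi1 = fps_X * theta_series (\<lambda>_. 1) (\<lambda>j. 15 * tri j + 3 * tri (j - 1))"
proof (rule fps_ext)
  fix n
  have e: "nat ((3 * j + 1)\<^sup>2) = Suc (15 * tri j + 3 * tri (j - 1))" for j
  proof -
    have "2 * int (Suc (15 * tri j + 3 * tri (j - 1))) = 2 * (3 * j + 1)\<^sup>2"
      using tri_double[of j] tri_double[of "j - 1"] by (simp add: power2_eq_square algebra_simps)
    hence "int (Suc (15 * tri j + 3 * tri (j - 1))) = (3 * j + 1)\<^sup>2"
      by (rule mult_left_cancel[THEN iffD1, rotated]) simp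
    thus ?thesis by (simp only: nat_int flip: \<open>int _ = _\<close>)
  qed
  show "phi1 $ n = (fps_X * theta_series (\<lambda>_. 1) (\<lambda>j. 15 * tri j + 3 * tri (j - 1))) $ n"
    unfolding phi1_def e by (cases n) (simp_all add: theta_series_nth)
qed

text \<open>The one factor that is not of Euler type is 1 - y + y^2 = (1 + y^3) / (1 + y) with y =
  X^(6t+3). The auxiliary product \<open>G\<close> clears this denominator: multiplication by
  \<open>G n ^ 3\<close> yields \<open>G (3 * n) ^ 3\<close> times Euler factors. Both have the
  limit \<open>odd3 ^ 3\<close>, which cancels. The factors of \<open>phi1\<close> turn the
  remaining squares in X^(18t+3) and X^(18t+15) into cubes.\<close>

theorem phi_cubes_product: "phi1 * (phi0 ^ 3 - phi1 ^ 3) = fps_X * euler6 ^ 4"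
proof -
  define w where "w = theta_series (\<lambda>_. 1 :: complex) (\<lambda>j. 15 * tri j + 3 * tri (j - 1))"
  define P where "P = (\<lambda>n. \<Prod>k<n. twist_factor 0 k * twist_factor 1 k * twist_factor 2 k)"
  define w' where "w' n = (\<Prod>t<n. (1 - fps_X ^ (18 * t + 18)) * ((1 + fps_X ^ (18 * t + 15)) * (1 + fps_X ^ (18 * t + 3))) :: complex fps)" for n
  define G where "G n = (\<Prod>k<n. 1 + fps_X ^ (6 * k + 3) :: complex fps)" for n
  define e where "e = qpoch (fps_X ^ 6 :: complex fps)"
  have P: "P \<longlonglongrightarrow> phi0 ^ 3 - phi1 ^ 3"
    unfolding P_def prod.distrib phi_cubes_factor by (intro tendsto_mult_fps twist_lim)
  have G: "G \<longlonglongrightarrow> odd3" unfolding G_def by (rule odd3_lim)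
  have e: "e \<longlonglongrightarrow> euler6" unfolding e_def by (rule euler6_lim)
  have id: "G n ^ 3 * (w' n * P (3 * n)) = G (3 * n) ^ 3 * (e (3 * n) * e n ^ 3)" for n
  proof -
    have "G n ^ 3 * (w' n * P (3 * n)) = (\<Prod>t<n. (1 + fps_X ^ (6 * t + 3)) ^ 3 *
        (((1 - fps_X ^ (18 * t + 18)) * ((1 + fps_X ^ (18 * t + 15)) * (1 + fps_X ^ (18 * t + 3)))) *
         (\<Prod>s<3. twist_factor 0 (3 * t + s) * twist_factor 1 (3 * t + s) * twist_factor 2 (3 * t + s))))"
      unfolding G_def w'_def P_def prod_triple
      by (simp add: prod.distrib prod_power_distrib lessThan_Suc numeral_3_eq_3 mult_ac)
    also have "\<dots> = (\<Prod>t<n. ((1 + fps_X ^ (6 * (3 * t) + 3)) * (1 + fps_X ^ (6 * (3 * t + 1) + 3)) * (1 + fps_X ^ (6 * (3 * t + 2) + 3))) ^ 3 *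
       (((1 - fps_X ^ (6 * (3 * t) + 6)) * (1 - fps_X ^ (6 * (3 * t + 1) + 6)) * (1 - fps_X ^ (6 * (3 * t + 2) + 6))) *
        (1 - fps_X ^ (6 * t + 6)) ^ 3))"
    proof (rule prod.cong[OF refl])
      fix t
      define y where "y j = (fps_X ^ (6 * t + j) :: complex fps)" for j
      have y: "fps_X ^ (6 * (3 * t) + 3) = y 1 ^ 3" "fps_X ^ (6 * (3 * t + 1) + 3) = y 3 ^ 3"
        "fps_X ^ (6 * (3 * t + 2) + 3) = y 5 ^ 3" "fps_X ^ (6 * (3 * t) + 6) = y 2 ^ 3"
        "fps_X ^ (6 * (3 * t + 1) + 6) = y 4 ^ 3" "fps_X ^ (6 * (3 * t + 2) + 6) = y 6 ^ 3"
        "fps_X ^ (18 * t + 18) = y 6 ^ 3" "fps_X ^ (18 * t + 15) = y 5 ^ 3" "fps_X ^ (18 * t + 3) = y 1 ^ 3"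
        unfolding y_def power_mult[symmetric] by (rule arg_cong[where f = "power fps_X"]; simp)+
      have c: "1 + y 3 ^ 3 = (1 + y 3) * (1 - y 3 + (y 3)\<^sup>2)"
        by (simp add: algebra_simps power2_eq_square power3_eq_cube)
      show "(1 + fps_X ^ (6 * t + 3)) ^ 3 *
        (((1 - fps_X ^ (18 * t + 18)) * ((1 + fps_X ^ (18 * t + 15)) * (1 + fps_X ^ (18 * t + 3)))) *
         (\<Prod>s<3. twist_factor 0 (3 * t + s) * twist_factor 1 (3 * t + s) * twist_factor 2 (3 * t + s))) =
        ((1 + fps_X ^ (6 * (3 * t) + 3)) * (1 + fps_X ^ (6 * (3 * t + 1) + 3)) * (1 + fps_X ^ (6 * (3 * t + 2) + 3))) ^ 3 *
       (((1 - fps_X ^ (6 * (3 * t) + 6)) * (1 - fps_X ^ (6 * (3 * t + 1) + 6)) * (1 - fps_X ^ (6 * (3 * t + 2) + 6))) *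
        (1 - fps_X ^ (6 * t + 6)) ^ 3)"
        unfolding twist_factor_product y y_def[symmetric] c
        by (simp only: power2_eq_square power3_eq_cube mult_ac)
    qed
    also have "\<dots> = G (3 * n) ^ 3 * (e (3 * n) * e n ^ 3)"
    proof -
      have e': "e m = (\<Prod>k<m. 1 - fps_X ^ (6 * k + 6))" for m
        unfolding e_def qpoch_def power_mult[symmetric]
        by (intro prod.cong refl arg_cong2[where f = "(-)"] arg_cong[where f = "power fps_X"]) simp
      show ?thesis unfolding G_def e' prod_triple prod.distrib prod_power_distrib[symmetric] by (simp only: mult_ac)
    qed
    finally show ?thesis .
  qed
  have "(\<lambda>n. G n ^ 3 * (w' n * P (3 * n))) \<longlonglongrightarrow> odd3 ^ 3 * (w * (phi0 ^ 3 - phi1 ^ 3))"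
    unfolding w_def w'_def by (intro tendsto_mult_fps tendsto_power_fps G phi1_lim tendsto_triple P)
  moreover have "(\<lambda>n. G n ^ 3 * (w' n * P (3 * n))) \<longlonglongrightarrow> odd3 ^ 3 * (euler6 * euler6 ^ 3)"
    unfolding id by (intro tendsto_mult_fps tendsto_power_fps tendsto_triple[OF G] tendsto_triple[OF e] e)
  ultimately have "odd3 ^ 3 * (w * (phi0 ^ 3 - phi1 ^ 3)) = odd3 ^ 3 * (euler6 * euler6 ^ 3)"
    by (rule LIMSEQ_unique)
  moreover have "odd3 ^ 3 \<noteq> 0"
  proof -
    have "odd3 $ 0 = 1" by (simp add: odd3_def infprod_def)
    thus ?thesis by auto
  qed
  ultimately have "w * (phi0 ^ 3 - phi1 ^ 3) = euler6 * euler6 ^ 3" using mult_left_cancel by blast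
  thus ?thesis unfolding phi1_shift[folded w_def, of] by (simp add: mult.assoc power_Suc[symmetric] del: power_Suc) 
qed

section \<open>The pentagonal number theorem and the fourth power of Euler's product\<close>

lemma euler6_theta:
  "euler6 = theta_series (\<lambda>j. if even j then 1 else -1) (\<lambda>j. 12 * tri j + 6 * tri (j - 1))"
proof -
  have lim: "(\<lambda>n. \<Prod>k<n. (1 - (fps_X ^ 12 * fps_X ^ 6) ^ Suc k) * ((1 - fps_X ^ 12 * (fps_X ^ 12 * fps_X ^ 6) ^ k) *
          (1 - fps_X ^ 6 * (fps_X ^ 12 * fps_X ^ 6) ^ k))) \<longlonglongrightarrow>
      theta_series (\<lambda>j. if even j then 1 else -1 :: complex) (\<lambda>j. 12 * tri j + 6 * tri (j - 1))"
    \<comment> \<open>The exponents 6, 12 and 18 make the three factors run through the multiples of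
      6 in threes; the series exponents 9 j^2 + 3 j are six times the pentagonal numbers.\<close>
    using jacobi_triple_product[of 12 6 "-1 :: complex" "-1"]
    by (simp add: minus_one_power_tri del: power_Suc flip: fps_const_neg)
  have "(1 - (fps_X ^ 12 * fps_X ^ 6) ^ Suc k) * ((1 - fps_X ^ 12 * (fps_X ^ 12 * fps_X ^ 6) ^ k) *
          (1 - fps_X ^ 6 * (fps_X ^ 12 * fps_X ^ 6) ^ k)) =
     (1 - (fps_X ^ 6) ^ Suc (3 * k)) * (1 - (fps_X ^ 6) ^ Suc (3 * k + 1)) * (1 - (fps_X ^ 6) ^ Suc (3 * k + 2) :: complex fps)" for k
  proof -
    have e: "(fps_X ^ 12 * fps_X ^ 6) ^ m = (fps_X ^ (18 * m) :: complex fps)" for m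
      unfolding power_add[symmetric] power_mult by simp
    have "18 * Suc k = 6 * Suc (3 * k + 2)" "12 + 18 * k = 6 * Suc (3 * k + 1)" "6 + 18 * k = 6 * Suc (3 * k)" by simp_all
    thus ?thesis unfolding e unfolding power_add[symmetric] power_mult[symmetric] by (simp only: mult_ac)
  qed
  with lim have "(\<lambda>n. qpoch (fps_X ^ 6) (3 * n)) \<longlonglongrightarrow>
      theta_series (\<lambda>j. if even j then 1 else -1 :: complex) (\<lambda>j. 12 * tri j + 6 * tri (j - 1))"
    unfolding qpoch_def prod_triple by (simp only:)
  thus ?thesis using tendsto_triple[OF euler6_lim] LIMSEQ_unique by blast
qed

lemma euler6_cube_theta:
  "euler6 ^ 3 = theta_series (\<lambda>j. - (of_int j * (if even j then 1 else -1))) (\<lambda>j. 6 * tri (j - 1))"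
  using jacobi_cube_identity[of 6 euler6] euler6_lim by (simp add: mult.assoc minus_one_power_tri)

text \<open>\<open>6 * j + 1 = u + 3 * v\<close> and \<open>2 * k - 1 = u - v\<close> turn the form of \<open>euler6 * euler6 ^ 3\<close> into
  \<open>u\<^sup>2 + 3 * v\<^sup>2\<close>.\<close>

lemma euler6_power_4_theta:
  "fps_X * euler6 ^ 4 = theta_series (\<lambda>(j, m). of_int (2 * j + 4 * m + 1))
     (\<lambda>(j, m). nat ((3 * (j + m) + 1)\<^sup>2 + 3 * (j - m)\<^sup>2))"
proof -
  define eps where "eps j = (if even j then 1 else -1 :: complex)" for j :: int
  define W where "W = (\<lambda>(j, k). - (eps j * eps k * of_int k))"
  define F where "F = (\<lambda>(j, k). (12 * tri j + 6 * tri (j - 1)) + 6 * tri (k - 1))"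
  \<comment> \<open>The two parities of j + k. Their second entries are exchanged by k -> 1 - k,
    which fixes the exponent, so both halves share it and their weights j + 1 + 2m and j + 2m can be
    added.\<close>
  define f where "f = (\<lambda>(j :: int, m :: int). (j, j + 1 + 2 * m))"
  define g where "g = (\<lambda>(j :: int, m :: int). (j, - j - 2 * m))"
  have "\<bar>j\<bar> \<le> int (12 * tri j + 6 * tri (j - 1)) + 1" "\<bar>j\<bar> \<le> int (6 * tri (j - 1)) + 1" for j
    using tri_ge[of j] by simp_all
  hence f1: "finite_fibres (\<lambda>j. 12 * tri j + 6 * tri (j - 1))" and f2: "finite_fibres (\<lambda>j. 6 * tri (j - 1))"
    by (blast intro: finite_fibres_int)+
  have "euler6 ^ 4 = euler6 * euler6 ^ 3" by (simp add: power4_eq_xxxx power3_eq_cube mult.assoc)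
  also have "\<dots> = theta_series W F"
    unfolding euler6_cube_theta unfolding euler6_theta theta_series_mult[OF f1 f2] W_def F_def eps_def
    by (rule arg_cong2[where f = theta_series]; rule ext) (auto simp: case_prod_unfold)
  also have "\<dots> = theta_series (W \<circ> f) (F \<circ> f) + theta_series (W \<circ> g) (F \<circ> g)"
  proof (rule theta_series_split)
    show "finite_fibres F" unfolding F_def by (rule finite_fibres_add[OF f1 f2])
    show "inj f" "inj g" by (auto simp: inj_def f_def g_def)
    show "range f \<inter> range g = {}"
    proof (rule equals0I)
      fix p assume "p \<in> range f \<inter> range g"
      then obtain x y where "p = f x" "p = g y" by blast
      hence "snd p - fst p = 2 * snd x + 1" "snd p - fst p = - 2 * (fst y + snd y)" "fst y = fst p"
        by (simp_all add: f_def g_def case_prod_unfold)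
      thus False by presburger
    qed
    show "range f \<union> range g = UNIV"
    proof (rule equalityI[OF subset_UNIV], rule subsetI)
      fix p :: "int \<times> int" 
      obtain j k where p: "p = (j, k)" by (cases p)
      show "p \<in> range f \<union> range g"
      proof (cases "even (j + k)")
        case True
        then obtain m where "j + k = 2 * m" by (rule evenE)
        hence "p = g (j, - m)" unfolding p g_def prod.case prod.inject by linarith
        thus ?thesis by blast
      next
        case False
        then obtain m where "j + k = 2 * m + 1" by (rule oddE)
        hence "k = j + 1 + 2 * (m - j)" by (simp add: algebra_simps)
        hence "p = f (j, m - j)" unfolding p f_def prod.case by (simp only:)
        thus ?thesis by blast
      qed
    qed
  qed
  also have "F \<circ> g = F \<circ> f"
  proof
    fix p :: "int \<times> int"
    obtain j m where p: "p = (j, m)" by (cases p)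
    have "2 * int (tri (- j - 2 * m - 1)) = 2 * int (tri (j + 1 + 2 * m - 1))"
      unfolding tri_double by (simp add: algebra_simps)
    thus "(F \<circ> g) p = (F \<circ> f) p" by (simp add: p F_def f_def g_def)
  qed
  finally have 1: "euler6 ^ 4 = theta_series (\<lambda>p. (W \<circ> f) p + (W \<circ> g) p) (F \<circ> f)"
    unfolding theta_series_add .
  have 2: "(\<lambda>p. (W \<circ> f) p + (W \<circ> g) p) = (\<lambda>(j, m). of_int (2 * j + 4 * m + 1))"
  proof
    fix p :: "int \<times> int"
    obtain j m where p: "p = (j, m)" by (cases p)
    have "eps j * eps (j + 1 + 2 * m) = -1" "eps j * eps (- j - 2 * m) = 1" by (simp_all add: eps_def)
    thus "(W \<circ> f) p + (W \<circ> g) p = (case p of (j, m) \<Rightarrow> of_int (2 * j + 4 * m + 1))"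
      by (simp add: p W_def f_def g_def)
  qed
  have 3: "(\<lambda>(j, m). nat ((3 * (j + m) + 1)\<^sup>2 + 3 * (j - m)\<^sup>2)) = (\<lambda>p. Suc ((F \<circ> f) p))"
  proof
    fix p :: "int \<times> int"
    obtain j m where p: "p = (j, m)" by (cases p)
    have "int ((F \<circ> f) p) = 6 * (2 * int (tri j)) + 3 * (2 * int (tri (j - 1))) + 3 * (2 * int (tri (j + 1 + 2 * m - 1)))"
      by (simp add: p F_def f_def)
    also have "\<dots> = (3 * (j + m) + 1)\<^sup>2 + 3 * (j - m)\<^sup>2 - 1"
      unfolding tri_double by (simp add: power2_eq_square algebra_simps)
    finally have "(3 * (j + m) + 1)\<^sup>2 + 3 * (j - m)\<^sup>2 = int (Suc ((F \<circ> f) p))" by simp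
    thus "(case p of (j, m) \<Rightarrow> nat ((3 * (j + m) + 1)\<^sup>2 + 3 * (j - m)\<^sup>2)) = Suc ((F \<circ> f) p)"
      unfolding p prod.case by (simp only: nat_int)
  qed
  show ?thesis unfolding 1 2 3 
    by (rule fps_ext, case_tac n) (simp_all add: theta_series_nth)
qed

section \<open>Sums over representations by u^2 + 3v^2\<close>

definition cm_reps :: "nat \<Rightarrow> (int \<times> int) set"
  where "cm_reps n = {(u, v). u\<^sup>2 + 3 * v\<^sup>2 = int n \<and> u mod 3 = 1}"

text \<open>At odd n this is the coefficient of \<open>fps_X * euler6 ^ 4\<close>, the q-expansion
  of eta(6 tau)^4. The condition u = 1 mod 3 fixes the sign of u.\<close>

definition cm_sum :: "nat \<Rightarrow> int" where "cm_sum n = (\<Sum>(u, v)\<in>cm_reps n. u)"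

lemma finite_cm_reps: "finite (cm_reps n)"
proof (rule finite_subset)
  show "cm_reps n \<subseteq> {- int n..int n} \<times> {- int n..int n}"
  proof safe
    fix u v assume "(u, v) \<in> cm_reps n"
    hence "u\<^sup>2 + 3 * v\<^sup>2 = int n" by (simp add: cm_reps_def)
    hence "\<bar>u\<bar> \<le> int n" "\<bar>v\<bar> \<le> int n"
      using int_abs_le_square[of u] int_abs_le_square[of v] zero_le_power2[of u] zero_le_power2[of v] by linarith+
    thus "u \<in> {- int n..int n}" "v \<in> {- int n..int n}" by auto
  qed
qed simp

text \<open>The map from (j, m) to (u, v) reaches only the pairs for which
  \<open>u div 3 + v\<close> is even; u^2 + 3v^2 odd guarantees that. The weight is u - v, and the
  part v cancels under v -> -v.\<close>

lemma phi_cubes_nth: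
  assumes "odd n"
  shows "(phi1 * (phi0 ^ 3 - phi1 ^ 3)) $ n = of_int (cm_sum n)"
proof -
  have "(phi1 * (phi0 ^ 3 - phi1 ^ 3)) $ n =
     (\<Sum>(j, m) | nat ((3 * (j + m) + 1)\<^sup>2 + 3 * (j - m)\<^sup>2) = n. of_int (2 * j + 4 * m + 1))"
    unfolding phi_cubes_product euler6_power_4_theta theta_series_nth by (simp add: case_prod_unfold)
  also have "\<dots> = (\<Sum>(u, v)\<in>cm_reps n. of_int (u - v))"
  proof (rule sum.reindex_bij_witness[of _ "\<lambda>(u, v). ((u div 3 + v) div 2, (u div 3 - v) div 2)"
        "\<lambda>(j, m). (3 * (j + m) + 1, j - m)"])
    fix p :: "int \<times> int" assume "p \<in> {p. case p of (j, m) \<Rightarrow> nat ((3 * (j + m) + 1)\<^sup>2 + 3 * (j - m)\<^sup>2) = n}"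
    moreover have "(3 * x + 1) mod 3 = 1" "(3 * x + 1) div 3 = x" for x :: int by presburger+
    ultimately show "(case (case p of (j, m) \<Rightarrow> (3 * (j + m) + 1, j - m)) of (u, v) \<Rightarrow> ((u div 3 + v) div 2, (u div 3 - v) div 2)) = p"
      "(case p of (j, m) \<Rightarrow> (3 * (j + m) + 1, j - m)) \<in> cm_reps n"
      unfolding cm_reps_def case_prod_unfold by (auto simp del: distrib_left_numeral)
  next
    fix p :: "int \<times> int" assume p: "p \<in> cm_reps n"
    obtain u v where uv: "p = (u, v)" by (cases p)
    define a where "a = u div 3"
    have e: "u\<^sup>2 + 3 * v\<^sup>2 = int n" and "u mod 3 = 1" using p uv by (auto simp: cm_reps_def)
    hence u: "u = 3 * a + 1" using mult_div_mod_eq[of 3 u] by (simp add: a_def)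
    have "odd (u\<^sup>2 + 3 * v\<^sup>2)" using assms e by simp
    hence "even (a + v)" by (simp add: u)
    then obtain s where s: "a + v = 2 * s" by (rule evenE)
    hence d: "(u div 3 + v) div 2 = s" "(u div 3 - v) div 2 = s - v" "a = 2 * s - v" by (simp_all flip: a_def)
    have sv: "s + (s - v) = a" "s - (s - v) = v" using d(3) by simp_all
    show "(case (case p of (u, v) \<Rightarrow> ((u div 3 + v) div 2, (u div 3 - v) div 2)) of (j, m) \<Rightarrow> (3 * (j + m) + 1, j - m)) = p"
      "(case p of (u, v) \<Rightarrow> ((u div 3 + v) div 2, (u div 3 - v) div 2)) \<in> 
         {p. case p of (j, m) \<Rightarrow> nat ((3 * (j + m) + 1)\<^sup>2 + 3 * (j - m)\<^sup>2) = n}"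
      using e unfolding uv mem_Collect_eq prod.case d(1,2) sv u[symmetric] by simp_all
  qed auto
  also have "\<dots> = of_int (\<Sum>(u, v)\<in>cm_reps n. u - v)" by (simp add: case_prod_unfold)
  also have "(\<Sum>(u, v)\<in>cm_reps n. u - v) = cm_sum n - (\<Sum>(u, v)\<in>cm_reps n. v)"
    by (simp add: cm_sum_def case_prod_unfold sum_subtractf)
  also have "(\<Sum>(u, v)\<in>cm_reps n. v) = 0"
  proof -
    have "(\<Sum>(u, v)\<in>cm_reps n. v) = (\<Sum>(u, v)\<in>cm_reps n. - v)"
      by (rule sum.reindex_bij_witness[of _ "\<lambda>(u, v). (u, - v)" "\<lambda>(u, v). (u, - v)"]) (auto simp: cm_reps_def)
    thus ?thesis by (simp add: case_prod_unfold sum_negf)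
  qed
  finally show ?thesis by simp
qed

section \<open>Extraction of r13 from the fourth power of phi\<close>

definition residue_support :: "nat \<Rightarrow> complex fps \<Rightarrow> bool"
  where "residue_support r f \<longleftrightarrow> (\<forall>n. f $ n \<noteq> 0 \<longrightarrow> n mod 3 = r mod 3)"

lemma residue_support_mult:
  assumes "residue_support r f" "residue_support s g"
  shows "residue_support (r + s) (f * g)"
  unfolding residue_support_def
proof safe
  fix n assume "(f * g) $ n \<noteq> 0"
  then obtain i where "i \<in> {0..n}" "f $ i * g $ (n - i) \<noteq> 0"
    unfolding fps_mult_nth by (meson sum.neutral)
  hence "i mod 3 = r mod 3" "(n - i) mod 3 = s mod 3" "i \<le> n"
    using assms by (auto simp: residue_support_def)
  hence "(i + (n - i)) mod 3 = (r + s) mod 3" by (metis mod_add_cong)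
  thus "n mod 3 = (r + s) mod 3" using \<open>i \<le> n\<close> by simp
qed

lemma residue_support_zero: "residue_support r f \<Longrightarrow> n mod 3 \<noteq> r mod 3 \<Longrightarrow> f $ n = 0"
  by (auto simp: residue_support_def)

lemma residue_support_phi0: "residue_support 0 phi0"
  unfolding residue_support_def
proof safe
  fix n assume "phi0 $ n \<noteq> 0"
  then obtain j :: int where "nat ((3 * j)\<^sup>2) = n"
    unfolding phi0_def theta_series_nth by (meson mem_Collect_eq sum.neutral)
  hence "int n = (3 * j)\<^sup>2" by auto
  hence "int n = 3 * (3 * j\<^sup>2)" by (simp add: power2_eq_square)
  thus "n mod 3 = 0 mod 3" by presburger
qed

lemma residue_support_phi1: "residue_support 1 phi1"
  unfolding residue_support_def
proof safe
  fix n assume "phi1 $ n \<noteq> 0"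
  then obtain j :: int where "nat ((3 * j + 1)\<^sup>2) = n"
    unfolding phi1_def theta_series_nth by (meson mem_Collect_eq sum.neutral)
  hence "int n = (3 * j + 1)\<^sup>2" by auto
  hence "int n = 3 * (3 * j\<^sup>2 + 2 * j) + 1" by (simp add: power2_eq_square algebra_simps)
  thus "n mod 3 = 1 mod 3" by presburger
qed

text \<open>A product with i factors \<open>phi1\<close> has its exponents in the class of i modulo
  3, so only i = 1 and i = 4 survive, with binomial coefficients 4 and 1 and powers of 2 from
  \<open>phi_split\<close>.\<close>

lemma phi_power_4_nth:
  assumes "n mod 3 = 1"
  shows "(phi ^ 4) $ n = 8 * (phi1 * phi0 ^ 3) $ n + 16 * (phi1 ^ 4) $ n"
proof -
  have e: "phi ^ 4 = phi0 * phi0 * phi0 * phi0 + 8 * (phi1 * phi0 ^ 3) + 24 * (phi0 * phi0 * phi1 * phi1) +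
       32 * (phi0 * phi1 * phi1 * phi1) + 16 * phi1 ^ 4"
    unfolding phi_split by (simp add: power4_eq_xxxx power3_eq_cube algebra_simps)
  have "(phi0 * phi0 * phi0 * phi0) $ n = 0"
    by (rule residue_support_zero[of "0 + 0 + 0 + 0"]) 
      (intro residue_support_mult residue_support_phi0 residue_support_phi1, simp add: assms)
  moreover have "(phi0 * phi0 * phi1 * phi1) $ n = 0"
    by (rule residue_support_zero[of "0 + 0 + 1 + 1"]) 
      (intro residue_support_mult residue_support_phi0 residue_support_phi1, simp add: assms)
  moreover have "(phi0 * phi1 * phi1 * phi1) $ n = 0"
    by (rule residue_support_zero[of "0 + 1 + 1 + 1"]) 
      (intro residue_support_mult residue_support_phi0 residue_support_phi1, simp add: assms)
  ultimately show ?thesis unfolding e by (simp add: numeral_fps_const)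
qed

lemma phi1_power_4_nth: "(phi1 ^ 4) $ n = of_nat (r13 n)"
proof -
  let ?e = "\<lambda>j :: int. nat ((3 * j + 1)\<^sup>2)"
  have "\<bar>j\<bar> \<le> int (?e j) + 1" for j using int_abs_le_square[of "3 * j + 1"] by simp
  hence f: "finite_fibres ?e" by (rule finite_fibres_int)
  note f2 = finite_fibres_add[OF f f]
  let ?S = "{((a, b), (c, d)). (?e a + ?e b) + (?e c + ?e d) = n}"
  have "phi1 ^ 4 = (phi1 * phi1) * (phi1 * phi1)" by (simp add: power4_eq_xxxx mult.assoc)
  also have "\<dots> $ n = (\<Sum>p\<in>?S. 1)"
    unfolding phi1_def theta_series_mult[OF f f] theta_series_mult[OF f2 f2] theta_series_nth
    by (simp add: case_prod_unfold)
  also have "\<dots> = of_nat (card ?S)" by simp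
  also have "card ?S = r13 n"
    unfolding r13_def
  proof (rule bij_betw_same_card)
    let ?f = "\<lambda>((a, b), (c, d)). vec_lambda (\<lambda>i. if i = 1 then 3 * a + 1 else if i = 2 then 3 * b + 1
         else if i = 3 then 3 * c + 1 else 3 * d + 1) :: int ^ 4"
    have ne: "(2 :: 4) \<noteq> 1" "(3 :: 4) \<noteq> 1" "(3 :: 4) \<noteq> 2" "(4 :: 4) \<noteq> 1" "(4 :: 4) \<noteq> 2" "(4 :: 4) \<noteq> 3"
      by simp_all
    note s4 = sum_4 and all4 = forall_4
    have "bij_betw ?f ?S {x :: int ^ 4. (\<Sum>i\<in>UNIV. (vec_nth x i)\<^sup>2) = int n \<and> (\<forall>i. [vec_nth x i = 1] (mod 3))}"
    proof (rule bij_betw_byWitness[where f' = "\<lambda>x. ((vec_nth x 1 div 3, vec_nth x 2 div 3), (vec_nth x 3 div 3, vec_nth x 4 div 3))"])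
      have d: "(3 * a + 1) div 3 = a" for a :: int by presburger
      show "\<forall>p\<in>?S. (\<lambda>x. ((vec_nth x 1 div 3, vec_nth x 2 div 3), (vec_nth x 3 div 3, vec_nth x 4 div 3))) (?f p) = p"
        by (auto simp: ne d)
      have m: "3 * (a div 3) + 1 = a" if "[a = 1] (mod 3)" for a :: int
        using that mult_div_mod_eq[of 3 a] by (simp add: cong_def)
      show "\<forall>x\<in>{x :: int ^ 4. (\<Sum>i\<in>UNIV. (vec_nth x i)\<^sup>2) = int n \<and> (\<forall>i. [vec_nth x i = 1] (mod 3))}.
          ?f ((vec_nth x 1 div 3, vec_nth x 2 div 3), (vec_nth x 3 div 3, vec_nth x 4 div 3)) = x"
        by (auto simp: vec_eq_iff all4 ne m)
      have c: "[3 * a + 1 = 1] (mod 3)" for a :: int by (simp add: cong_def)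
      show "?f ` ?S \<subseteq> {x :: int ^ 4. (\<Sum>i\<in>UNIV. (vec_nth x i)\<^sup>2) = int n \<and> (\<forall>i. [vec_nth x i = 1] (mod 3))}"
        by (auto simp: s4 all4 ne c)
      show "(\<lambda>x. ((vec_nth x 1 div 3, vec_nth x 2 div 3), (vec_nth x 3 div 3, vec_nth x 4 div 3))) `
         {x :: int ^ 4. (\<Sum>i\<in>UNIV. (vec_nth x i)\<^sup>2) = int n \<and> (\<forall>i. [vec_nth x i = 1] (mod 3))} \<subseteq> ?S"
        by (auto simp: s4 all4 m nat_add_distrib[symmetric])
    qed
    thus "bij_betw ?f ?S {x :: int ^ 4. (\<Sum>i\<in>UNIV. (vec_nth x i)\<^sup>2) = int n \<and> (\<forall>i. [vec_nth x i = 1] (mod 3))}" .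
  qed
  finally show ?thesis .
qed

text \<open>Elimination of \<open>phi1 * phi0 ^ 3\<close>: with c for \<open>cm_sum n\<close> and r
  for \<open>r13 n\<close>, the two relations combine to 8 sigma(n) = 8 (c + r) + 16 r.\<close>

theorem r13_formula:
  assumes "odd n" "n mod 3 = 1"
  shows "3 * int (r13 n) = int (\<Sum>m | m dvd n. m) - cm_sum n"
proof -
  have "phi1 * (phi0 ^ 3 - phi1 ^ 3) = phi1 * phi0 ^ 3 - phi1 ^ 4"
    by (simp add: algebra_simps power4_eq_xxxx power3_eq_cube)
  hence "(phi1 * phi0 ^ 3) $ n = of_int (cm_sum n) + of_nat (r13 n)"
    using phi_cubes_nth[OF assms(1)] phi1_power_4_nth[of n] by (simp add: diff_eq_eq)
  hence "8 * of_nat (\<Sum>m | m dvd n. m) = 8 * (of_int (cm_sum n) + of_nat (r13 n)) + 16 * (of_nat (r13 n) :: complex)"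
    using phi_power_4_nth[OF assms(2)] jacobi_four_squares[OF assms(1)] phi1_power_4_nth[of n] by simp
  hence "of_int (8 * int (\<Sum>m | m dvd n. m)) = (of_int (8 * (cm_sum n + int (r13 n)) + 16 * int (r13 n)) :: complex)"
    by simp
  hence "8 * int (\<Sum>m | m dvd n. m) = 8 * (cm_sum n + int (r13 n)) + 16 * int (r13 n)"
    by (simp only: of_int_eq_iff)
  thus ?thesis by simp
qed

section \<open>Character sums over a finite field\<close>

text \<open>The fixed generator \<open>g\<close> turns sums over units into sums over exponents;
  squares, cubes and classes of twists become congruences of exponents modulo 2, 3 and 6, all of
  which divide the group order 6e.\<close>

locale cubic_field = field R for R (structure) +
  fixes g and e :: nat
  assumes fin: "finite (carrier R)" and card: "card (carrier R) = 6 * e + 1" and e: "e > 0"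
    and g: "g \<in> carrier R" and g0: "g \<noteq> \<zero>"
    and gen: "\<And>x. x \<in> carrier R \<Longrightarrow> x \<noteq> \<zero> \<Longrightarrow> \<exists>i :: nat. x = g [^] i"
begin

lemma pow_nz: "x \<in> carrier R \<Longrightarrow> x \<noteq> \<zero> \<Longrightarrow> x [^] (n :: nat) \<noteq> \<zero>"
  by (induction n) (auto simp: integral_iff)

lemma g_pow [simp]: "g [^] (i :: nat) \<in> carrier R" "g [^] (i :: nat) \<noteq> \<zero>"
  using g g0 pow_nz by auto

lemma card_units: "card (carrier R - {\<zero>}) = 6 * e"
  using fin card by (subst card_Diff_singleton) auto

lemma unit_pow_order: "x \<in> carrier R \<Longrightarrow> x \<noteq> \<zero> \<Longrightarrow> x [^] (6 * e) = \<one>"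
proof -
  assume x: "x \<in> carrier R" "x \<noteq> \<zero>"
  interpret U: group "units_of R" by (rule units_group)
  have c: "carrier (units_of R) = carrier R - {\<zero>}" by (simp add: units_of_carrier field_Units)
  have "x [^]\<^bsub>units_of R\<^esub> order (units_of R) = \<one>\<^bsub>units_of R\<^esub>"
    using x by (intro U.pow_order_eq_1) (simp add: c)
  moreover have "order (units_of R) = 6 * e" using card_units by (simp add: order_def c)
  moreover have "x [^]\<^bsub>units_of R\<^esub> n = x [^] n" for n :: nat
    using x by (intro units_of_pow) (simp add: field_Units)
  ultimately show ?thesis by (simp add: units_of_one)
qed

lemma g_pow_mod: "g [^] (i :: nat) = g [^] (i mod (6 * e))"
proof -
  have "g [^] i = g [^] (6 * e * (i div (6 * e)) + i mod (6 * e))" by simp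
  also have "\<dots> = (g [^] (6 * e)) [^] (i div (6 * e)) \<otimes> g [^] (i mod (6 * e))"
    using g by (simp only: nat_pow_mult[symmetric] nat_pow_pow)
  also have "\<dots> = g [^] (i mod (6 * e))" using g g0 unit_pow_order[of g] by simp
  finally show ?thesis .
qed

lemma bij_g_pow: "bij_betw (\<lambda>i :: nat. g [^] i) {..<6 * e} (carrier R - {\<zero>})"
proof -
  have im: "(\<lambda>i :: nat. g [^] i) ` {..<6 * e} = carrier R - {\<zero>}"
  proof (rule equalityI; rule subsetI)
    fix x assume "x \<in> carrier R - {\<zero>}"
    then obtain i :: nat where "x = g [^] i" using gen by blast
    hence "x = g [^] (i mod (6 * e))" using g_pow_mod by simp
    thus "x \<in> (\<lambda>i :: nat. g [^] i) ` {..<6 * e}" using e by (intro image_eqI) auto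
  qed auto
  hence "inj_on (\<lambda>i :: nat. g [^] i) {..<6 * e}" by (intro eq_card_imp_inj_on) (auto simp: card_units)
  with im show ?thesis by (simp add: bij_betw_def)
qed

lemma g_pow_eq_iff: "g [^] (i :: nat) = g [^] (j :: nat) \<longleftrightarrow> i mod (6 * e) = j mod (6 * e)"
proof
  assume "g [^] i = g [^] j"
  hence "g [^] (i mod (6 * e)) = g [^] (j mod (6 * e))"
    unfolding g_pow_mod[of i, symmetric] g_pow_mod[of j, symmetric] .
  thus "i mod (6 * e) = j mod (6 * e)"
    by (rule inj_onD[OF bij_betw_imp_inj_on[OF bij_g_pow]]) (use e in auto)
next
  assume "i mod (6 * e) = j mod (6 * e)"
  thus "g [^] i = g [^] j" unfolding g_pow_mod[of i] g_pow_mod[of j] by (simp only:)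
qed

lemma sum_carrier: "(\<Sum>x\<in>carrier R. f x) = f \<zero> + (\<Sum>i<6 * e. f (g [^] (i :: nat)))"
  for f :: "'a \<Rightarrow> 'c :: comm_monoid_add"
proof -
  have "(\<Sum>x\<in>carrier R. f x) = f \<zero> + (\<Sum>x\<in>carrier R - {\<zero>}. f x)"
    using fin by (intro sum.remove) auto
  also have "(\<Sum>x\<in>carrier R - {\<zero>}. f x) = (\<Sum>i<6 * e. f (g [^] (i :: nat)))"
    by (rule sum.reindex_bij_betw[OF bij_g_pow, symmetric])
  finally show ?thesis .
qed

text \<open>With r = 6e/m, the solutions are the powers of \<open>g\<close> whose exponent is i
  modulo r, and there are m such exponents below 6e.\<close>

lemma power_eq_card:
  assumes m: "m dvd 6 * e" "m > 0"
  shows "card {y \<in> carrier R. y [^] m = g [^] (m * i)} = m"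
proof -
  obtain r where r: "6 * e = r * m" using m by (auto simp: dvd_def mult.commute)
  have r0: "r > 0" using r e by (cases r) auto
  have "{y \<in> carrier R. y [^] m = g [^] (m * i)} = (\<lambda>j :: nat. g [^] j) ` {j \<in> {..<6 * e}. j mod r = i mod r}"
  proof (rule equalityI; rule subsetI)
    fix y assume y: "y \<in> {y \<in> carrier R. y [^] m = g [^] (m * i)}"
    have "y \<noteq> \<zero>"
    proof
      assume "y = \<zero>"
      hence "g [^] (m * i) = \<zero>" using y m by (simp add: nat_pow_zero)
      thus False using g_pow(2) by blast
    qed
    then obtain j where j: "j < 6 * e" "y = g [^] j"
      using bij_g_pow y by (auto simp: bij_betw_def)
    hence "g [^] (j * m) = g [^] (m * i)" using y g by (simp add: nat_pow_pow)
    hence "(m * j) mod (m * r) = (m * i) mod (m * r)" unfolding g_pow_eq_iff r by (simp only: mult.commute)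
    hence "m * (j mod r) = m * (i mod r)" by (simp only: mult_mod_right)
    hence "j mod r = i mod r" using m by simp
    thus "y \<in> (\<lambda>j :: nat. g [^] j) ` {j \<in> {..<6 * e}. j mod r = i mod r}" using j by blast
  next
    fix y assume "y \<in> (\<lambda>j :: nat. g [^] j) ` {j \<in> {..<6 * e}. j mod r = i mod r}"
    then obtain j where j: "y = g [^] j" "j mod r = i mod r" by blast
    hence "(m * j) mod (m * r) = (m * i) mod (m * r)" by (simp only: mult_mod_right[symmetric])
    hence "g [^] (m * j) = g [^] (m * i)" unfolding g_pow_eq_iff r by (simp only: mult.commute)
    thus "y \<in> {y \<in> carrier R. y [^] m = g [^] (m * i)}" using j g by (simp add: nat_pow_pow mult.commute)
  qed
  also have "card \<dots> = card {j \<in> {..<6 * e}. j mod r = i mod r}"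
    by (rule card_image, rule inj_on_subset[OF bij_betw_imp_inj_on[OF bij_g_pow]]) auto
  also have "{j \<in> {..<6 * e}. j mod r = i mod r} = (\<lambda>t. i mod r + t * r) ` {..<m}"
  proof (rule equalityI; rule subsetI)
    fix j assume j: "j \<in> {j \<in> {..<6 * e}. j mod r = i mod r}"
    hence "j = i mod r + (j div r) * r" using mod_div_mult_eq[of j r] by simp
    moreover have "j div r < m" using j r by (simp add: less_mult_imp_div_less mult.commute)
    ultimately show "j \<in> (\<lambda>t. i mod r + t * r) ` {..<m}" by blast
  next
    fix j assume "j \<in> (\<lambda>t. i mod r + t * r) ` {..<m}"
    then obtain t where t: "t < m" "j = i mod r + t * r" by blast
    have "j < (t + 1) * r" using t r0 by simp
    also have "\<dots> \<le> m * r" using t by (intro mult_right_mono) auto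
    finally show "j \<in> {j \<in> {..<6 * e}. j mod r = i mod r}" using t r by (simp add: mult.commute)
  qed
  also have "card \<dots> = m" using r0 by (subst card_image) (auto simp: inj_on_def)
  finally show ?thesis .
qed

section \<open>The quadratic character\<close>

definition chi :: "'a \<Rightarrow> int"
  where "chi x = (if x = \<zero> then 0 else if \<exists>i :: nat. even i \<and> x = g [^] i then 1 else -1)"

lemma chi_zero [simp]: "chi \<zero> = 0"
  by (simp add: chi_def)

lemma chi_g_pow [simp]: "chi (g [^] (i :: nat)) = (-1) ^ i"
proof -
  have "even i" if "even j" "g [^] i = g [^] j" for j :: nat
  proof -
    have "i mod (6 * e) = j mod (6 * e)" using that g_pow_eq_iff by blast
    hence "i mod (6 * e) mod 2 = j mod (6 * e) mod 2" by simp
    hence "i mod 2 = j mod 2" by (simp add: mod_mod_cancel)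
    thus ?thesis using that by presburger
  qed
  hence "(\<exists>j :: nat. even j \<and> g [^] i = g [^] j) \<longleftrightarrow> even i" by blast
  thus ?thesis by (simp add: chi_def)
qed

lemma chi_mult: "x \<in> carrier R \<Longrightarrow> y \<in> carrier R \<Longrightarrow> chi (x \<otimes> y) = chi x * chi y"
proof -
  assume xy: "x \<in> carrier R" "y \<in> carrier R"
  show ?thesis
  proof (cases "x = \<zero> \<or> y = \<zero>")
    case False
    obtain i :: nat where "x = g [^] i" using gen[of x] xy False by blast
    moreover obtain j :: nat where "y = g [^] j" using gen[of y] xy False by blast
    ultimately show ?thesis using g by (simp add: nat_pow_mult power_add)
  qed (use xy in auto)
qed

lemma chi_one [simp]: "chi \<one> = 1"
  using chi_g_pow[of 0] by simp

lemma chi_square: "x \<in> carrier R \<Longrightarrow> x \<noteq> \<zero> \<Longrightarrow> chi x * chi x = 1"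
proof -
  assume "x \<in> carrier R" "x \<noteq> \<zero>"
  then obtain i :: nat where "x = g [^] i" using gen by blast
  thus ?thesis by (cases "even i") simp_all
qed

lemma chi_pow3: "x \<in> carrier R \<Longrightarrow> chi (x [^] (3 :: nat)) = chi x"
proof (cases "x = \<zero>")
  case False
  assume "x \<in> carrier R"
  thus ?thesis using False chi_square[of x] by (simp add: numeral_3_eq_3 chi_mult)
qed (simp add: nat_pow_zero)

lemma sum_alternating: "(\<Sum>i<2 * n. (-1) ^ i) = (0 :: int)"
  by (induction n) auto

lemma sum_chi: "(\<Sum>x\<in>carrier R. chi x) = 0"
  unfolding sum_carrier using sum_alternating[of "3 * e"] by simp

lemma sum_chi_square: "(\<Sum>x\<in>carrier R. chi x * chi x) = 6 * int e"
proof -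
  have "chi (g [^] i) * chi (g [^] i) = 1" for i :: nat by (rule chi_square) simp_all
  thus ?thesis unfolding sum_carrier by (simp del: chi_g_pow)
qed

lemma sum_shift: "d \<in> carrier R \<Longrightarrow> (\<Sum>c\<in>carrier R. f (c \<oplus> d)) = (\<Sum>c\<in>carrier R. f c)"
  for f :: "'a \<Rightarrow> int"
  by (rule sum.reindex_bij_witness[of _ "\<lambda>c. c \<ominus> d" "\<lambda>c. c \<oplus> d"])
     (auto simp: minus_eq a_assoc r_neg l_neg)

lemma sum_scale: "u \<in> carrier R \<Longrightarrow> u \<noteq> \<zero> \<Longrightarrow> (\<Sum>c\<in>carrier R. f (u \<otimes> c)) = (\<Sum>c\<in>carrier R. f c)"
  for f :: "'a \<Rightarrow> int"
  by (rule sum.reindex_bij_witness[of _ "\<lambda>c. inv u \<otimes> c" "\<lambda>c. u \<otimes> c"])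
     (auto simp: m_assoc[symmetric] field_Units)

lemma inv_divide:
  assumes "c \<in> Units R" "d \<in> Units R"
  shows "inv (d \<otimes> inv c) = inv d \<otimes> c"
proof (rule comm_inv_char)
  have "d \<otimes> inv c \<otimes> (inv d \<otimes> c) = (d \<otimes> inv d) \<otimes> (c \<otimes> inv c)"
    using assms by (simp only: m_ac Units_closed Units_inv_closed m_closed)
  thus "d \<otimes> inv c \<otimes> (inv d \<otimes> c) = \<one>" using assms by simp
qed (use assms in auto)

text \<open>For c nonzero, chi(c) chi(c + d) = chi(c)^2 chi(1 + d/c), and 1 + d/c runs through
  everything except 1. The full character sum is 0, so -chi(1) remains.\<close>

lemma sum_chi_corr:
  assumes d: "d \<in> carrier R" "d \<noteq> \<zero>"
  shows "(\<Sum>c\<in>carrier R. chi c * chi (c \<oplus> d)) = -1"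
proof -
  have "(\<Sum>c\<in>carrier R. chi c * chi (c \<oplus> d)) = (\<Sum>c\<in>carrier R - {\<zero>}. chi c * chi (c \<oplus> d))"
    using fin by (subst sum.remove[of _ \<zero>]) auto
  also have "\<dots> = (\<Sum>x\<in>carrier R - {\<one>}. chi x)"
  proof (rule sum.reindex_bij_witness[of _ "\<lambda>x. d \<otimes> inv (x \<ominus> \<one>)" "\<lambda>c. \<one> \<oplus> d \<otimes> inv c"])
    fix c assume "c \<in> carrier R - {\<zero>}"
    hence c: "c \<in> carrier R" "c \<noteq> \<zero>" "c \<in> Units R" by (auto simp: field_Units)
    have dc: "d \<otimes> inv c \<in> carrier R" "d \<otimes> inv c \<noteq> \<zero>"
      using c d by (auto simp: integral_iff)
         (metis Units_inv_Units field_Units DiffD2 singletonI)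
    show "\<one> \<oplus> d \<otimes> inv c \<in> carrier R - {\<one>}"
      using c d dc by (auto simp: add.r_cancel_one')
    have "\<one> \<oplus> d \<otimes> inv c \<ominus> \<one> = d \<otimes> inv c"
      using dc by (simp add: minus_eq a_comm[of \<one>] a_assoc r_neg)
    moreover have "inv (d \<otimes> inv c) = inv d \<otimes> c"
      using c d by (intro inv_divide) (auto simp: field_Units)
    ultimately show "d \<otimes> inv (\<one> \<oplus> d \<otimes> inv c \<ominus> \<one>) = c"
      using c d by (simp add: m_assoc[symmetric] field_Units)
    have "c \<oplus> d = c \<otimes> (\<one> \<oplus> d \<otimes> inv c)"
      using c d by (simp add: r_distr m_lcomm[of c d])
    hence "chi c * chi (c \<oplus> d) = (chi c * chi c) * chi (\<one> \<oplus> d \<otimes> inv c)"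
      using c d by (simp add: chi_mult)
    thus "chi (\<one> \<oplus> d \<otimes> inv c) = chi c * chi (c \<oplus> d)" using chi_square c by simp
  next
    fix x assume "x \<in> carrier R - {\<one>}"
    hence x: "x \<in> carrier R" "x \<ominus> \<one> \<in> carrier R" "x \<ominus> \<one> \<noteq> \<zero>" by (auto simp: r_right_minus_eq)
    hence u: "x \<ominus> \<one> \<in> Units R" "d \<in> Units R" using d by (auto simp: field_Units)
    hence iu: "inv (x \<ominus> \<one>) \<in> Units R" by simp
    show "d \<otimes> inv (x \<ominus> \<one>) \<in> carrier R - {\<zero>}"
      using u iu by (metis Units_m_closed field_Units)
    have "inv (d \<otimes> inv (x \<ominus> \<one>)) = inv d \<otimes> (x \<ominus> \<one>)"
      using u by (intro inv_divide)
    hence "d \<otimes> inv (d \<otimes> inv (x \<ominus> \<one>)) = x \<ominus> \<one>"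
      using x u d by (simp add: m_assoc[symmetric])
    thus "\<one> \<oplus> d \<otimes> inv (d \<otimes> inv (x \<ominus> \<one>)) = x"
      using x by (simp add: minus_eq a_lcomm[of \<one> x] r_neg)
  qed
  also have "\<dots> = - 1"
    using sum_chi fin sum.remove[of "carrier R" \<one> chi] by simp
  finally show ?thesis .
qed

section \<open>Character sums of the cubic twists\<close>

definition S :: "'a \<Rightarrow> int" where "S c = (\<Sum>x\<in>carrier R. chi (x [^] (3 :: nat) \<oplus> c))"

text \<open>Substitute t x for x and use chi(t^3) = chi(t). For t = g this changes the sign, so up
  to sign only \<open>s 0\<close>, \<open>s 1\<close> and \<open>s 2\<close> occur.\<close>

lemma S_twist:
  assumes c: "c \<in> carrier R" and t: "t \<in> carrier R" "t \<noteq> \<zero>"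
  shows "S (t [^] (3 :: nat) \<otimes> c) = chi t * S c"
proof -
  have "S (t [^] (3 :: nat) \<otimes> c) = (\<Sum>x\<in>carrier R. chi ((t \<otimes> x) [^] (3 :: nat) \<oplus> t [^] (3 :: nat) \<otimes> c))"
    unfolding S_def by (rule sum_scale[OF t, symmetric])
  also have "\<dots> = (\<Sum>x\<in>carrier R. chi t * chi (x [^] (3 :: nat) \<oplus> c))"
  proof (rule sum.cong[OF refl])
    fix x assume x: "x \<in> carrier R"
    have "(t \<otimes> x) [^] (3 :: nat) \<oplus> t [^] (3 :: nat) \<otimes> c = t [^] (3 :: nat) \<otimes> (x [^] (3 :: nat) \<oplus> c)"
      using x c t by (simp add: nat_pow_distrib r_distr)
    thus "chi ((t \<otimes> x) [^] (3 :: nat) \<oplus> t [^] (3 :: nat) \<otimes> c) = chi t * chi (x [^] (3 :: nat) \<oplus> c)"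
      using x c t by (simp add: chi_mult chi_pow3)
  qed
  finally show ?thesis by (simp add: S_def sum_distrib_left)
qed

definition s :: "nat \<Rightarrow> int" where "s i = S (g [^] i)"

lemma s_add_3: "s (i + 3) = - s i"
  using S_twist[of "g [^] i" g] g g0 chi_g_pow[of 1]
  by (simp add: s_def nat_pow_mult add.commute del: chi_g_pow)

lemma s_add_6: "s (i + 6 * t) = s i"
proof (induction t)
  case (Suc t)
  have "s (i + 6 * Suc t) = s (i + 6 * t + 3 + 3)" by (simp add: algebra_simps)
  thus ?case using Suc by (simp only: s_add_3 minus_minus)
qed simp

lemma S_zero: "S \<zero> = 0"
  using sum_chi by (simp add: S_def chi_pow3 cong: sum.cong)

lemma sum_six: "(\<Sum>i<6 * n. f i) = (\<Sum>t<n. f (0 + 6 * t) + f (1 + 6 * t) + f (2 + 6 * t) + f (0 + 3 + 6 * t) + f (1 + 3 + 6 * t) + f (2 + 3 + 6 * t))"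
  for f :: "nat \<Rightarrow> int"
proof (induction n)
  case (Suc n)
  have "6 * Suc n = Suc (Suc (Suc (Suc (Suc (Suc (6 * n))))))" by simp
  moreover have "0 + 6 * n = 6 * n" "1 + 6 * n = Suc (6 * n)" "2 + 6 * n = Suc (Suc (6 * n))"
    "0 + 3 + 6 * n = Suc (Suc (Suc (6 * n)))" "1 + 3 + 6 * n = Suc (Suc (Suc (Suc (6 * n))))"
    "2 + 3 + 6 * n = Suc (Suc (Suc (Suc (Suc (6 * n)))))" by simp_all
  ultimately show ?case by (simp only: sum.lessThan_Suc Suc add_ac)
qed simp

text \<open>Sum over c first. In the second sum the correlation of \<open>chi\<close> with its shift
  by x^3 is 6e for x = 0 and -1 for each of the 6e units x, so the total vanishes.\<close>

lemma sum_S_chi: "(\<Sum>c\<in>carrier R. S c) = 0" "(\<Sum>c\<in>carrier R. chi c * S c) = 0"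
proof -
  have "(\<Sum>c\<in>carrier R. S c) = (\<Sum>x\<in>carrier R. \<Sum>c\<in>carrier R. chi (c \<oplus> x [^] (3 :: nat)))"
    unfolding S_def by (subst sum.swap) (auto simp: a_comm intro!: sum.cong)
  thus "(\<Sum>c\<in>carrier R. S c) = 0" by (simp add: sum_shift sum_chi)
  have "(\<Sum>c\<in>carrier R. chi c * S c) = (\<Sum>x\<in>carrier R. \<Sum>c\<in>carrier R. chi c * chi (c \<oplus> x [^] (3 :: nat)))"
    unfolding S_def sum_distrib_left by (subst sum.swap) (auto simp: a_comm intro!: sum.cong)
  also have "\<dots> = 6 * int e + (\<Sum>i<6 * e. -1)"
    unfolding sum_carrier[of "\<lambda>x. \<Sum>c\<in>carrier R. chi c * chi (c \<oplus> x [^] (3 :: nat))"]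
    using sum_chi_square g by (simp add: nat_pow_zero sum_chi_corr nat_pow_pow cong: sum.cong)
  finally show "(\<Sum>c\<in>carrier R. chi c * S c) = 0" by simp
qed

text \<open>The weight 1 + chi(c) selects the even exponents. The classes 0, 2, 4 modulo 6 thus
  satisfy s 0 + s 2 + s 4 = 0, and s 4 = - s 1.\<close>

lemma s_linear: "s 0 + s 2 = s 1"
proof -
  have "0 = (\<Sum>c\<in>carrier R. S c + chi c * S c)" by (simp add: sum.distrib sum_S_chi)
  also have "\<dots> = (\<Sum>i<6 * e. s i + (-1) ^ i * s i)"
    unfolding sum_carrier by (simp add: S_zero s_def)
  also have "\<dots> = (\<Sum>t<e. 2 * (s 0 + s 2 - s 1))"
    unfolding sum_six s_add_6 unfolding s_add_3 by (rule sum.cong) (auto simp: power_add power_mult)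
  also have "\<dots> = 2 * int e * (s 0 + s 2 - s 1)" by simp
  finally show ?thesis using e by simp
qed

lemma card_cube_eq: "x \<in> carrier R \<Longrightarrow> x \<noteq> \<zero> \<Longrightarrow> card {y \<in> carrier R. y [^] (3 :: nat) = x [^] (3 :: nat)} = 3"
proof -
  assume "x \<in> carrier R" "x \<noteq> \<zero>"
  then obtain i :: nat where "x = g [^] i" using gen by blast
  thus ?thesis using power_eq_card[of 3 i] g by (simp add: nat_pow_pow mult.commute)
qed

text \<open>The second moment of S over all c, with q = 6e + 1. The correlation of chi(x^3 + c) and
  chi(y^3 + c) is q - 1 if x^3 = y^3 and -1 otherwise; three y match each unit x and one matches 0,
  which gives 12 e q. On the other side each of the three squares occurs 2e times.\<close>

lemma s_quadratic: "(s 0)\<^sup>2 + (s 1)\<^sup>2 + (s 2)\<^sup>2 = 6 * (6 * int e + 1)"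
proof -
  let ?q = "6 * int e + 1"
  let ?C = "carrier R"
  have corr: "(\<Sum>c\<in>?C. chi (x [^] (3 :: nat) \<oplus> c) * chi (y [^] (3 :: nat) \<oplus> c)) =
      (if y [^] (3 :: nat) = x [^] (3 :: nat) then ?q else 0) - 1" if "x \<in> ?C" "y \<in> ?C" for x y
  proof -
    define d where "d = y [^] (3 :: nat) \<ominus> x [^] (3 :: nat)"
    have d: "d \<in> ?C" using that by (simp add: d_def)
    have "(\<Sum>c\<in>?C. chi (x [^] (3 :: nat) \<oplus> c) * chi (y [^] (3 :: nat) \<oplus> c)) =
        (\<Sum>c\<in>?C. chi (c \<oplus> x [^] (3 :: nat)) * chi ((c \<oplus> x [^] (3 :: nat)) \<oplus> d))"
      unfolding d_def using that
      by (intro sum.cong refl arg_cong2[where f = "(*)"] arg_cong[where f = chi])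
         (simp_all add: minus_eq a_ac r_neg1 r_neg2 r_neg)
    also have "\<dots> = (\<Sum>c\<in>?C. chi c * chi (c \<oplus> d))"
      using that by (intro sum_shift[where f = "\<lambda>c. chi c * chi (c \<oplus> d)"]) simp
    also have "\<dots> = (if y [^] (3 :: nat) = x [^] (3 :: nat) then ?q else 0) - 1"
    proof (cases "d = \<zero>")
      case True
      hence "y [^] (3 :: nat) = x [^] (3 :: nat)" using that r_right_minus_eq by (simp add: d_def)
      thus ?thesis using True sum_chi_square by (simp cong: sum.cong)
    next
      case False
      hence "y [^] (3 :: nat) \<noteq> x [^] (3 :: nat)" using that by (auto simp: d_def minus_eq r_neg)
      thus ?thesis using sum_chi_corr[OF d False] by simp
    qed
    finally show ?thesis .
  qed
  have "(\<Sum>c\<in>?C. (S c)\<^sup>2) = (\<Sum>c\<in>?C. \<Sum>x\<in>?C. \<Sum>y\<in>?C. chi (x [^] (3 :: nat) \<oplus> c) * chi (y [^] (3 :: nat) \<oplus> c))"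
    by (simp add: S_def power2_eq_square sum_product)
  also have "\<dots> = (\<Sum>x\<in>?C. \<Sum>c\<in>?C. \<Sum>y\<in>?C. chi (x [^] (3 :: nat) \<oplus> c) * chi (y [^] (3 :: nat) \<oplus> c))"
    by (rule sum.swap)
  also have "\<dots> = (\<Sum>x\<in>?C. \<Sum>y\<in>?C. \<Sum>c\<in>?C. chi (x [^] (3 :: nat) \<oplus> c) * chi (y [^] (3 :: nat) \<oplus> c))"
    by (rule sum.cong[OF refl], rule sum.swap)
  also have "\<dots> = (\<Sum>x\<in>?C. \<Sum>y\<in>?C. (if y [^] (3 :: nat) = x [^] (3 :: nat) then ?q else 0) - 1)"
    by (intro sum.cong refl corr)
  also have "\<dots> = (\<Sum>x\<in>?C. ?q * int (card {y \<in> ?C. y [^] (3 :: nat) = x [^] (3 :: nat)}) - ?q)"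
  proof (rule sum.cong[OF refl])
    fix x
    show "(\<Sum>y\<in>?C. (if y [^] (3 :: nat) = x [^] (3 :: nat) then ?q else 0) - 1) =
       ?q * int (card {y \<in> ?C. y [^] (3 :: nat) = x [^] (3 :: nat)}) - ?q"
      using fin card by (simp add: sum_subtractf sum.If_cases Int_def)
  qed
  also have "\<dots> = ?q * int (card {y \<in> ?C. y [^] (3 :: nat) = \<zero> [^] (3 :: nat)}) - ?q + (\<Sum>i<6 * e. ?q * 3 - ?q)"
    unfolding sum_carrier by (simp add: card_cube_eq)
  also have "{y \<in> ?C. y [^] (3 :: nat) = \<zero> [^] (3 :: nat)} = {\<zero>}"
    using pow_nz by (auto simp: nat_pow_zero)
  finally have A: "(\<Sum>c\<in>?C. (S c)\<^sup>2) = int e * (12 * ?q)" by simp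
  define Z where "Z = (s 0)\<^sup>2 + (s 1)\<^sup>2 + (s 2)\<^sup>2"
  have "(\<Sum>c\<in>?C. (S c)\<^sup>2) = (\<Sum>i<6 * e. (s i)\<^sup>2)"
    unfolding sum_carrier by (simp add: S_zero s_def)
  also have "\<dots> = (\<Sum>t<e. 2 * Z)"
    unfolding sum_six s_add_6 unfolding s_add_3 by (simp add: Z_def)
  also have "\<dots> = int e * (2 * Z)" by simp
  finally have "2 * Z = 12 * ?q" unfolding A by (rule mult_left_cancel[THEN iffD1, rotated, OF sym]) (use e in simp)
  thus ?thesis by (simp add: Z_def)
qed

lemma minus_one_pow: "g [^] (3 * e) = \<ominus> \<one>"
proof -
  have "g [^] (3 * e) \<otimes> g [^] (3 * e) = \<one>"
    using unit_pow_order[OF g g0] g by (simp add: nat_pow_mult)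
  hence "g [^] (3 * e) = \<one> \<or> g [^] (3 * e) = \<ominus> \<one>" by (intro square_eq_one) simp_all
  moreover have "g [^] (3 * e) \<noteq> g [^] (0 :: nat)" unfolding g_pow_eq_iff using e by simp
  ultimately show ?thesis by simp
qed

text \<open>Every term is odd except at the roots of x^3 = -1. There are three of them, because -1 =
  g^(3e) is a cube, and the remaining 6e - 2 odd terms have an even sum.\<close>

lemma s0_even: "even (s 0)"
proof -
  have par: "even (chi x) \<longleftrightarrow> x = \<zero>" for x by (simp add: chi_def)
  have "{x \<in> carrier R. x [^] (3 :: nat) \<oplus> \<one> = \<zero>} = {x \<in> carrier R. x [^] (3 :: nat) = g [^] (3 * e)}"
    unfolding minus_one_pow
  proof (rule Collect_cong, rule conj_cong[OF refl])
    fix x assume x: "x \<in> carrier R"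
    show "x [^] (3 :: nat) \<oplus> \<one> = \<zero> \<longleftrightarrow> x [^] (3 :: nat) = \<ominus> \<one>"
    proof
      assume "x [^] (3 :: nat) \<oplus> \<one> = \<zero>"
      thus "x [^] (3 :: nat) = \<ominus> \<one>" by (rule minus_equality[symmetric]) (use x in simp_all)
    next
      assume "x [^] (3 :: nat) = \<ominus> \<one>"
      thus "x [^] (3 :: nat) \<oplus> \<one> = \<zero>" by (simp add: l_neg)
    qed
  qed
  hence c3: "card {x \<in> carrier R. x [^] (3 :: nat) \<oplus> \<one> = \<zero>} = 3" using power_eq_card[of 3 e] by simp
  have "even (s 0) \<longleftrightarrow> even (card {x \<in> carrier R. odd (chi (x [^] (3 :: nat) \<oplus> \<one>))})"
    using fin by (simp add: s_def S_def even_sum_iff)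
  also have "{x \<in> carrier R. odd (chi (x [^] (3 :: nat) \<oplus> \<one>))} = 
      carrier R - {x \<in> carrier R. x [^] (3 :: nat) \<oplus> \<one> = \<zero>}" by (auto simp: par)
  also have "card \<dots> = 6 * e + 1 - 3" using fin card c3 by (subst card_Diff_subset) auto
  finally show ?thesis using e by (cases e) auto
qed

text \<open>The term depends on x^3 only, so units contribute in triples i, i + 2e, i + 4e of
  exponents; x = 0 contributes chi(1) = 1.\<close>

lemma s0_mod_3: "s 0 mod 3 = 1"
proof -
  let ?f = "\<lambda>i :: nat. chi ((g [^] i) [^] (3 :: nat) \<oplus> \<one>)"
  have per: "?f (i + 2 * e) = ?f i" for i
  proof -
    have "g [^] ((i + 2 * e) * 3) = g [^] (i * 3)"
      unfolding g_pow_eq_iff distrib_right by simp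
    thus ?thesis using g by (simp add: nat_pow_pow)
  qed
  have "(\<Sum>i<n + 2 * e. ?f i) = (\<Sum>i<2 * e. ?f i) + (\<Sum>i<n. ?f i)" for n
    by (induction n) (simp_all add: per)
  from this[of "4 * e"] this[of "2 * e"] have "(\<Sum>i<6 * e. ?f i) = 3 * (\<Sum>i<2 * e. ?f i)" by simp
  hence "s 0 = 1 + 3 * (\<Sum>i<2 * e. ?f i)"
    unfolding s_def S_def sum_carrier by (simp add: nat_pow_zero)
  thus ?thesis by presburger
qed

text \<open>An equation y^2 = a has 1 + chi(a) solutions; the 2 in the formula is the point at
  infinity together with the 1 in q = 6e + 1.\<close>

lemma card_E_points: "int (card (E_points R)) = 6 * int e + 2 + s 0"
proof -
  have sq: "int (card {y \<in> carrier R. y [^] (2 :: nat) = x}) = 1 + chi x" if x: "x \<in> carrier R" for x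
  proof (cases "x = \<zero>")
    case True
    have "y [^] (2 :: nat) = \<zero> \<longleftrightarrow> y = \<zero>" if "y \<in> carrier R" for y
      using pow_nz[OF that, of 2] by (auto simp: nat_pow_zero)
    hence "{y \<in> carrier R. y [^] (2 :: nat) = x} = {\<zero>}" unfolding True by blast
    thus ?thesis using True by simp
  next
    case False
    then obtain i :: nat where i: "x = g [^] i" using gen[OF x] by blast
    show ?thesis
    proof (cases "even i")
      case True
      then obtain m where m: "i = 2 * m" by (rule evenE)
      have "2 dvd 6 * e" by simp
      hence "card {y \<in> carrier R. y [^] (2 :: nat) = x} = 2" unfolding i m by (rule power_eq_card) simp
      moreover have "chi x = 1" unfolding i chi_g_pow m by simp
      ultimately show ?thesis by simp
    next
      case odd: False
      have chi: "chi x = -1" unfolding i chi_g_pow using odd by simp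
      have "{y \<in> carrier R. y [^] (2 :: nat) = x} = {}"
      proof (rule equals0I)
        fix y assume "y \<in> {y \<in> carrier R. y [^] (2 :: nat) = x}"
        hence y: "y \<in> carrier R" "x = y \<otimes> y" by (auto simp: numeral_2_eq_2)
        have "y \<noteq> \<zero>"
        proof
          assume "y = \<zero>"
          hence "x = \<zero>" unfolding y(2) by simp
          with False show False by (rule notE)
        qed
        hence "chi x = 1" unfolding y(2) chi_mult[OF y(1) y(1)] by (rule chi_square[OF y(1)])
        thus False unfolding chi by simp
      qed
      hence "card {y \<in> carrier R. y [^] (2 :: nat) = x} = 0" by (simp only: card.empty)
      thus ?thesis unfolding chi by simp
    qed
  qed
  let ?P = "{(x, y). x \<in> carrier R \<and> y \<in> carrier R \<and> y [^] (2 :: nat) = x [^] (3 :: nat) \<oplus> \<one>}"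
  have P: "?P = (SIGMA x:carrier R. {y \<in> carrier R. y [^] (2 :: nat) = x [^] (3 :: nat) \<oplus> \<one>})" by auto
  have finP: "finite ?P" unfolding P by (rule finite_SigmaI) (use fin in simp_all)
  have "E_points R = insert None (Some ` ?P)" by (simp only: E_points_def)
  hence "card (E_points R) = Suc (card (Some ` ?P))" using finP by (simp only:) (subst card_insert_disjoint, auto)
  also have "card (Some ` ?P) = card ?P" by (rule card_image) simp
  finally have "int (card (E_points R)) = 1 + int (card ?P)" by simp
  also have "int (card ?P) = (\<Sum>x\<in>carrier R. int (card {y \<in> carrier R. y [^] (2 :: nat) = x [^] (3 :: nat) \<oplus> \<one>}))"
    unfolding P using fin by (subst card_SigmaI) simp_all
  also have "\<dots> = (\<Sum>x\<in>carrier R. 1 + chi (x [^] (3 :: nat) \<oplus> \<one>))"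
    by (rule sum.cong[OF refl]) (simp add: sq)
  also have "\<dots> = 6 * int e + 1 + s 0"
    using card by (simp add: sum.distrib s_def S_def)
  finally show ?thesis by simp
qed

text \<open>With s 0 = -2u the linear relation gives s 2 = s 1 + 2u. Completing the square in the
  quadratic one yields (s 1 + u)^2 = 3 (q - u^2), where q = 6e + 1, so s 1 + u is divisible by 3 and
  the quotient is v.\<close>

lemma points_representation:
  "\<exists>u v. u\<^sup>2 + 3 * v\<^sup>2 = 6 * int e + 1 \<and> u mod 3 = 1 \<and> s 0 = - 2 * u"
proof -
  obtain w where w: "s 0 = 2 * w" using s0_even by (rule evenE)
  define u where "u = - w"
  have u3: "u mod 3 = 1" using s0_mod_3 unfolding u_def w by presburger
  have "s 2 = s 1 + 2 * u" using s_linear by (simp add: w u_def)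
  moreover have "s 0 = - 2 * u" by (simp add: w u_def)
  ultimately have "(- 2 * u)\<^sup>2 + (s 1)\<^sup>2 + (s 1 + 2 * u)\<^sup>2 = 6 * (6 * int e + 1)"
    using s_quadratic by simp
  hence "2 * (s 1 + u)\<^sup>2 = 2 * (3 * (6 * int e + 1 - u\<^sup>2))"
    by (simp add: power2_eq_square algebra_simps)
  hence sq: "(s 1 + u)\<^sup>2 = 3 * (6 * int e + 1 - u\<^sup>2)" by simp
  moreover from this have "3 dvd (s 1 + u)\<^sup>2" by simp
  hence "3 dvd s 1 + u" by (simp add: prime_dvd_power_iff)
  then obtain v where "s 1 + u = 3 * v" by (rule dvdE)
  ultimately have "u\<^sup>2 + 3 * v\<^sup>2 = 6 * int e + 1" by (simp add: power2_eq_square)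
  thus ?thesis using u3 w by (intro exI[of _ u] exI[of _ v]) (simp add: u_def)
qed

end

section \<open>The character sum modulo the characteristic\<close>

context cubic_field
begin

definition emb :: "int \<Rightarrow> 'a" where "emb z = [z] \<cdot> \<one>"

lemma emb_closed [simp]: "emb z \<in> carrier R"
  by (simp add: emb_def)

lemma emb_add: "emb (a + b) = emb a \<oplus> emb b"
  by (simp add: emb_def add.int_pow_mult)

lemma emb_of_nat: "emb (int n) = [n] \<cdot> \<one>"
  by (simp add: emb_def add_pow_int_ge)

lemma emb_0 [simp]: "emb 0 = \<zero>" and emb_1 [simp]: "emb 1 = \<one>"
  using emb_of_nat[of 0] emb_of_nat[of 1] by simp_all

lemma emb_neg: "emb (- a) = \<ominus> emb a"
  using emb_add[of "- a" a] minus_equality[of "emb (- a)" "emb a"] by simp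

lemma emb_dvd: "emb a = \<zero> \<Longrightarrow> a dvd b \<Longrightarrow> emb b = \<zero>"
proof -
  assume a: "emb a = \<zero>" and "a dvd b"
  then obtain c where c: "b = a * c" by (elim dvdE)
  have "emb b = [c] \<cdot> ([a] \<cdot> \<one>)" unfolding c emb_def by (rule add.int_pow_pow[symmetric]) simp
  also have "\<dots> = \<zero>" using a by (simp add: emb_def)
  finally show ?thesis .
qed

lemma emb_card: "emb (6 * int e + 1) = \<zero>"
proof -
  have "\<one> [^]\<^bsub>add_monoid R\<^esub> order (add_monoid R) = \<one>\<^bsub>add_monoid R\<^esub>"
    by (rule group.pow_order_eq_1[OF add.group_axioms]) simp
  moreover have "order (add_monoid R) = 6 * e + 1" using card by (simp add: order_def)
  ultimately have "[(6 * e + 1)] \<cdot> \<one> = \<zero>" by (simp add: add_pow_def)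
  hence "emb (int (6 * e + 1)) = \<zero>" unfolding emb_of_nat .
  thus ?thesis by (simp only: of_nat_add of_nat_mult of_nat_numeral of_nat_1)
qed

lemma emb_sum: "finite A \<Longrightarrow> emb (\<Sum>x\<in>A. f x) = (\<Oplus>x\<in>A. emb (f x))"
  by (induction A rule: finite_induct) (simp_all add: emb_add)

text \<open>Euler's criterion, read off the exponents from g^(3e) = -1.\<close>

lemma emb_chi: "x \<in> carrier R \<Longrightarrow> emb (chi x) = x [^] (3 * e)"
proof (cases "x = \<zero>")
  case True
  thus ?thesis using e by (simp add: nat_pow_zero)
next
  case False
  assume "x \<in> carrier R"
  then obtain i :: nat where i: "x = g [^] i" using gen False by blast
  have "x [^] (3 * e) = (\<ominus> \<one>) [^] i"
    unfolding i minus_one_pow[symmetric] using g by (simp add: nat_pow_pow mult.commute)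
  also have "\<dots> = emb ((-1) ^ i)"
  proof (induction i)
    case (Suc i)
    have "(\<ominus> \<one>) [^] Suc i = \<ominus> ((\<ominus> \<one>) [^] i)" by (simp add: r_minus)
    also have "\<dots> = emb (- ((-1) ^ i))" unfolding emb_neg Suc ..
    finally show ?case by simp
  qed simp
  finally show ?thesis unfolding i by simp
qed

definition power_sum :: "nat \<Rightarrow> 'a" where "power_sum m = (\<Oplus>x\<in>carrier R. x [^] m)"

lemma power_sum_closed [simp]: "power_sum m \<in> carrier R"
  by (simp add: power_sum_def Pi_def)

text \<open>Since 0^0 = 1, this is the order of the field, which is 0 in the field.\<close>

lemma power_sum_0: "power_sum 0 = \<zero>"
proof -
  have "power_sum 0 = (\<Oplus>x\<in>carrier R. emb 1)" by (simp add: power_sum_def)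
  also have "\<dots> = emb (\<Sum>x\<in>carrier R. 1)" by (rule emb_sum[OF fin, symmetric])
  also have "\<dots> = \<zero>" using card emb_card by (simp add: add.commute)
  finally show ?thesis .
qed

lemma power_sum_full: "power_sum (6 * e) = \<ominus> \<one>"
proof -
  have "power_sum (6 * e) = (\<Oplus>x\<in>carrier R. emb (chi x * chi x))"
    unfolding power_sum_def
  proof (rule finsum_cong')
    fix x assume x: "x \<in> carrier R"
    show "x [^] (6 * e) = emb (chi x * chi x)"
    proof (cases "x = \<zero>")
      case True
      thus ?thesis using e by (simp add: nat_pow_zero)
    next
      case False
      thus ?thesis using chi_square[OF x False] unit_pow_order[OF x False] by simp
    qed
  qed auto
  also have "\<dots> = emb (6 * int e)" using emb_sum[OF fin, of "\<lambda>x. chi x * chi x"] sum_chi_square by simp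
  finally have "power_sum (6 * e) \<oplus> \<one> = \<zero>" using emb_add[of "6 * int e" 1] emb_card by simp
  thus ?thesis by (intro minus_equality[symmetric]) simp_all
qed

lemma finsum_scale:
  assumes u: "u \<in> carrier R" "u \<noteq> \<zero>" and f: "\<And>x. x \<in> carrier R \<Longrightarrow> f x \<in> carrier R"
  shows "(\<Oplus>x\<in>carrier R. f (u \<otimes> x)) = (\<Oplus>x\<in>carrier R. f x)"
proof -
  have U: "u \<in> Units R" using u by (simp add: field_Units)
  have im: "(\<lambda>x. u \<otimes> x) ` carrier R = carrier R"
  proof (rule equalityI; rule subsetI)
    fix y assume "y \<in> carrier R"
    moreover have "u \<otimes> (inv u \<otimes> y) = (u \<otimes> inv u) \<otimes> y"
      by (rule m_assoc[symmetric]) (use U u \<open>y \<in> carrier R\<close> in simp_all)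
    ultimately have "y = u \<otimes> (inv u \<otimes> y)" "inv u \<otimes> y \<in> carrier R" using U by simp_all
    thus "y \<in> (\<lambda>x. u \<otimes> x) ` carrier R" by (rule image_eqI)
  qed (use u in auto)
  have inj: "inj_on (\<lambda>x. u \<otimes> x) (carrier R)" using u by (auto simp: inj_on_def m_lcancel)
  have "(\<Oplus>x\<in>carrier R. f x) = (\<Oplus>x\<in>(\<lambda>x. u \<otimes> x) ` carrier R. f x)" by (simp only: im)
  also have "\<dots> = (\<Oplus>x\<in>carrier R. f (u \<otimes> x))"
    by (rule finsum_reindex) (use f im inj u in auto)
  finally show ?thesis ..
qed

text \<open>Scaling the summation variable by \<open>g\<close> multiplies the sum by g^m, which
  differs from 1.\<close>

lemma power_sum_vanish:
  assumes "\<not> 6 * e dvd m"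
  shows "power_sum m = \<zero>"
proof -
  have "power_sum m = (\<Oplus>x\<in>carrier R. (g \<otimes> x) [^] m)"
    unfolding power_sum_def by (rule finsum_scale[OF g g0, symmetric]) simp
  also have "\<dots> = (\<Oplus>x\<in>carrier R. g [^] m \<otimes> x [^] m)"
    by (rule finsum_cong') (use g in \<open>auto simp: nat_pow_distrib\<close>)
  also have "\<dots> = g [^] m \<otimes> power_sum m"
    unfolding power_sum_def by (rule finsum_rdistr[symmetric]) (use fin in auto)
  finally have "(g [^] m \<ominus> \<one>) \<otimes> power_sum m = \<zero>"
    by (simp add: minus_eq l_distr l_minus r_neg)
  moreover have "g [^] m \<noteq> g [^] (0 :: nat)" unfolding g_pow_eq_iff using assms by (simp add: dvd_eq_mod_eq_0)
  hence "g [^] m \<ominus> \<one> \<noteq> \<zero>" by (simp add: r_right_minus_eq)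
  ultimately show ?thesis by (simp add: integral_iff)
qed

lemma finsum_swap_atMost:
  assumes "\<And>x j. x \<in> carrier R \<Longrightarrow> F x j \<in> carrier R"
  shows "(\<Oplus>x\<in>carrier R. \<Oplus>j\<in>{..n :: nat}. F x j) = (\<Oplus>j\<in>{..n}. \<Oplus>x\<in>carrier R. F x j)"
proof (induction n)
  case 0
  have "(\<Oplus>x\<in>carrier R. \<Oplus>j\<in>{..0 :: nat}. F x j) = (\<Oplus>x\<in>carrier R. F x 0)"
    by (rule finsum_cong') (use assms in auto)
  thus ?case using assms by simp
next
  case (Suc n)
  have "(\<Oplus>x\<in>carrier R. \<Oplus>j\<in>{..Suc n}. F x j) = (\<Oplus>x\<in>carrier R. F x (Suc n) \<oplus> (\<Oplus>j\<in>{..n}. F x j))"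
    by (rule finsum_cong') (use assms in auto)
  also have "\<dots> = (\<Oplus>x\<in>carrier R. F x (Suc n)) \<oplus> (\<Oplus>x\<in>carrier R. \<Oplus>j\<in>{..n}. F x j)"
    by (rule finsum_addf) (use assms in auto)
  also have "\<dots> = (\<Oplus>j\<in>{..Suc n}. \<Oplus>x\<in>carrier R. F x j)"
    unfolding Suc using assms by (subst finsum_Suc) auto
  finally show ?case .
qed

text \<open>By Euler's criterion the sum is that of (x^3 + 1)^(3e). After binomial expansion the
  power sums vanish unless 6e divides 3j; as j is at most 3e, only j = 0 and j = 2e are left, and j
  = 0 gives the field order, which is 0.\<close>

lemma emb_s0: "emb (s 0) = \<ominus> emb (int ((3 * e) choose (2 * e)))"
proof -
  let ?b = "\<lambda>j. emb (int ((3 * e) choose j))"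
  have "emb (s 0) = (\<Oplus>x\<in>carrier R. emb (chi (x [^] (3 :: nat) \<oplus> \<one>)))"
    unfolding s_def S_def by (simp add: emb_sum[OF fin])
  also have "\<dots> = (\<Oplus>x\<in>carrier R. \<Oplus>j\<in>{..3 * e}. ?b j \<otimes> x [^] (3 * j))"
  proof (rule finsum_cong')
    fix x assume x: "x \<in> carrier R"
    have "emb (chi (x [^] (3 :: nat) \<oplus> \<one>)) = (x [^] (3 :: nat) \<oplus> \<one>) [^] (3 * e)"
      using x by (simp add: emb_chi)
    also have "\<dots> = (\<Oplus>j\<in>{..3 * e}. [((3 * e) choose j)] \<cdot> ((x [^] (3 :: nat)) [^] j \<otimes> \<one> [^] (3 * e - j)))"
      using x by (intro binomial_ring) auto
    also have "\<dots> = (\<Oplus>j\<in>{..3 * e}. ?b j \<otimes> x [^] (3 * j))"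
    proof (rule finsum_cong')
      fix j
      show "[((3 * e) choose j)] \<cdot> ((x [^] (3 :: nat)) [^] j \<otimes> \<one> [^] (3 * e - j)) = ?b j \<otimes> x [^] (3 * j)"
        using x add_pow_ldistr[of \<one> "x [^] (3 * j)" "(3 * e) choose j"]
        by (simp add: emb_of_nat nat_pow_pow)
    qed (use x in auto)
    finally show "emb (chi (x [^] (3 :: nat) \<oplus> \<one>)) = (\<Oplus>j\<in>{..3 * e}. ?b j \<otimes> x [^] (3 * j))" .
  qed (use fin in auto)
  also have "\<dots> = (\<Oplus>j\<in>{..3 * e}. \<Oplus>x\<in>carrier R. ?b j \<otimes> x [^] (3 * j))"
    by (rule finsum_swap_atMost) simp
  also have "\<dots> = (\<Oplus>j\<in>{..3 * e}. if 2 * e = j then \<ominus> ?b j else \<zero>)"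
  proof (rule finsum_cong')
    fix j assume j: "j \<in> {..3 * e}"
    have "(\<Oplus>x\<in>carrier R. ?b j \<otimes> x [^] (3 * j)) = ?b j \<otimes> power_sum (3 * j)"
      unfolding power_sum_def by (rule finsum_rdistr[symmetric]) (use fin in auto)
    also have "\<dots> = (if 2 * e = j then \<ominus> ?b j else \<zero>)"
    proof (cases "j = 0 \<or> 2 * e = j")
      case True
      thus ?thesis
      proof
        assume "j = 0"
        thus ?thesis using e by (simp add: power_sum_0)
      next
        assume "2 * e = j"
        hence "3 * j = 6 * e" by simp
        hence "power_sum (3 * j) = \<ominus> \<one>" by (simp only: power_sum_full)
        thus ?thesis using \<open>2 * e = j\<close> by (simp add: r_minus)
      qed
    next
      case False
      have "\<not> 6 * e dvd 3 * j"
      proof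
        assume "6 * e dvd 3 * j"
        then obtain t where t: "3 * j = 6 * e * t" by (rule dvdE)
        have "t \<noteq> 0" "t \<noteq> 1" using False t by auto
        hence "6 * e * 2 \<le> 3 * j" unfolding t by (intro mult_left_mono) auto
        thus False using j e by simp
      qed
      thus ?thesis using False by (simp add: power_sum_vanish)
    qed
    finally show "(\<Oplus>x\<in>carrier R. ?b j \<otimes> x [^] (3 * j)) = (if 2 * e = j then \<ominus> ?b j else \<zero>)" .
  qed auto
  also have "\<dots> = \<ominus> ?b (2 * e)"
    by (rule add.finprod_singleton) auto
  finally show ?thesis .
qed

lemma emb_char:
  assumes "6 * int e + 1 = int p ^ k"
  shows "emb (int p) = \<zero>"
proof -
  have "emb (int p) = \<zero>" if "emb (int (p ^ n)) = \<zero>" for n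
    using that
  proof (induction n)
    case (Suc n)
    have "emb (int (p ^ Suc n)) = [p] \<cdot> ([(p ^ n)] \<cdot> \<one>)"
      unfolding emb_of_nat by (simp add: add.nat_pow_pow mult.commute)
    also have "\<dots> = ([p] \<cdot> \<one>) \<otimes> ([(p ^ n)] \<cdot> \<one>)"
      using add_pow_ldistr[of \<one> "[(p ^ n)] \<cdot> \<one>" p] by simp
    finally have "emb (int p) = \<zero> \<or> emb (int (p ^ n)) = \<zero>"
      using Suc.prems by (simp add: integral_iff emb_of_nat[symmetric])
    thus ?case using Suc.IH by blast
  qed simp
  moreover have "emb (int (p ^ k)) = \<zero>" using emb_card assms by simp
  ultimately show ?thesis by blast
qed

text \<open>If p divided \<open>s 0\<close>, the binomial coefficient would be 0 in the field, just
  as p is; by Bezout 1 would be 0 as well.\<close>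

lemma not_dvd_s0:
  assumes p: "Factorial_Ring.prime p" and q: "6 * int e + 1 = int p ^ k"
    and b: "\<not> p dvd ((3 * e) choose (2 * e))"
  shows "\<not> int p dvd s 0"
proof
  assume "int p dvd s 0"
  hence "emb (s 0) = \<zero>" using emb_dvd emb_char[OF q] by blast
  hence z: "emb (int ((3 * e) choose (2 * e))) = \<zero>" unfolding emb_s0
    by (metis emb_closed minus_minus minus_zero)
  have "coprime (int p) (int ((3 * e) choose (2 * e)))"
    using p b by (simp add: prime_imp_coprime)
  then obtain u v where "u * int p + v * int ((3 * e) choose (2 * e)) = 1"
    by (metis bezout_int coprime_imp_gcd_eq_1)
  hence "emb (u * int p) \<oplus> emb (v * int ((3 * e) choose (2 * e))) = \<one>" by (simp flip: emb_add)
  moreover have "emb (u * int p) = \<zero>" by (rule emb_dvd[OF emb_char[OF q]]) simp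
  moreover have "emb (v * int ((3 * e) choose (2 * e))) = \<zero>" by (rule emb_dvd[OF z]) simp
  ultimately show False by simp
qed

end

text \<open>One step of Legendre's formula: the multiples of p up to p a + b are p times 1, ...,
  a.\<close>

lemma multiplicity_fact:
  fixes p :: nat
  assumes p: "Factorial_Ring.prime p" and "b < p"
  shows "multiplicity p (fact (p * a + b) :: nat) = a + multiplicity p (fact a :: nat)"
proof -
  have step: "multiplicity p (fact (p * a + b) :: nat) = multiplicity p (fact (p * a) :: nat)" if "b < p" for a b
    using that
  proof (induction b)
    case (Suc b)
    have "\<not> p dvd p * a + Suc b" using Suc.prems by (simp add: dvd_add_right_iff nat_dvd_not_less del: add_Suc_right)
    hence "multiplicity p (p * a + Suc b) = 0" by (rule not_dvd_imp_multiplicity_0)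
    moreover have "(fact (p * a + Suc b) :: nat) = (p * a + Suc b) * fact (p * a + b)" by simp
    moreover have "multiplicity p ((p * a + Suc b) * fact (p * a + b)) =
        multiplicity p (p * a + Suc b) + multiplicity p (fact (p * a + b))"
      by (rule prime_elem_multiplicity_mult_distrib) (use p in auto)
    ultimately show ?case using Suc by simp
  qed simp
  have "multiplicity p (fact (p * a) :: nat) = a + multiplicity p (fact a :: nat)"
  proof (induction a)
    case (Suc a)
    have p1: "p > 1" using p prime_gt_1_nat by blast
    hence "p * Suc a = Suc (p * a + (p - 1))" by simp
    hence "(fact (p * Suc a) :: nat) = (p * Suc a) * fact (p * a + (p - 1))" by (simp only: fact_Suc of_nat_id)
    also have "multiplicity p \<dots> = multiplicity p (p * Suc a) + multiplicity p (fact (p * a + (p - 1)) :: nat)"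
      using p1 by (intro prime_elem_multiplicity_mult_distrib) (use p in auto)
    also have "multiplicity p (p * Suc a) = 1 + multiplicity p (Suc a)"
      using p1 p by (subst prime_elem_multiplicity_mult_distrib) auto
    also have "multiplicity p (fact (p * a + (p - 1)) :: nat) = a + multiplicity p (fact a :: nat)"
      using step[of "p - 1" a] p1 Suc by simp
    also have "1 + multiplicity p (Suc a) + (a + multiplicity p (fact a :: nat)) =
        Suc a + multiplicity p (Suc a * fact a)"
      using p by (subst prime_elem_multiplicity_mult_distrib) auto
    finally show ?case by simp
  qed simp
  thus ?thesis using step assms by simp
qed

text \<open>In base \<open>p\<close> the digits of \<open>3 * e\<close>, \<open>2 * e\<close> and \<open>e\<close> are constant, so adding the last two
  produces no carry.\<close>

lemma not_dvd_binomial: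
  fixes p :: nat
  assumes p: "Factorial_Ring.prime p" and r: "p = 6 * r + 1" and e: "6 * e + 1 = p ^ k"
  shows "\<not> p dvd ((3 * e) choose (2 * e))"
proof -
  have "multiplicity p (fact (3 * e) :: nat) = multiplicity p (fact (2 * e) :: nat) + multiplicity p (fact e :: nat)"
    using e
  proof (induction k arbitrary: e)
    case (Suc k)
    have "p ^ k mod 6 = 1"
    proof -
      have "p ^ k mod 6 = (p mod 6) ^ k mod 6" by (rule power_mod[symmetric])
      also have "p mod 6 = 1" using r by simp
      finally show ?thesis by simp
    qed
    hence "6 * (p ^ k div 6) + 1 = p ^ k" using mult_div_mod_eq[of 6 "p ^ k"] by simp
    then obtain f where f: "6 * f + 1 = p ^ k" by blast
    have "6 * e + 1 = p * (6 * f + 1)" unfolding f using Suc.prems by simp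
    hence ef: "e = p * f + r" using r by simp
    have m: "3 * e = p * (3 * f) + 3 * r" "2 * e = p * (2 * f) + 2 * r" "e = p * f + r" unfolding ef by simp_all
    have "multiplicity p (fact (3 * e) :: nat) = 3 * f + multiplicity p (fact (3 * f) :: nat)"
      unfolding m(1) by (rule multiplicity_fact[OF p]) (use r in simp)
    moreover have "multiplicity p (fact (2 * e) :: nat) = 2 * f + multiplicity p (fact (2 * f) :: nat)"
      unfolding m(2) by (rule multiplicity_fact[OF p]) (use r in simp)
    moreover have "multiplicity p (fact e :: nat) = f + multiplicity p (fact f :: nat)"
      unfolding m(3) by (rule multiplicity_fact[OF p]) (use r in simp)
    ultimately show ?case using Suc.IH[OF f] by linarith
  qed simp
  moreover have "(fact (2 * e) * fact e) * ((3 * e) choose (2 * e)) = (fact (3 * e) :: nat)"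
    using binomial_fact_lemma[of "2 * e" "3 * e"] by simp
  hence "multiplicity p (fact (3 * e) :: nat) = multiplicity p (fact (2 * e) :: nat) + multiplicity p (fact e :: nat)
       + multiplicity p ((3 * e) choose (2 * e))"
    using p by (metis (no_types) prime_elem_multiplicity_mult_distrib prime_imp_prime_elem fact_nonzero mult_eq_0_iff)
  ultimately have "multiplicity p ((3 * e) choose (2 * e)) = 0" by simp
  moreover have "(3 * e) choose (2 * e) > 0" by simp
  ultimately show ?thesis using p by (metis multiplicity_eq_zero_iff not_prime_unit less_not_refl)
qed

section \<open>Representations of prime powers by the norm form\<close>

lemma prime_dvd_norm:
  fixes p u v :: int
  assumes p: "Factorial_Ring.prime p" "p > 3" and "p dvd u\<^sup>2 + 3 * v\<^sup>2" and "p dvd u \<or> p dvd v"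
  shows "p dvd u" "p dvd v"
proof -
  have "\<not> p dvd 3" using p zdvd_not_zless[of 3 p] by simp
  have "p dvd u\<^sup>2 \<longleftrightarrow> p dvd 3 * v\<^sup>2"
    using assms(3) dvd_add_right_iff[of p "u\<^sup>2" "3 * v\<^sup>2"] dvd_add_left_iff[of p "3 * v\<^sup>2" "u\<^sup>2"] by blast
  hence "p dvd u \<longleftrightarrow> p dvd v" using p \<open>\<not> p dvd 3\<close> by (simp add: prime_dvd_mult_iff prime_dvd_power_iff)
  thus "p dvd u" "p dvd v" using assms(4) by auto
qed

text \<open>Brahmagupta's identity writes q^2 as a square plus 3 (u t - s v)^2. A nonzero multiple
  of q is too large for u t - s v, so the two vectors are proportional, of equal norm, and the class
  modulo 3 excludes opposite signs.\<close>

lemma representation_unique_aux: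
  fixes u v s t q :: int
  assumes q: "q > 0" and uv: "u\<^sup>2 + 3 * v\<^sup>2 = q" and st: "s\<^sup>2 + 3 * t\<^sup>2 = q"
    and m: "u mod 3 = 1" "s mod 3 = 1" and d: "q dvd u * t - s * v"
  shows "s = u \<and> t = v"
proof -
  have "(u * s + 3 * v * t)\<^sup>2 + 3 * (u * t - s * v)\<^sup>2 = (u\<^sup>2 + 3 * v\<^sup>2) * (s\<^sup>2 + 3 * t\<^sup>2)"
    by (simp add: power2_eq_square algebra_simps)
  hence br: "(u * s + 3 * v * t)\<^sup>2 + 3 * (u * t - s * v)\<^sup>2 = q\<^sup>2" unfolding uv st by (simp add: power2_eq_square)
  have z: "u * t - s * v = 0"
  proof (rule ccontr)
    assume nz: "u * t - s * v \<noteq> 0"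
    hence "q \<le> \<bar>u * t - s * v\<bar>" using d dvd_imp_le_int[of "u * t - s * v" q] q by simp
    hence "q\<^sup>2 \<le> (u * t - s * v)\<^sup>2" using q by (simp add: abs_le_square_iff[symmetric])
    moreover have "0 < (u * t - s * v)\<^sup>2" using nz by simp
    moreover have "0 \<le> (u * s + 3 * v * t)\<^sup>2" by simp
    ultimately show False using br by linarith
  qed
  hence "(u * s + 3 * v * t)\<^sup>2 = q\<^sup>2" using br by simp
  hence pm: "u * s + 3 * v * t = q \<or> u * s + 3 * v * t = - q" by (simp add: power2_eq_iff)
  have "u * q = s * (u * s) + 3 * t * (u * t)" unfolding st[symmetric] by (simp add: power2_eq_square algebra_simps)
  also have "u * t = s * v" using z by simp
  finally have "u * q = s * (u * s + 3 * v * t)" by (simp add: algebra_simps)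
  hence "u * q = s * q \<or> u * q = (- s) * q" using pm by auto
  hence "u = s \<or> u = - s" using mult_right_cancel[of q u s] mult_right_cancel[of q u "- s"] q by blast
  moreover have "u \<noteq> - s" using m by presburger
  ultimately have us: "u = s" by blast
  moreover have "u \<noteq> 0" using m by auto
  ultimately have "t = v" using z by simp
  thus ?thesis using us by simp
qed

text \<open>The power p^k divides (u t - s v) (u t + s v), and p cannot divide both factors, since
  it would divide 2 u t. Hence p^k divides one of them, and the second case is the first with -v for
  v.\<close>

lemma representation_unique:
  fixes u v s t p :: int
  assumes p: "Factorial_Ring.prime p" "p > 3" and k: "k > 0"
    and uv: "u\<^sup>2 + 3 * v\<^sup>2 = p ^ k" and st: "s\<^sup>2 + 3 * t\<^sup>2 = p ^ k"
    and m: "u mod 3 = 1" "s mod 3 = 1" and nd: "\<not> p dvd u" "\<not> p dvd s"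
  shows "s = u \<and> (t = v \<or> t = - v)"
proof -
  have "\<not> p dvd t" using prime_dvd_norm(1)[OF p, of s t] st k nd by (auto simp: dvd_power)
  have "(u * t - s * v) * (u * t + s * v) = u\<^sup>2 * t\<^sup>2 - s\<^sup>2 * v\<^sup>2" by (simp add: power2_eq_square algebra_simps)
  also have "\<dots> = (p ^ k - 3 * v\<^sup>2) * t\<^sup>2 - (p ^ k - 3 * t\<^sup>2) * v\<^sup>2" 
  proof -
    have "u\<^sup>2 = p ^ k - 3 * v\<^sup>2" "s\<^sup>2 = p ^ k - 3 * t\<^sup>2" using uv st by linarith+
    thus ?thesis by (simp only:)
  qed
  also have "\<dots> = p ^ k * (t\<^sup>2 - v\<^sup>2)" by (simp add: algebra_simps)
  finally have dv: "p ^ k dvd (u * t - s * v) * (u * t + s * v)" by simp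
  have "\<not> (p dvd u * t - s * v \<and> p dvd u * t + s * v)"
  proof
    assume "p dvd u * t - s * v \<and> p dvd u * t + s * v"
    hence "p dvd (u * t - s * v) + (u * t + s * v)" by (blast intro: dvd_add)
    also have "(u * t - s * v) + (u * t + s * v) = 2 * (u * t)" by simp
    finally have "p dvd 2 * (u * t)" .
    moreover have "\<not> p dvd 2" using p zdvd_not_zless[of 2 p] by simp
    ultimately show False using p nd \<open>\<not> p dvd t\<close> by (simp add: prime_dvd_mult_iff)
  qed
  then consider "\<not> p dvd u * t + s * v" | "\<not> p dvd u * t - s * v" by blast
  thus ?thesis
  proof cases
    case 1
    hence "coprime (p ^ k) (u * t + s * v)" using p by (simp add: prime_imp_coprime)
    hence "p ^ k dvd u * t - s * v" using dv by (simp add: coprime_dvd_mult_left_iff)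
    thus ?thesis using representation_unique_aux[OF _ uv st m] p by simp
  next
    case 2
    hence "coprime (p ^ k) (u * t - s * v)" using p by (simp add: prime_imp_coprime)
    hence "p ^ k dvd u * t - s * (- v)" using dv by (simp add: coprime_dvd_mult_right_iff)
    thus ?thesis using representation_unique_aux[of "p ^ k" u "- v" s t] uv st m p by simp
  qed
qed

text \<open>If p divides u it divides v, so the solution is p times a smaller one. The sign of
  \<open>d\<close> is chosen so that scaling preserves u = 1 mod 3: d is p or -p according to p
  modulo 3.\<close>

lemma cm_reps_scaled:
  fixes p :: nat and d :: int
  assumes p: "Factorial_Ring.prime p" "p > 3" and d: "\<bar>d\<bar> = int p" "d mod 3 = 1"
  shows "{(u, v) \<in> cm_reps (p ^ (k + 2)). int p dvd u} = (\<lambda>(u, v). (d * u, d * v)) ` cm_reps (p ^ k)"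
proof -
  have d2: "d\<^sup>2 = (int p)\<^sup>2" by (simp only: d(1)[symmetric] power2_abs)
  have d0: "d \<noteq> 0" using d(2) by (intro notI) simp
  have mod3: "(d * u) mod 3 = u mod 3" for u
  proof -
    have "(d * u) mod 3 = ((d mod 3) * u) mod 3" by (rule mod_mult_left_eq[symmetric])
    also have "\<dots> = u mod 3" unfolding d(2) by simp
    finally show ?thesis .
  qed
  show ?thesis
  proof (rule equalityI; rule subsetI)
    fix x assume "x \<in> {(u, v) \<in> cm_reps (p ^ (k + 2)). int p dvd u}"
    then obtain u v where x: "x = (u, v)" and e: "u\<^sup>2 + 3 * v\<^sup>2 = int p ^ (k + 2)" and m: "u mod 3 = 1" and pu: "int p dvd u"
      by (auto simp: cm_reps_def)
    have "int p dvd u\<^sup>2 + 3 * v\<^sup>2" unfolding e by simp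
    hence "int p dvd v" using prime_dvd_norm(2)[of "int p" u v] p pu by simp
    hence "\<bar>d\<bar> dvd u" "\<bar>d\<bar> dvd v" using pu unfolding d(1) by blast+
    hence "d dvd u" "d dvd v" by (simp_all only: abs_dvd_iff)
    then obtain a b where ab: "u = d * a" "v = d * b" unfolding dvd_def by blast
    have "d\<^sup>2 * (a\<^sup>2 + 3 * b\<^sup>2) = d\<^sup>2 * int p ^ k"
    proof -
      have "d\<^sup>2 * (a\<^sup>2 + 3 * b\<^sup>2) = u\<^sup>2 + 3 * v\<^sup>2" unfolding ab by (simp add: power2_eq_square algebra_simps)
      also have "\<dots> = d\<^sup>2 * int p ^ k" unfolding e d2 power_add by (rule mult.commute)
      finally show ?thesis .
    qed
    hence "a\<^sup>2 + 3 * b\<^sup>2 = int p ^ k" using d0 by simp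
    moreover have "a mod 3 = 1" using m unfolding ab mod3 .
    ultimately have "(a, b) \<in> cm_reps (p ^ k)" by (simp add: cm_reps_def)
    thus "x \<in> (\<lambda>(u, v). (d * u, d * v)) ` cm_reps (p ^ k)" unfolding x ab by (rule rev_image_eqI) simp
  next
    fix x assume "x \<in> (\<lambda>(u, v). (d * u, d * v)) ` cm_reps (p ^ k)"
    then obtain a b where x: "x = (d * a, d * b)" and e: "a\<^sup>2 + 3 * b\<^sup>2 = int p ^ k" and m: "a mod 3 = 1"
      by (auto simp: cm_reps_def)
    have "(d * a)\<^sup>2 + 3 * (d * b)\<^sup>2 = d\<^sup>2 * (a\<^sup>2 + 3 * b\<^sup>2)" by (simp add: power2_eq_square algebra_simps)
    also have "\<dots> = int p ^ (k + 2)" unfolding e d2 by (simp add: power_add power2_eq_square mult_ac)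
    finally have "(d * a)\<^sup>2 + 3 * (d * b)\<^sup>2 = int p ^ (k + 2)" .
    moreover have "int p dvd d * a" unfolding d(1)[symmetric] by simp
    ultimately show "x \<in> {(u, v) \<in> cm_reps (p ^ (k + 2)). int p dvd u}"
      using m unfolding x by (simp add: cm_reps_def mod3)
  qed
qed

lemma sum_cm_reps_scaled:
  fixes p :: nat and d :: int
  assumes p: "Factorial_Ring.prime p" "p > 3" and d: "\<bar>d\<bar> = int p" "d mod 3 = 1"
  shows "(\<Sum>(u, v)\<in>{(u, v) \<in> cm_reps (p ^ (k + 2)). int p dvd u}. u) = d * cm_sum (p ^ k)"
proof -
  have "d \<noteq> 0" using d p by auto
  hence "inj_on (\<lambda>(u, v). (d * u, d * v)) (cm_reps (p ^ k))" by (auto simp: inj_on_def)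
  thus ?thesis unfolding cm_reps_scaled[OF assms] cm_sum_def
    by (simp add: sum.reindex case_prod_unfold sum_distrib_left)
qed

lemma cm_reps_1: "cm_reps 1 = {(1, 0)}"
proof (rule equalityI; rule subsetI)
  fix x assume "x \<in> cm_reps 1"
  then obtain u v where x: "x = (u, v)" and e: "u\<^sup>2 + 3 * v\<^sup>2 = 1" and m: "u mod 3 = 1" by (auto simp: cm_reps_def)
  have "v\<^sup>2 \<ge> 0" "u\<^sup>2 \<ge> 0" by simp_all
  hence "v\<^sup>2 = 0" using e by linarith
  moreover from this have "u\<^sup>2 = 1" using e by simp
  ultimately have "v = 0" "u = 1 \<or> u = -1" by (auto simp: power2_eq_1_iff)
  thus "x \<in> {(1, 0)}" using x m by auto
qed (simp add: cm_reps_def)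

lemma cm_sum_1: "cm_sum 1 = 1"
  by (simp add: cm_sum_def cm_reps_1[simplified])

text \<open>Solutions prime to p are only (u, v) and (u, -v), distinct because v = 0 would force p
  to divide u. The others are p times the solutions for p^(k-2).\<close>

lemma cm_sum_split_prime:
  fixes p :: nat
  assumes p: "Factorial_Ring.prime p" "p mod 6 = 1" and k: "k > 0"
    and uv: "u\<^sup>2 + 3 * v\<^sup>2 = int p ^ k" "u mod 3 = 1" "\<not> int p dvd u"
  shows "cm_sum (p ^ k) = 2 * u + (if k \<ge> 2 then int p * cm_sum (p ^ (k - 2)) else 0)"
proof -
  have p3: "p > 3"
  proof -
    have "p \<noteq> 1" using p by auto
    thus ?thesis using p(2) by presburger
  qed
  hence P: "Factorial_Ring.prime (int p)" "int p > 3" using p by simp_all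
  let ?A = "{(s, t) \<in> cm_reps (p ^ k). int p dvd s}" and ?B = "{(s, t) \<in> cm_reps (p ^ k). \<not> int p dvd s}"
  have v0: "v \<noteq> 0"
  proof
    assume "v = 0"
    hence "int p dvd u\<^sup>2" using uv k by simp
    thus False using uv P by (simp add: prime_dvd_power_iff)
  qed
  have "?B = {(u, v), (u, - v)}"
  proof (rule equalityI; rule subsetI)
    fix x assume "x \<in> ?B"
    then obtain s t where x: "x = (s, t)" and st: "s\<^sup>2 + 3 * t\<^sup>2 = int p ^ k" "s mod 3 = 1" "\<not> int p dvd s"
      by (auto simp: cm_reps_def)
    have "s = u \<and> (t = v \<or> t = - v)"
      by (rule representation_unique[OF P k uv(1) st(1) uv(2) st(2) uv(3) st(3)])
    thus "x \<in> {(u, v), (u, - v)}" unfolding x by auto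
  qed (use uv in \<open>auto simp: cm_reps_def\<close>)
  hence B: "(\<Sum>(s, t)\<in>?B. s) = 2 * u" using v0 by simp
  have A: "(\<Sum>(s, t)\<in>?A. s) = (if k \<ge> 2 then int p * cm_sum (p ^ (k - 2)) else 0)"
  proof (cases "k \<ge> 2")
    case True
    then obtain j where j: "k = j + 2" using that[of "k - 2"] by simp
    have "int p mod 3 = 1" using p(2) by presburger
    thus ?thesis using sum_cm_reps_scaled[OF p(1) p3, of "int p" j] unfolding j by simp
  next
    case False
    hence k1: "k = 1" using k by simp
    \<comment> \<open>For k = 1, p would divide both entries, and hence p^2 would divide p.\<close>
    have "?A = {}"
    proof (rule equals0I)
      fix x assume "x \<in> ?A"
      then obtain s t where st: "s\<^sup>2 + 3 * t\<^sup>2 = int p" "int p dvd s" by (auto simp: cm_reps_def k1)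
      have "int p dvd t" using prime_dvd_norm(2)[OF P, of s t] st by simp
      then obtain a b where ab: "s = int p * a" "t = int p * b" using st(2) unfolding dvd_def by blast
      have "int p * (int p * (a\<^sup>2 + 3 * b\<^sup>2)) = int p * 1" using st(1) unfolding ab by (simp add: power2_eq_square algebra_simps)
      hence "int p * (a\<^sup>2 + 3 * b\<^sup>2) = 1" using P by simp
      hence "int p dvd 1" by (rule dvdI[OF sym])
      thus False using P(1) by (simp add: not_prime_unit)
    qed
    hence "(\<Sum>(s, t)\<in>?A. s) = 0" by (simp only: sum.empty)
    thus ?thesis using False by simp
  qed
  have "cm_sum (p ^ k) = (\<Sum>(s, t)\<in>?A \<union> ?B. s)" unfolding cm_sum_def by (rule sum.cong) auto
  also have "\<dots> = (\<Sum>(s, t)\<in>?A. s) + (\<Sum>(s, t)\<in>?B. s)"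
  proof (rule sum.union_disjoint)
    show "finite ?A" "finite ?B" by (rule finite_subset[OF _ finite_cm_reps[of "p ^ k"]]; blast)+
  qed blast
  finally have "cm_sum (p ^ k) = (\<Sum>(s, t)\<in>?A. s) + (\<Sum>(s, t)\<in>?B. s)" .
  thus ?thesis unfolding A B by simp
qed

text \<open>With \<open>a = u - v\<close> and \<open>b = 2 * v\<close> the form is \<open>a\<^sup>2 + a * b + b\<^sup>2\<close>, which divides \<open>a ^ 3 - b ^ 3\<close>;
  cubing is injective modulo \<open>p\<close> when \<open>p\<close> is \<open>2\<close> modulo \<open>3\<close>.\<close>

lemma inert_prime_dvd:
  fixes p :: nat and u v :: int
  assumes p: "Factorial_Ring.prime p" "p > 3" "p mod 3 = 2" and d: "int p dvd u\<^sup>2 + 3 * v\<^sup>2"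
  shows "int p dvd u"
proof (rule ccontr)
  have P: "Factorial_Ring.prime (int p)" "int p > 3" using p by simp_all
  assume "\<not> int p dvd u"
  hence nv: "\<not> int p dvd v" using prime_dvd_norm(1)[OF P d] by blast
  define a b where "a = u - v" and "b = 2 * v"
  have ab: "a\<^sup>2 + a * b + b\<^sup>2 = u\<^sup>2 + 3 * v\<^sup>2" by (simp add: a_def b_def power2_eq_square algebra_simps)
  have n2: "\<not> int p dvd 2" using P zdvd_not_zless[of 2 "int p"] by simp
  have n3: "\<not> int p dvd 3" using P zdvd_not_zless[of 3 "int p"] by simp
  have nb: "\<not> int p dvd b" using nv n2 P by (simp add: b_def prime_dvd_mult_iff)
  have na: "\<not> int p dvd a"
  proof
    assume "int p dvd a"
    hence "int p dvd a\<^sup>2 + a * b" by (simp add: power2_eq_square)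
    hence "int p dvd b\<^sup>2" using d unfolding ab[symmetric] by (simp add: dvd_add_right_iff)
    thus False using nb P by (simp add: prime_dvd_power_iff)
  qed
  have "p = 3 * (p div 3) + 2" using mult_div_mod_eq[of 3 p] p(3) by simp
  then obtain j where j: "p = 3 * j + 2" by blast
  have fermat: "[x * (x ^ 3) ^ j = 1] (mod int p)" if "\<not> int p dvd x" for x
  proof -
    define y where "y = nat (x mod int p)"
    have y: "int y = x mod int p" using p by (simp add: y_def)
    have "\<not> p dvd y" 
    proof
      assume "p dvd y"
      hence "int p dvd x mod int p" unfolding y[symmetric] by simp
      thus False using that by (simp add: dvd_mod_iff)
    qed
    hence "[y ^ (p - 1) = 1] (mod p)" using fermat_theorem p by blast
    hence "[int (y ^ (p - 1)) = int 1] (mod int p)" using cong_int_iff by blast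
    hence "[(x mod int p) ^ (p - 1) = 1] (mod int p)" by (simp add: y)
    hence "[x ^ (p - 1) = 1] (mod int p)" by (simp add: cong_def power_mod)
    moreover have "p - 1 = Suc (3 * j)" using j by simp
    ultimately show ?thesis by (simp only: power_Suc power_mult)
  qed
  have "a ^ 3 - b ^ 3 = (a - b) * (a\<^sup>2 + a * b + b\<^sup>2)" by (simp add: power2_eq_square power3_eq_cube algebra_simps)
  hence "int p dvd a ^ 3 - b ^ 3" using d ab by simp
  hence "[a ^ 3 = b ^ 3] (mod int p)" by (simp add: cong_iff_dvd_diff)
  hence c: "[(a ^ 3) ^ j = (b ^ 3) ^ j] (mod int p)" by (rule cong_pow)
  have "[a * 1 = a * (b * (b ^ 3) ^ j)] (mod int p)" 
    by (rule cong_mult[OF cong_refl cong_sym[OF fermat[OF nb]]])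
  also have "a * (b * (b ^ 3) ^ j) = b * (a * (b ^ 3) ^ j)" by simp
  also have "[b * (a * (b ^ 3) ^ j) = b * (a * (a ^ 3) ^ j)] (mod int p)"
    by (rule cong_mult[OF cong_refl cong_mult[OF cong_refl cong_sym[OF c]]])
  also have "[b * (a * (a ^ 3) ^ j) = b * 1] (mod int p)" 
    by (rule cong_mult[OF cong_refl fermat[OF na]])
  finally have "int p dvd a - b" by (simp add: cong_iff_dvd_diff)
  hence "int p dvd (u\<^sup>2 + 3 * v\<^sup>2) - (a - b) * (a + 2 * b)" using d by (intro dvd_diff) simp_all
  also have "(u\<^sup>2 + 3 * v\<^sup>2) - (a - b) * (a + 2 * b) = 3 * b\<^sup>2"
    unfolding ab[symmetric] by (simp add: power2_eq_square algebra_simps)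
  finally show False using nb n3 P by (simp add: prime_dvd_mult_iff prime_dvd_power_iff)
qed

text \<open>Descent: p divides every solution for p^(2m+2), which is therefore -p times one for
  p^(2m). The minus sign keeps u = 1 mod 3, as -p = 1 mod 3.\<close>

lemma cm_reps_inert:
  fixes p :: nat
  assumes p: "Factorial_Ring.prime p" "p > 3" "p mod 3 = 2"
  shows "cm_reps (p ^ (2 * m)) = {((- int p) ^ m, 0)}"
proof (induction m)
  case 0
  show ?case using cm_reps_1 by simp
next
  case (Suc m)
  have d: "\<bar>- int p\<bar> = int p" "(- int p) mod 3 = 1" 
  proof -
    have "int p mod 3 = 2" using p(3) by (metis of_nat_mod of_nat_numeral)
    thus "(- int p) mod 3 = 1" by presburger
  qed simp
  have "cm_reps (p ^ (2 * m + 2)) = {(u, v) \<in> cm_reps (p ^ (2 * m + 2)). int p dvd u}"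
  proof -
    have "int p dvd u" if "(u, v) \<in> cm_reps (p ^ (2 * m + 2))" for u v
    proof (rule inert_prime_dvd[OF p])
      have "u\<^sup>2 + 3 * v\<^sup>2 = int p ^ (2 * m + 2)" using that by (simp add: cm_reps_def)
      thus "int p dvd u\<^sup>2 + 3 * v\<^sup>2" by simp
    qed
    thus ?thesis by blast
  qed
  also have "\<dots> = (\<lambda>(u, v). (- int p * u, - int p * v)) ` cm_reps (p ^ (2 * m))"
    by (rule cm_reps_scaled[OF p(1,2) d])
  finally show ?case unfolding Suc by simp
qed

section \<open>The recurrence for r13 and the point counts\<close>

lemma divisor_sum_prime_power:
  fixes p :: nat
  assumes p: "Factorial_Ring.prime p"
  shows "(\<Sum>m | m dvd p ^ k. m) = (\<Sum>i\<le>k. p ^ i)"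
proof -
  have "{m. m dvd p ^ k} = (\<lambda>i. p ^ i) ` {..k}" using divides_primepow_nat[OF p] by auto
  moreover have "inj_on (\<lambda>i. p ^ i) {..k}" using prime_gt_1_nat[OF p] by (auto simp: inj_on_def)
  ultimately show ?thesis by (simp add: sum.reindex)
qed

text \<open>The divisor sums telescope: sigma(p^k) - p sigma(p^(k-2)) = p^k + 1. Together with the
  recursion for \<open>cm_sum\<close> this leaves p^k + 1 - 2u.\<close>

lemma r13_recurrence_aux:
  fixes p :: nat
  assumes p: "Factorial_Ring.prime p" and q: "(p ^ k) mod 6 = 1" and k: "k > 0"
    and c: "cm_sum (p ^ k) = 2 * u + (if k \<ge> 2 then int p * cm_sum (p ^ (k - 2)) else 0)"
    and q': "k \<ge> 2 \<Longrightarrow> (p ^ (k - 2)) mod 6 = 1"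
  shows "3 * int (r13 (p ^ k)) = int p ^ k + 1 - 2 * u + (if k \<ge> 2 then 3 * int p * int (r13 (p ^ (k - 2))) else 0)"
proof -
  have f: "3 * int (r13 (p ^ j)) = (\<Sum>i\<le>j. int p ^ i) - cm_sum (p ^ j)" if "(p ^ j) mod 6 = 1" for j
  proof -
    have "odd (p ^ j)" "(p ^ j) mod 3 = 1" using that by presburger+
    from r13_formula[OF this] show ?thesis unfolding divisor_sum_prime_power[OF p] by simp
  qed
  show ?thesis
  proof (cases "k \<ge> 2")
    case True
    then obtain j where j: "k = j + 2" using that[of "k - 2"] by simp
    have "(\<Sum>i\<le>k. int p ^ i) = (\<Sum>i\<le>Suc j. int p ^ i) + int p ^ k" unfolding j by simp
    also have "(\<Sum>i\<le>Suc j. int p ^ i) = 1 + int p * (\<Sum>i\<le>j. int p ^ i)"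
      unfolding sum.atMost_Suc_shift by (simp add: sum_distrib_left)
    finally have "(\<Sum>i\<le>k. int p ^ i) = int p ^ k + 1 + int p * (\<Sum>i\<le>j. int p ^ i)" by simp
    moreover have "(p ^ j) mod 6 = 1" using q'[OF True] by (simp add: j)
    note f' = f[OF this]
    have "int p * (3 * int (r13 (p ^ j))) = int p * (\<Sum>i\<le>j. int p ^ i) - int p * cm_sum (p ^ j)"
      unfolding f' by (rule right_diff_distrib)
    moreover have "cm_sum (p ^ k) = 2 * u + int p * cm_sum (p ^ j)" using c by (simp add: j)
    ultimately have "3 * int (r13 (p ^ k)) = int p ^ k + 1 - 2 * u + int p * (3 * int (r13 (p ^ j)))"
      using f[OF q] by linarith
    thus ?thesis by (simp add: j)
  next
    case False
    hence "k = 1" using k by simp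
    thus ?thesis using f[OF q] c by simp
  qed
qed

text \<open>The locale is instantiated with a generator of the multiplicative group of the field of
  order p^k. The last clause concerns p = 1 mod 6 only; for p = 5 mod 6 and even k, u is a power of
  -p.\<close>

lemma N_representation:
  assumes p: "Factorial_Ring.prime p" and k: "k > 0" and q: "p ^ k mod 6 = 1"
  obtains u v where "u\<^sup>2 + 3 * v\<^sup>2 = int p ^ k" "u mod 3 = 1" "int (N p k) = int p ^ k + 1 - 2 * u"
    "p mod 6 = 1 \<Longrightarrow> \<not> int p dvd u"
proof -
  define F where "F = finite_field (p ^ k)"
  define e where "e = p ^ k div 6"
  have e: "p ^ k = 6 * e + 1" using mult_div_mod_eq[of 6 "p ^ k"] q by (simp add: e_def)
  have "p ^ k > 1" using prime_gt_1_nat[OF p] k by (rule one_less_power)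
  hence e0: "e > 0" using e by simp
  have F: "field F" and cF: "card (carrier F) = 6 * e + 1"
    using finite_field[OF p k] e by (simp_all add: F_def order_def)
  interpret F: field F by (rule F)
  have fin: "finite (carrier F)" using cF by (intro card_ge_0_finite) simp
  obtain g where g: "g \<in> carrier (Multiplicative_Group.mult_of F)"
    "carrier (Multiplicative_Group.mult_of F) = {g [^]\<^bsub>F\<^esub> i | i::nat. i \<in> UNIV}"
    using F.finite_field_mult_group_has_gen[OF fin] by blast
  interpret C: cubic_field F g e
  proof unfold_locales
    show "finite (carrier F)" by (rule fin)
    show "card (carrier F) = 6 * e + 1" by (rule cF)
    show "e > 0" by (rule e0)
    show "g \<in> carrier F" "g \<noteq> \<zero>\<^bsub>F\<^esub>" using g(1) by (simp_all add: Multiplicative_Group.carrier_mult_of)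
    show "\<exists>i :: nat. x = g [^]\<^bsub>F\<^esub> i" if "x \<in> carrier F" "x \<noteq> \<zero>\<^bsub>F\<^esub>" for x
    proof -
      have "x \<in> carrier (Multiplicative_Group.mult_of F)" using that by (simp add: Multiplicative_Group.carrier_mult_of)
      thus ?thesis unfolding g(2) by blast
    qed
  qed
  have qe: "6 * int e + 1 = int p ^ k" using arg_cong[OF e, of int] by simp
  obtain u v where uv: "u\<^sup>2 + 3 * v\<^sup>2 = 6 * int e + 1" "u mod 3 = 1" "C.s 0 = - 2 * u"
    using C.points_representation by blast
  have "int (N p k) = int p ^ k + 1 - 2 * u"
    unfolding N_def F_def[symmetric] C.card_E_points uv(3) qe[symmetric] by simp
  moreover have "\<not> int p dvd u" if p1: "p mod 6 = 1"
  proof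
    assume "int p dvd u"
    hence "int p dvd C.s 0" unfolding uv(3) by simp
    moreover have "p = 6 * (p div 6) + 1" using mult_div_mod_eq[of 6 p] p1 by simp
    hence "\<not> p dvd ((3 * e) choose (2 * e))" by (rule not_dvd_binomial[OF p _ e[symmetric]])
    ultimately show False using C.not_dvd_s0[OF p qe] by blast
  qed
  ultimately show ?thesis using that[of u v] uv(1,2) unfolding qe by blast
qed

text \<open>For p = 1 mod 6 the u of the point count is prime to p and starts the recursion for
  \<open>cm_sum\<close>. For p = 5 mod 6 there is a single representation, which the point count
  must use.\<close>

lemma r13_point_count_recurrence:
  fixes p :: nat
  assumes p: "Factorial_Ring.prime p" and k: "p mod 6 = 1 \<and> k \<ge> 1 \<or> p > 3 \<and> even k \<and> k \<ge> 2"
  shows "3 * int (r13 (p ^ k)) = int (N p k) + (if k \<ge> 2 then 3 * int p * int (r13 (p ^ (k - 2))) else 0)"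
proof -
  have k0: "k > 0" using k by auto
  have p56: "p mod 6 = 1 \<or> p mod 6 = 5" if "p > 3"
  proof -
    have "Factorial_Ring.prime (2 :: nat)" "Factorial_Ring.prime (3 :: nat)" by simp_all
    hence "\<not> 2 dvd p" "\<not> 3 dvd p" using primes_dvd_imp_eq[OF _ p] that by fastforce+
    thus ?thesis by presburger
  qed
  have pow1: "p ^ j mod 6 = 1" if "p mod 6 = 1" for j
  proof -
    have "p ^ j mod 6 = (p mod 6) ^ j mod 6" by (rule power_mod[symmetric])
    thus ?thesis unfolding that by simp
  qed
  have pow5: "p ^ (2 * j) mod 6 = 1" if "p mod 6 = 5" for j
  proof -
    have "p ^ (2 * j) mod 6 = (p\<^sup>2 mod 6) ^ j mod 6" unfolding power_mult by (rule power_mod[symmetric])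
    moreover have "p\<^sup>2 mod 6 = (p mod 6)\<^sup>2 mod 6" by (rule power_mod[symmetric])
    ultimately show ?thesis unfolding that by simp
  qed
  show ?thesis
  proof (cases "p mod 6 = 1")
    case True
    obtain u v where uv: "u\<^sup>2 + 3 * v\<^sup>2 = int p ^ k" "u mod 3 = 1" "int (N p k) = int p ^ k + 1 - 2 * u"
      "\<not> int p dvd u"
      using N_representation[OF p k0 pow1[OF True]] True by blast
    show ?thesis
      unfolding uv(3) by (rule r13_recurrence_aux[OF p pow1[OF True] k0
        cm_sum_split_prime[OF p True k0 uv(1,2,4)] pow1[OF True]])
  next
    case False
    hence p3: "p > 3" and ev: "even k" "k \<ge> 2" and p5: "p mod 6 = 5" using k p56 by auto
    obtain m where "k = 2 * m" using ev(1) by (rule evenE)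
    moreover from this obtain n where "m = Suc n" using ev(2) by (cases m) auto
    ultimately have kn: "k = 2 * Suc n" by simp
    have p2: "p mod 3 = 2" using p5 by presburger
    have q: "p ^ k mod 6 = 1" unfolding kn by (rule pow5[OF p5])
    have q': "p ^ (k - 2) mod 6 = 1" using pow5[OF p5, of n] by (simp add: kn)
    obtain u v where uv: "u\<^sup>2 + 3 * v\<^sup>2 = int p ^ k" "u mod 3 = 1" "int (N p k) = int p ^ k + 1 - 2 * u"
      using N_representation[OF p k0 q] by blast
    have "(u, v) \<in> cm_reps (p ^ k)" using uv by (simp add: cm_reps_def)
    hence u: "u = (- int p) ^ Suc n" unfolding kn cm_reps_inert[OF p p3 p2] by simp
    \<comment> \<open>With u = (-p)^(n+1) the recursion reads u = 2u + p (-p)^n, so the one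
      representation satisfies the same formula as the split case.\<close>
    have "cm_sum (p ^ k) = (- int p) ^ Suc n" unfolding kn cm_sum_def cm_reps_inert[OF p p3 p2] by simp
    moreover have "k - 2 = 2 * n" by (simp add: kn)
    hence "cm_sum (p ^ (k - 2)) = (- int p) ^ n" by (simp add: cm_sum_def cm_reps_inert[OF p p3 p2])
    ultimately have "cm_sum (p ^ k) = 2 * u + (if k \<ge> 2 then int p * cm_sum (p ^ (k - 2)) else 0)"
      using ev(2) unfolding u by simp
    from r13_recurrence_aux[OF p q k0 this q'] show ?thesis unfolding uv(3) .
  qed
qed

text \<open>This makes the second term of the recurrence vanish at k = 2, so the threshold k >= 2
  there agrees with the threshold k >= 3 below.\<close>

lemma r13_1: "r13 1 = 0"
  using r13_formula[of 1] cm_sum_1 by simp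

lemma r13_prime_power_relation:
  fixes p :: nat
  assumes p: "Factorial_Ring.prime p" and k: "p mod 6 = 1 \<and> k \<ge> 1 \<or> p > 3 \<and> even k \<and> k \<ge> 2"
  shows "3 * r13 (p ^ k) = (if k \<ge> 3 then N p k + 3 * p * r13 (p ^ (k - 2)) else N p k)"
proof (cases "k \<ge> 3")
  case True
  hence "int (3 * r13 (p ^ k)) = int (N p k + 3 * p * r13 (p ^ (k - 2)))"
    using r13_point_count_recurrence[OF assms] by simp
  thus ?thesis using True by (simp only: of_nat_eq_iff if_True)
next
  case False
  have "(if k \<ge> 2 then 3 * int p * int (r13 (p ^ (k - 2))) else 0) = 0"
  proof (cases "k \<ge> 2")
    case True
    hence "k - 2 = 0" using False by simp
    thus ?thesis using r13_1 by simp
  qed simp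
  hence "3 * int (r13 (p ^ k)) = int (N p k)" using r13_point_count_recurrence[OF assms] by simp
  thus ?thesis using False by simp
qed

text \<open>The recurrence unrolled in steps of 2 down to the exponent \<open>b\<close>, where it
  has no second term; b = 1 and b = 2 give the odd and the even exponents.\<close>

lemma r13_sum_formula:
  fixes p b :: nat
  assumes p: "Factorial_Ring.prime p" and b: "b = 1 \<and> p mod 6 = 1 \<or> b = 2 \<and> p > 3"
  shows "real (r13 (p ^ (2 * k + b))) = 1 / 3 * (\<Sum>j\<le>k. real p ^ j * real (N p (2 * (k - j) + b)))"
proof (induction k)
  case 0
  have "3 * r13 (p ^ b) = N p b" using r13_prime_power_relation[OF p, of b] b by auto
  hence "real (3 * r13 (p ^ b)) = real (N p b)" by (rule arg_cong)
  thus ?case by simp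
next
  case (Suc k)
  have "p mod 6 = 1 \<and> 2 * Suc k + b \<ge> 1 \<or> p > 3 \<and> even (2 * Suc k + b) \<and> 2 * Suc k + b \<ge> 2" using b by auto
  from r13_prime_power_relation[OF p this]
  have "3 * r13 (p ^ (2 * Suc k + b)) = N p (2 * Suc k + b) + 3 * p * r13 (p ^ (2 * k + b))"
    using b by auto
  hence "real (3 * r13 (p ^ (2 * Suc k + b))) = real (N p (2 * Suc k + b) + 3 * p * r13 (p ^ (2 * k + b)))"
    by (rule arg_cong)
  hence "3 * real (r13 (p ^ (2 * Suc k + b))) = real (N p (2 * Suc k + b)) + 3 * real p * real (r13 (p ^ (2 * k + b)))"
    by (simp only: of_nat_add of_nat_mult of_nat_numeral)
  also have "\<dots> = real (N p (2 * Suc k + b)) + real p * (\<Sum>j\<le>k. real p ^ j * real (N p (2 * (k - j) + b)))"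
    unfolding Suc by simp
  also have "\<dots> = (\<Sum>j\<le>Suc k. real p ^ j * real (N p (2 * (Suc k - j) + b)))"
    unfolding sum.atMost_Suc_shift by (simp add: sum_distrib_left mult.assoc)
  finally show ?case by simp
qed

theorem theorem7:
  shows "(\<forall>p::nat. Factorial_Ring.prime p \<and> [p = 1] (mod 6) \<longrightarrow>
            real (r13 p) = 1 / 3 * real (N p 1)) \<and>
         (\<forall>(p::nat) (k::nat). Factorial_Ring.prime p \<and>
            ([p = 1] (mod 6) \<and> k \<ge> 1 \<or> p > 3 \<and> even k \<and> k \<ge> 2) \<longrightarrow>
            3 * r13 (p ^ k) =
              (if k \<ge> 3 then N p k + 3 * p * r13 (p ^ (k - 2)) else N p k)) \<and>
         (\<forall>(p::nat) (k::nat). Factorial_Ring.prime p \<and> [p = 1] (mod 6) \<longrightarrow>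
            real (r13 (p ^ (2 * k + 1))) =
              1 / 3 * (\<Sum>j\<le>k. real p ^ j * real (N p (2 * (k - j) + 1)))) \<and>
         (\<forall>(p::nat) (k::nat). Factorial_Ring.prime p \<and> p > 3 \<longrightarrow>
            real (r13 (p ^ (2 * k + 2))) =
              1 / 3 * (\<Sum>j\<le>k. real p ^ j * real (N p (2 * (k - j) + 2))))"
proof (intro conjI allI impI)
  have c: "[p = 1] (mod 6) \<longleftrightarrow> p mod 6 = 1" for p :: nat by (simp add: cong_def)
  show "real (r13 p) = 1 / 3 * real (N p 1)" if "Factorial_Ring.prime p \<and> [p = 1] (mod 6)" for p
    using r13_sum_formula[of p 1 0] that unfolding c by simp
  show "3 * r13 (p ^ k) = (if k \<ge> 3 then N p k + 3 * p * r13 (p ^ (k - 2)) else N p k)"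
    if "Factorial_Ring.prime p \<and> ([p = 1] (mod 6) \<and> k \<ge> 1 \<or> p > 3 \<and> even k \<and> k \<ge> 2)" for p k
    using r13_prime_power_relation[of p k] that unfolding c by blast
  show "real (r13 (p ^ (2 * k + 1))) = 1 / 3 * (\<Sum>j\<le>k. real p ^ j * real (N p (2 * (k - j) + 1)))"
    if "Factorial_Ring.prime p \<and> [p = 1] (mod 6)" for p k
    using r13_sum_formula[of p 1 k] that unfolding c by blast
  show "real (r13 (p ^ (2 * k + 2))) = 1 / 3 * (\<Sum>j\<le>k. real p ^ j * real (N p (2 * (k - j) + 2)))"
    if "Factorial_Ring.prime p \<and> p > 3" for p k
    using r13_sum_formula[of p 2 k] that by blast
qed

end
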